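(* The operad $\operatorname{Zinb}$ has a unique structure of anticyclic operad such that the quotient map $\operatorname{Dend}\to\operatorname{Zinb}$ is a morphism of anticyclic operads.
   Context: All vector spaces are over $\mathbb{Q}$. The symmetric group $\mathfrak{S}_n$ acts on $\mathcal{P}(n)$ by $(\sigma\cdot E)(x_1,\dots,x_n)=E(x_{\sigma(1)},\dots,x_{\sigma(n)})$. An anticyclic operad is a symmetric operad $\mathcal{P}$ (unit $1\in\mathcal{P}(1)$, partial compositions $\circ_i$) together with an action of $\mathfrak{S}_{n+1}$ on each $\mathcal{P}(n)$ extending the action of $\mathfrak{S}_n$ (the stabilizer of $n+1$), such that, writing $\tau_n$ for the action of the long cycle $(n+1,n,\dots,2,1)$ ($1\mapsto n+1$, $i\mapsto i-1$ for $i\ge 2$): $\tau_1(1)=-1$ and, for $f\in\mathcal{P}(m)$, $g\in\mathcal{P}(n)$, $\tau(f\circ_i g)=\tau_m(f)\circ_{i-1}g$ for $2\le i\le m$ and $\tau(f\circ_1 g)=-\tau_n(g)\circ_n\tau_m(f)$. A morphism of anticyclic operads is a morphism of operads commuting with the actions of $\mathfrak{S}_{n+1}$. A non-symmetric anticyclic operad is a non-symmetric operad with endomorphisms $\tau_n$ of $\mathcal{P}(n)$ satisfying $\tau_n^{n+1}=\mathrm{Id}$ and these same identities. If $\mathcal{P}$ is a non-symmetric anticyclic operad, the symmetric operad with components $\mathcal{P}(n)\otimes\mathbb{Q}\mathfrak{S}_n\cong\operatorname{Ind}_{\mathbb{Z}/(n+1)\mathbb{Z}}^{\mathfrak{S}_{n+1}}\mathcal{P}(n)$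 is naturally an anticyclic operad, with $\tau_n(E\otimes 1)=\tau_n(E)\otimes 1$. The non-symmetric operad $\operatorname{Dend}$ is generated by binary operations $x\prec y$, $x\succ y$ with relations $(x\prec y)\prec z=x\prec(y\prec z)+x\prec(y\succ z)$, $x\succ(y\prec z)=(x\succ y)\prec z$, $x\succ(y\succ z)=(x\succ y)\succ z+(x\prec y)\succ z$. It is a non-symmetric anticyclic operad with the unique structure such that $\tau_1=-\mathrm{Id}$, $\tau_2(x_1\succ x_2)=x_1\prec x_2$, $\tau_2(x_1\prec x_2)=-x_1\prec x_2-x_1\succ x_2$. In the claim, $\operatorname{Dend}$ denotes the associated (symmetric) anticyclic operad. $\operatorname{Zinb}$ is the quotient of the symmetric operad $\operatorname{Dend}$ by the ideal generated by $x_1\prec x_2-x_2\succ x_1$; denoting by $x_1x_2$ the image of $x_1\prec x_2$, it is generated by the binary product $xy$ (no symmetry) with relation $(xy)z=x(yz)+x(zy)$. *)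

theory Defs
  imports
    "HOL-Algebra.AbelCoset"
    "HOL-Algebra.Module"
    "HOL-Algebra.Algebraic_Closure_Type"
    "HOL-Combinatorics.Permutations"
    "HOL-Library.FuncSet"
    "HOL-Library.Tree"
    "HOL-Library.Poly_Mapping"
begin

section \<open>Rational vector spaces\<close>

text \<open>
  A vector space over the rationals is a module, in the sense of HOL-Algebra, over the field of
  rational numbers. The fields \<open>mult\<close> and \<open>one\<close> of a module record carry no meaning.
\<close>

abbreviation rat_field :: "rat ring" where
  "rat_field \<equiv> ring_of_type_algebra"

definition linear_maps :: "(rat, 'a) module \<Rightarrow> (rat, 'b) module \<Rightarrow> ('a \<Rightarrow> 'b) set" where
  "linear_maps M N = {h \<in> carrier M \<rightarrow> carrier N.
     (\<forall>x\<in>carrier M. \<forall>y\<in>carrier M. h (x \<oplus>\<^bsub>M\<^esub> y) = h x \<oplus>\<^bsub>N\<^esub> h y) \<and>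
     (\<forall>c. \<forall>x\<in>carrier M. h (c \<odot>\<^bsub>M\<^esub> x) = c \<odot>\<^bsub>N\<^esub> h x)}"

definition quot_module :: "(rat, 'a) module \<Rightarrow> 'a set \<Rightarrow> (rat, 'a set) module" where
  "quot_module M N =
     \<lparr>carrier = a_rcosets\<^bsub>M\<^esub> N,
      monoid.mult = undefined, one = undefined,
      zero = N,
      add = (<+>\<^bsub>M\<^esub>),
      module.smult = (\<lambda>c U. \<Union>x\<in>U. N +>\<^bsub>M\<^esub> (c \<odot>\<^bsub>M\<^esub> x))\<rparr>"


section \<open>Operads\<close>

text \<open>
  Operads have components in arities \<open>n \<ge> 1\<close> only; whatever a record contains in arity \<open>0\<close> is
  irrelevant. The term \<open>pcomp P m n i f g\<close> is the partial composition \<open>f \<circ>\<^sub>i g\<close> of \<open>f \<in> P(m)\<close> and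
  \<open>g \<in> P(n)\<close>, for \<open>1 \<le> i \<le> m\<close>; it lies in \<open>P(m + n - 1)\<close>.
\<close>

record 'a operad =
  comp_space :: "nat \<Rightarrow> (rat, 'a) module"
  op_unit :: 'a
  pcomp :: "nat \<Rightarrow> nat \<Rightarrow> nat \<Rightarrow> 'a \<Rightarrow> 'a \<Rightarrow> 'a"

abbreviation elems :: "('a, 'm) operad_scheme \<Rightarrow> nat \<Rightarrow> 'a set" where
  "elems P n \<equiv> carrier (comp_space P n)"

locale ns_operad =
  fixes P :: "('a, 'm) operad_scheme"
  assumes comp_space: "1 \<le> n \<Longrightarrow> module rat_field (comp_space P n)"
    and unit_closed: "op_unit P \<in> elems P 1"
    and pcomp_linear_left: "\<lbrakk>1 \<le> i; i \<le> m; 1 \<le> n; g \<in> elems P n\<rbrakk> \<Longrightarrow>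
      (\<lambda>f. pcomp P m n i f g) \<in> linear_maps (comp_space P m) (comp_space P (m + n - 1))"
    and pcomp_linear_right: "\<lbrakk>1 \<le> i; i \<le> m; 1 \<le> n; f \<in> elems P m\<rbrakk> \<Longrightarrow>
      (\<lambda>g. pcomp P m n i f g) \<in> linear_maps (comp_space P n) (comp_space P (m + n - 1))"
    and unit_left: "\<lbrakk>1 \<le> n; g \<in> elems P n\<rbrakk> \<Longrightarrow> pcomp P 1 n 1 (op_unit P) g = g"
    and unit_right: "\<lbrakk>1 \<le> i; i \<le> m; f \<in> elems P m\<rbrakk> \<Longrightarrow> pcomp P m 1 i f (op_unit P) = f"
    and assoc_sequential:
      "\<lbrakk>1 \<le> i; i \<le> m; 1 \<le> j; j \<le> n; 1 \<le> l; f \<in> elems P m; g \<in> elems P n; h \<in> elems P l\<rbrakk> \<Longrightarrow>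
       pcomp P (m + n - 1) l (i + j - 1) (pcomp P m n i f g) h
         = pcomp P m (n + l - 1) i f (pcomp P n l j g h)"
    and assoc_parallel:
      "\<lbrakk>1 \<le> i; i < k; k \<le> m; 1 \<le> n; 1 \<le> l; f \<in> elems P m; g \<in> elems P n; h \<in> elems P l\<rbrakk> \<Longrightarrow>
       pcomp P (m + n - 1) l (k + n - 1) (pcomp P m n i f g) h
         = pcomp P (m + l - 1) n i (pcomp P m l k f h) g"

text \<open>
  With \<open>(\<sigma> f)(x\<^sub>1,\<dots>,x\<^sub>n) = f(x\<^bsub>\<sigma>(1)\<^esub>,\<dots>,x\<^bsub>\<sigma>(n)\<^esub>)\<close>, for \<open>\<sigma>\<close> a permutation of \<open>{1..m}\<close>, \<open>\<rho>\<close> a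
  permutation of \<open>{1..n}\<close> and \<open>1 \<le> k \<le> m\<close>, the variables of \<open>(\<sigma> f) \<circ>\<^bsub>\<sigma>(k)\<^esub> (\<rho> g)\<close>, read from left
  to right in the slots of \<open>f \<circ>\<^sub>k g\<close>, are those of index \<open>perm_comp n k \<sigma> \<rho> p\<close> for
  \<open>p = 1,\<dots>,m+n-1\<close>.
\<close>

definition perm_comp ::
    "nat \<Rightarrow> nat \<Rightarrow> (nat \<Rightarrow> nat) \<Rightarrow> (nat \<Rightarrow> nat) \<Rightarrow> nat \<Rightarrow> nat" where
  "perm_comp n k \<sigma> \<rho> p =
     (let shift = (\<lambda>j. if j < \<sigma> k then j else j + n - 1) in
      if p < k then shift (\<sigma> p)
      else if p < k + n then \<sigma> k - 1 + \<rho> (p + 1 - k)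
      else shift (\<sigma> (p + 1 - n)))"

record 'a sym_operad = "'a operad" +
  perm_act :: "nat \<Rightarrow> (nat \<Rightarrow> nat) \<Rightarrow> 'a \<Rightarrow> 'a"

locale sym_operad = ns_operad P for P :: "('a, 'm) sym_operad_scheme" +
  assumes perm_act_linear: "\<lbrakk>1 \<le> n; \<sigma> permutes {1..n}\<rbrakk> \<Longrightarrow>
      perm_act P n \<sigma> \<in> linear_maps (comp_space P n) (comp_space P n)"
    and perm_act_id: "\<lbrakk>1 \<le> n; f \<in> elems P n\<rbrakk> \<Longrightarrow> perm_act P n id f = f"
    and perm_act_comp: "\<lbrakk>1 \<le> n; \<sigma> permutes {1..n}; \<rho> permutes {1..n}; f \<in> elems P n\<rbrakk> \<Longrightarrow>
      perm_act P n (\<sigma> \<circ> \<rho>) f = perm_act P n \<sigma> (perm_act P n \<rho> f)"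
    and equivariant:
      "\<lbrakk>1 \<le> k; k \<le> m; 1 \<le> n; \<sigma> permutes {1..m}; \<rho> permutes {1..n}; f \<in> elems P m; g \<in> elems P n\<rbrakk>
       \<Longrightarrow> pcomp P m n (\<sigma> k) (perm_act P m \<sigma> f) (perm_act P n \<rho> g)
           = perm_act P (m + n - 1) (perm_comp n k \<sigma> \<rho>) (pcomp P m n k f g)"


subsection \<open>Ideals, quotients and morphisms\<close>

definition operad_ideal :: "('a, 'm) operad_scheme \<Rightarrow> (nat \<Rightarrow> 'a set) \<Rightarrow> bool" where
  "operad_ideal P I \<longleftrightarrow>
     (\<forall>n\<ge>1. submodule (I n) rat_field (comp_space P n)) \<and>
     (\<forall>m n i. 1 \<le> i \<and> i \<le> m \<and> 1 \<le> n \<longrightarrow>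
        (\<forall>f\<in>elems P m. \<forall>g\<in>I n. pcomp P m n i f g \<in> I (m + n - 1)) \<and>
        (\<forall>f\<in>I m. \<forall>g\<in>elems P n. pcomp P m n i f g \<in> I (m + n - 1)))"

definition sym_operad_ideal :: "('a, 'm) sym_operad_scheme \<Rightarrow> (nat \<Rightarrow> 'a set) \<Rightarrow> bool" where
  "sym_operad_ideal P I \<longleftrightarrow> operad_ideal P I \<and>
     (\<forall>n\<ge>1. \<forall>\<sigma>. \<sigma> permutes {1..n} \<longrightarrow> (\<forall>f\<in>I n. perm_act P n \<sigma> f \<in> I n))"

text \<open>The least ideal, among those satisfying \<open>is_ideal\<close>, containing the family \<open>S\<close>.\<close>

definition ideal_generated ::
    "((nat \<Rightarrow> 'a set) \<Rightarrow> bool) \<Rightarrow> (nat \<Rightarrow> 'a set) \<Rightarrow> nat \<Rightarrow> 'a set" where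
  "ideal_generated is_ideal S n = \<Inter>{I n | I. is_ideal I \<and> (\<forall>k. S k \<subseteq> I k)}"

definition quot_proj ::
    "('a, 'm) operad_scheme \<Rightarrow> (nat \<Rightarrow> 'a set) \<Rightarrow> nat \<Rightarrow> 'a \<Rightarrow> 'a set" where
  "quot_proj P I n f = I n +>\<^bsub>comp_space P n\<^esub> f"

definition quot_operad ::
    "('a, 'm) operad_scheme \<Rightarrow> (nat \<Rightarrow> 'a set) \<Rightarrow> 'a set operad" where
  "quot_operad P I =
     \<lparr>comp_space = (\<lambda>n. quot_module (comp_space P n) (I n)),
      op_unit = quot_proj P I 1 (op_unit P),
      pcomp = (\<lambda>m n i U V. \<Union>f\<in>U. \<Union>g\<in>V. quot_proj P I (m + n - 1) (pcomp P m n i f g))\<rparr>"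

definition quot_sym_operad ::
    "('a, 'm) sym_operad_scheme \<Rightarrow> (nat \<Rightarrow> 'a set) \<Rightarrow> 'a set sym_operad" where
  "quot_sym_operad P I =
     operad.extend (quot_operad P I)
       \<lparr>perm_act = (\<lambda>n \<sigma> U. \<Union>f\<in>U. quot_proj P I n (perm_act P n \<sigma> f))\<rparr>"

locale sym_operad_hom = source: sym_operad P + target: sym_operad Q
  for P :: "('a, 'm) sym_operad_scheme" and Q :: "('b, 'k) sym_operad_scheme" +
  fixes \<phi> :: "nat \<Rightarrow> 'a \<Rightarrow> 'b"
  assumes hom_linear: "1 \<le> n \<Longrightarrow> \<phi> n \<in> linear_maps (comp_space P n) (comp_space Q n)"
    and hom_unit: "\<phi> 1 (op_unit P) = op_unit Q"
    and hom_pcomp: "\<lbrakk>1 \<le> i; i \<le> m; 1 \<le> n; f \<in> elems P m; g \<in> elems P n\<rbrakk> \<Longrightarrow>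
      \<phi> (m + n - 1) (pcomp P m n i f g) = pcomp Q m n i (\<phi> m f) (\<phi> n g)"
    and hom_perm_act: "\<lbrakk>1 \<le> n; \<sigma> permutes {1..n}; f \<in> elems P n\<rbrakk> \<Longrightarrow>
      \<phi> n (perm_act P n \<sigma> f) = perm_act Q n \<sigma> (\<phi> n f)"


section \<open>Anticyclic operads\<close>

definition long_cycle :: "nat \<Rightarrow> nat \<Rightarrow> nat" where
  "long_cycle n i =
     (if i = 1 then n + 1 else if 2 \<le> i \<and> i \<le> n + 1 then i - 1 else i)"

locale ns_anticyclic_operad = ns_operad P for P :: "('a, 'm) operad_scheme" +
  fixes \<tau> :: "nat \<Rightarrow> 'a \<Rightarrow> 'a"
  assumes tau_linear: "1 \<le> n \<Longrightarrow> \<tau> n \<in> linear_maps (comp_space P n) (comp_space P n)"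
    and tau_order: "\<lbrakk>1 \<le> n; f \<in> elems P n\<rbrakk> \<Longrightarrow> (\<tau> n ^^ (n + 1)) f = f"
    and tau_unit: "\<tau> 1 (op_unit P) = \<ominus>\<^bsub>comp_space P 1\<^esub> op_unit P"
    and tau_pcomp: "\<lbrakk>2 \<le> i; i \<le> m; 1 \<le> n; f \<in> elems P m; g \<in> elems P n\<rbrakk> \<Longrightarrow>
      \<tau> (m + n - 1) (pcomp P m n i f g) = pcomp P m n (i - 1) (\<tau> m f) g"
    and tau_pcomp_1: "\<lbrakk>1 \<le> m; 1 \<le> n; f \<in> elems P m; g \<in> elems P n\<rbrakk> \<Longrightarrow>
      \<tau> (m + n - 1) (pcomp P m n 1 f g)
        = \<ominus>\<^bsub>comp_space P (m + n - 1)\<^esub> pcomp P n m n (\<tau> n g) (\<tau> m f)"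

text \<open>Here \<open>A n\<close> is the action on \<open>P(n)\<close> of the permutations of \<open>{1..n+1}\<close>.\<close>

locale anticyclic_operad = sym_operad P for P :: "('a, 'm) sym_operad_scheme" +
  fixes A :: "nat \<Rightarrow> (nat \<Rightarrow> nat) \<Rightarrow> 'a \<Rightarrow> 'a"
  assumes act_linear: "\<lbrakk>1 \<le> n; \<sigma> permutes {1..n + 1}\<rbrakk> \<Longrightarrow>
      A n \<sigma> \<in> linear_maps (comp_space P n) (comp_space P n)"
    and act_id: "\<lbrakk>1 \<le> n; f \<in> elems P n\<rbrakk> \<Longrightarrow> A n id f = f"
    and act_comp:
      "\<lbrakk>1 \<le> n; \<sigma> permutes {1..n + 1}; \<rho> permutes {1..n + 1}; f \<in> elems P n\<rbrakk> \<Longrightarrow>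
      A n (\<sigma> \<circ> \<rho>) f = A n \<sigma> (A n \<rho> f)"
    and act_extends: "\<lbrakk>1 \<le> n; \<sigma> permutes {1..n}; f \<in> elems P n\<rbrakk> \<Longrightarrow> A n \<sigma> f = perm_act P n \<sigma> f"
    and cycle_unit: "A 1 (long_cycle 1) (op_unit P) = \<ominus>\<^bsub>comp_space P 1\<^esub> op_unit P"
    and cycle_pcomp: "\<lbrakk>2 \<le> i; i \<le> m; 1 \<le> n; f \<in> elems P m; g \<in> elems P n\<rbrakk> \<Longrightarrow>
      A (m + n - 1) (long_cycle (m + n - 1)) (pcomp P m n i f g)
        = pcomp P m n (i - 1) (A m (long_cycle m) f) g"
    and cycle_pcomp_1: "\<lbrakk>1 \<le> m; 1 \<le> n; f \<in> elems P m; g \<in> elems P n\<rbrakk> \<Longrightarrow>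
      A (m + n - 1) (long_cycle (m + n - 1)) (pcomp P m n 1 f g)
        = \<ominus>\<^bsub>comp_space P (m + n - 1)\<^esub>
            pcomp P n m n (A n (long_cycle n) g) (A m (long_cycle m) f)"

locale anticyclic_operad_hom =
  sym_operad_hom P Q \<phi> + source: anticyclic_operad P A + target: anticyclic_operad Q B
  for P :: "('a, 'm) sym_operad_scheme" and A
    and Q :: "('b, 'k) sym_operad_scheme" and B
    and \<phi> +
  assumes hom_act: "\<lbrakk>1 \<le> n; \<sigma> permutes {1..n + 1}; f \<in> elems P n\<rbrakk> \<Longrightarrow>
      \<phi> n (A n \<sigma> f) = B n \<sigma> (\<phi> n f)"

text \<open>
  Families of maps on the components are HOL functions on whole types. The next two conditions
  fix their values at arguments without mathematical meaning, so that equality of HOL functions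
  is equality of families of maps.
\<close>

definition extensional_tau :: "('a, 'm) operad_scheme \<Rightarrow> (nat \<Rightarrow> 'a \<Rightarrow> 'a) \<Rightarrow> bool" where
  "extensional_tau P \<tau> \<longleftrightarrow>
     (\<forall>n f. \<not> (1 \<le> n \<and> f \<in> elems P n) \<longrightarrow> \<tau> n f = undefined)"

definition extensional_act ::
    "('a, 'm) operad_scheme \<Rightarrow> (nat \<Rightarrow> (nat \<Rightarrow> nat) \<Rightarrow> 'a \<Rightarrow> 'a) \<Rightarrow> bool" where
  "extensional_act P A \<longleftrightarrow>
     (\<forall>n \<sigma> f. \<not> (1 \<le> n \<and> \<sigma> permutes {1..n + 1} \<and> f \<in> elems P n) \<longrightarrow> A n \<sigma> f = undefined)"


section \<open>Symmetrization of a non-symmetric operad\<close>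

abbreviation perms :: "nat \<Rightarrow> (nat \<Rightarrow> nat) set" where
  "perms n \<equiv> {\<sigma>. \<sigma> permutes {1..n}}"

abbreviation perm_inv :: "(nat \<Rightarrow> nat) \<Rightarrow> nat \<Rightarrow> nat" where
  "perm_inv \<sigma> \<equiv> inv_into UNIV \<sigma>"

text \<open>
  An element \<open>\<Sum>\<^sub>\<sigma> E\<^sub>\<sigma> \<otimes> \<sigma>\<close> of the tensor product of \<open>P(n)\<close> with the group algebra of the symmetric
  group is the function \<open>F\<close> with \<open>F \<sigma> = E\<^sub>\<sigma>\<close>. The tensor \<open>E \<otimes> \<sigma>\<close> stands for the operation
  \<open>E(x\<^bsub>\<sigma>(1)\<^esub>,\<dots>,x\<^bsub>\<sigma>(n)\<^esub>)\<close>, i.e. for \<open>\<sigma> (E \<otimes> 1)\<close>. Hence \<open>\<rho> (E \<otimes> \<sigma>) = E \<otimes> \<rho>\<sigma>\<close>, and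
  equivariance imposes
  \<open>(E \<otimes> \<sigma>) \<circ>\<^bsub>\<sigma>(k)\<^esub> (E' \<otimes> \<rho>) = (E \<circ>\<^sub>k E') \<otimes> perm_comp n k \<sigma> \<rho>\<close>.
\<close>

definition pure_tensor ::
    "('a, 'm) operad_scheme \<Rightarrow> nat \<Rightarrow> 'a \<Rightarrow> (nat \<Rightarrow> nat) \<Rightarrow> ((nat \<Rightarrow> nat) \<Rightarrow> 'a)" where
  "pure_tensor P n E \<sigma> = (\<lambda>\<theta>\<in>perms n. if \<theta> = \<sigma> then E else \<zero>\<^bsub>comp_space P n\<^esub>)"

definition symmetrization ::
    "('a, 'm) operad_scheme \<Rightarrow> ((nat \<Rightarrow> nat) \<Rightarrow> 'a) sym_operad" where
  "symmetrization P =
     \<lparr>comp_space = (\<lambda>n.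
        \<lparr>carrier = perms n \<rightarrow>\<^sub>E elems P n,
         monoid.mult = undefined, one = undefined,
         zero = (\<lambda>\<theta>\<in>perms n. \<zero>\<^bsub>comp_space P n\<^esub>),
         add = (\<lambda>F G. \<lambda>\<theta>\<in>perms n. F \<theta> \<oplus>\<^bsub>comp_space P n\<^esub> G \<theta>),
         module.smult = (\<lambda>c F. \<lambda>\<theta>\<in>perms n. c \<odot>\<^bsub>comp_space P n\<^esub> F \<theta>)\<rparr>),
      op_unit = pure_tensor P 1 (op_unit P) id,
      pcomp = (\<lambda>m n i F G. \<lambda>\<theta>\<in>perms (m + n - 1).
        finsum (comp_space P (m + n - 1))
          (\<lambda>(\<sigma>, \<rho>). pcomp P m n (perm_inv \<sigma> i) (F \<sigma>) (G \<rho>))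
          {(\<sigma>, \<rho>) \<in> perms m \<times> perms n. perm_comp n (perm_inv \<sigma> i) \<sigma> \<rho> = \<theta>}),
      perm_act = (\<lambda>n \<rho> F. \<lambda>\<theta>\<in>perms n. F (perm_inv \<rho> \<circ> \<theta>))\<rparr>"

text \<open>
  Let \<open>c\<close> be the long cycle on \<open>{1..n+1}\<close>. Every permutation of \<open>{1..n+1}\<close> is \<open>\<theta> c\<^sup>k\<close> for a unique
  permutation \<open>\<theta>\<close> of \<open>{1..n}\<close> and a unique \<open>k\<close> with \<open>0 \<le> k \<le> n\<close>, and
  \<open>c\<close> acts by \<open>c (E \<otimes> 1) = \<tau>(E) \<otimes> 1\<close>, so that
  \<open>\<rho> (E \<otimes> \<sigma>) = \<rho>\<sigma> (E \<otimes> 1) = \<tau>\<^sup>k(E) \<otimes> \<theta>\<close> where \<open>\<rho>\<sigma> = \<theta> c\<^sup>k\<close>. For given \<open>\<rho>\<close> and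
  \<open>\<theta>\<close>, evaluating this equation at \<open>n + 1\<close>, which is fixed by \<open>\<sigma>\<close>, gives \<open>\<rho>(n+1) = \<theta>(n+1-k)\<close>;
  this determines \<open>k\<close>, and then \<open>\<sigma> = \<rho>\<^sup>-\<^sup>1 \<theta> c\<^sup>k\<close>.
\<close>

definition symmetrization_act ::
    "(nat \<Rightarrow> 'a \<Rightarrow> 'a) \<Rightarrow> nat \<Rightarrow> (nat \<Rightarrow> nat) \<Rightarrow> ((nat \<Rightarrow> nat) \<Rightarrow> 'a) \<Rightarrow> ((nat \<Rightarrow> nat) \<Rightarrow> 'a)" where
  "symmetrization_act \<tau> n \<rho> F = (\<lambda>\<theta>\<in>perms n.
     let k = n + 1 - perm_inv \<theta> (\<rho> (n + 1))
     in (\<tau> n ^^ k) (F (perm_inv \<rho> \<circ> \<theta> \<circ> (long_cycle n ^^ k))))"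


section \<open>The free non-symmetric operad on a set of binary operations\<close>

text \<open>
  A basis in arity \<open>n\<close> is given by the planar binary trees with \<open>n\<close> leaves and with inner nodes
  labelled by generators; \<open>graft i s t\<close> replaces the \<open>i\<close>-th leaf of \<open>s\<close> by \<open>t\<close>.
\<close>

fun graft :: "nat \<Rightarrow> 'g tree \<Rightarrow> 'g tree \<Rightarrow> 'g tree" where
  "graft i \<langle>\<rangle> t = t"
| "graft i \<langle>l, g, r\<rangle> t =
     (if i \<le> size1 l then \<langle>graft i l t, g, r\<rangle> else \<langle>l, g, graft (i - size1 l) r t\<rangle>)"

definition free_binary_operad :: "('g tree \<Rightarrow>\<^sub>0 rat) operad" where
  "free_binary_operad =
     \<lparr>comp_space = (\<lambda>n.
        \<lparr>carrier = {p. Poly_Mapping.keys p \<subseteq> {t. size1 t = n}},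
         monoid.mult = undefined, one = undefined,
         zero = 0,
         add = (+),
         module.smult = (\<lambda>c. Poly_Mapping.map ((*) c))\<rparr>),
      op_unit = Poly_Mapping.single \<langle>\<rangle> 1,
      pcomp = (\<lambda>m n i p q. \<Sum>s\<in>Poly_Mapping.keys p. \<Sum>t\<in>Poly_Mapping.keys q.
        Poly_Mapping.single (graft i s t) (Poly_Mapping.lookup p s * Poly_Mapping.lookup q t))\<rparr>"


section \<open>The operads Dend and Zinb\<close>

datatype dend_gen = Prec | Succ

text \<open>The leaves of a tree stand for the variables \<open>x, y, z\<close> from left to right.\<close>

abbreviation tree_monomial :: "dend_gen tree \<Rightarrow> dend_gen tree \<Rightarrow>\<^sub>0 rat" where
  "tree_monomial t \<equiv> Poly_Mapping.single t 1"

definition dend_relations :: "nat \<Rightarrow> (dend_gen tree \<Rightarrow>\<^sub>0 rat) set" where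
  "dend_relations n = (if n = 3 then
     {tree_monomial \<langle>\<langle>\<langle>\<rangle>, Prec, \<langle>\<rangle>\<rangle>, Prec, \<langle>\<rangle>\<rangle>
        - (tree_monomial \<langle>\<langle>\<rangle>, Prec, \<langle>\<langle>\<rangle>, Prec, \<langle>\<rangle>\<rangle>\<rangle> + tree_monomial \<langle>\<langle>\<rangle>, Prec, \<langle>\<langle>\<rangle>, Succ, \<langle>\<rangle>\<rangle>\<rangle>),
      tree_monomial \<langle>\<langle>\<rangle>, Succ, \<langle>\<langle>\<rangle>, Prec, \<langle>\<rangle>\<rangle>\<rangle>
        - tree_monomial \<langle>\<langle>\<langle>\<rangle>, Succ, \<langle>\<rangle>\<rangle>, Prec, \<langle>\<rangle>\<rangle>,
      tree_monomial \<langle>\<langle>\<rangle>, Succ, \<langle>\<langle>\<rangle>, Succ, \<langle>\<rangle>\<rangle>\<rangle>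
        - (tree_monomial \<langle>\<langle>\<langle>\<rangle>, Succ, \<langle>\<rangle>\<rangle>, Succ, \<langle>\<rangle>\<rangle> + tree_monomial \<langle>\<langle>\<langle>\<rangle>, Prec, \<langle>\<rangle>\<rangle>, Succ, \<langle>\<rangle>\<rangle>)}
     else {})"

definition dend_ideal :: "nat \<Rightarrow> (dend_gen tree \<Rightarrow>\<^sub>0 rat) set" where
  "dend_ideal = ideal_generated (operad_ideal free_binary_operad) dend_relations"

type_synonym ns_dend_elem = "(dend_gen tree \<Rightarrow>\<^sub>0 rat) set"

definition ns_Dend :: "ns_dend_elem operad" where
  "ns_Dend = quot_operad free_binary_operad dend_ideal"

definition dend_op :: "dend_gen \<Rightarrow> ns_dend_elem" where
  "dend_op g = quot_proj free_binary_operad dend_ideal 2 (tree_monomial \<langle>\<langle>\<rangle>, g, \<langle>\<rangle>\<rangle>)"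

definition dend_tau :: "nat \<Rightarrow> ns_dend_elem \<Rightarrow> ns_dend_elem" where
  "dend_tau = (THE \<tau>.
     extensional_tau ns_Dend \<tau> \<and>
     ns_anticyclic_operad ns_Dend \<tau> \<and>
     (\<forall>f\<in>elems ns_Dend 1. \<tau> 1 f = \<ominus>\<^bsub>comp_space ns_Dend 1\<^esub> f) \<and>
     \<tau> 2 (dend_op Succ) = dend_op Prec \<and>
     \<tau> 2 (dend_op Prec) =
       (\<ominus>\<^bsub>comp_space ns_Dend 2\<^esub> dend_op Prec) \<ominus>\<^bsub>comp_space ns_Dend 2\<^esub> dend_op Succ)"

type_synonym dend_elem = "(nat \<Rightarrow> nat) \<Rightarrow> ns_dend_elem"

definition Dend :: "dend_elem sym_operad" where
  "Dend = symmetrization ns_Dend"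

definition dend_act :: "nat \<Rightarrow> (nat \<Rightarrow> nat) \<Rightarrow> dend_elem \<Rightarrow> dend_elem" where
  "dend_act = symmetrization_act dend_tau"

text \<open>The only relation is \<open>x\<^sub>1 \<prec> x\<^sub>2 - x\<^sub>2 \<succ> x\<^sub>1\<close>.\<close>

definition zinb_relations :: "nat \<Rightarrow> dend_elem set" where
  "zinb_relations n = (if n = 2 then
     {pure_tensor ns_Dend 2 (dend_op Prec) id
        \<ominus>\<^bsub>comp_space Dend 2\<^esub> pure_tensor ns_Dend 2 (dend_op Succ) (transpose 1 2)}
     else {})"

definition zinb_ideal :: "nat \<Rightarrow> dend_elem set" where
  "zinb_ideal = ideal_generated (sym_operad_ideal Dend) zinb_relations"

definition Zinb :: "dend_elem set sym_operad" where
  "Zinb = quot_sym_operad Dend zinb_ideal"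

definition zinb_proj :: "nat \<Rightarrow> dend_elem \<Rightarrow> dend_elem set" where
  "zinb_proj = quot_proj Dend zinb_ideal"

end

theory Submission
  imports Defs
begin

text \<open>
  An action on \<open>Zinb\<close> for which the projection is a morphism is determined by the action on \<open>Dend\<close>,
  because the projection is onto; this is uniqueness. It exists if and only if the kernel of the
  projection, the ideal generated by \<open>r = x\<^sub>1 \<prec> x\<^sub>2 - x\<^sub>2 \<succ> x\<^sub>1\<close>, is stable under the symmetric groups
  on \<open>n + 1\<close> letters. Two facts give this stability.

  First, stability of an ideal can be tested on generators (\<open>act_stable_ideal\<close>). The elements whose
  whole orbit lies in the ideal \<open>I\<close> form an ideal \<open>J\<close>: the long cycle \<open>c\<close> sends \<open>f \<circ>\<^sub>i g\<close> either to
  \<open>(c f) \<circ>\<^bsub>i-1\<^esub> g\<close> or to \<open>- (c g) \<circ>\<^sub>n (c f)\<close>, so all its powers keep a composition with an element of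
  \<open>J\<close> inside \<open>I\<close>, and every permutation of \<open>n + 1\<close> letters is one of \<open>n\<close> letters times a power of
  \<open>c\<close>. Second, if \<open>s\<close> is the transposition of the two variables, then \<open>c r = - r + s r\<close> and
  \<open>c\<^sup>2 r = - s r\<close> (\<open>dend_act_zinb_relations\<close>), so the orbit of \<open>r\<close> lies in the ideal.

  Before this argument can start, \<open>Dend\<close> has to be known to be an anticyclic operad.

  \<^item> The non-symmetric \<open>Dend\<close> is a quotient of the free operad on two binary operations, where a
    tree is \<open>(g \<circ>\<^sub>2 r) \<circ>\<^sub>1 l\<close> with root \<open>g\<close> and subtrees \<open>l\<close> and \<open>r\<close>. The identities for \<open>\<tau>\<close> of a
    composition thus define \<open>\<tau>\<close> on trees by recursion. It has order \<open>n + 1\<close> in arity \<open>n\<close> because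
    this property passes from two elements to their composition (\<open>tau_order_comp\<close>) and holds for
    the generators. It maps the span of the three relations of \<open>Dend\<close> to itself, hence preserves
    the ideal of relations (\<open>tau_stable_ideal\<close>). Since \<open>Dend\<close> is generated by its two operations,
    the structure obtained on the quotient is the only one with the given values
    (\<open>dend_tau_unique\<close>), which identifies it with \<open>dend_tau\<close>.

  \<^item> The symmetrization of a non-symmetric anticyclic operad is anticyclic. All operations are
    linear in each argument, so the axioms have to be checked on pure tensors only. On them \<open>\<rho>\<close> acts
    by \<open>\<rho> (E \<otimes> \<sigma>) = \<tau>\<^sup>k(E) \<otimes> \<theta>\<close> for any factorization \<open>\<rho>\<sigma> = \<theta>c\<^sup>k\<close> (\<open>act_pure\<close>). Each axiom becomes
    the same axiom of the non-symmetric operad together with an identity between permutations. The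
    latter are checked on positions: an input of a composition comes from exactly one of the
    operations that are composed.
\<close>


section \<open>Rational vector spaces, linear maps and quotients\<close>

text \<open>Arities are written \<open>m + n - 1\<close> and positions start at \<open>1\<close>, which therefore stays a numeral.\<close>

declare One_nat_def [simp del]

lemma rat_field_simps [simp]:
  "carrier rat_field = UNIV" "add rat_field = (+)" "monoid.mult rat_field = (*)"
  "zero rat_field = 0" "one rat_field = 1"
  by (simp_all add: ring_of_type_algebra_def)

lemma cring_rat_field: "cring rat_field"
  by (rule cring_from_type_algebra)

text \<open>Negatives need no axiom of their own: they are the multiples by \<open>-1\<close>.\<close>

lemma rat_moduleI:
  fixes M (structure)
  assumes zero: "\<zero> \<in> carrier M"
    and add: "\<And>x y. x \<in> carrier M \<Longrightarrow> y \<in> carrier M \<Longrightarrow> x \<oplus> y \<in> carrier M"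
    and smult: "\<And>c x. x \<in> carrier M \<Longrightarrow> c \<odot> x \<in> carrier M"
    and assoc: "\<And>x y z. x \<in> carrier M \<Longrightarrow> y \<in> carrier M \<Longrightarrow> z \<in> carrier M \<Longrightarrow>
      (x \<oplus> y) \<oplus> z = x \<oplus> (y \<oplus> z)"
    and comm: "\<And>x y. x \<in> carrier M \<Longrightarrow> y \<in> carrier M \<Longrightarrow> x \<oplus> y = y \<oplus> x"
    and l_zero: "\<And>x. x \<in> carrier M \<Longrightarrow> \<zero> \<oplus> x = x"
    and smult_0: "\<And>x. x \<in> carrier M \<Longrightarrow> 0 \<odot> x = \<zero>"
    and smult_1: "\<And>x. x \<in> carrier M \<Longrightarrow> 1 \<odot> x = x"
    and smult_l_distr: "\<And>b c x. x \<in> carrier M \<Longrightarrow> (b + c) \<odot> x = b \<odot> x \<oplus> c \<odot> x"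
    and smult_r_distr: "\<And>c x y. x \<in> carrier M \<Longrightarrow> y \<in> carrier M \<Longrightarrow>
      c \<odot> (x \<oplus> y) = c \<odot> x \<oplus> c \<odot> y"
    and smult_assoc: "\<And>b c x. x \<in> carrier M \<Longrightarrow> (b * c) \<odot> x = b \<odot> (c \<odot> x)"
  shows "module rat_field M"
proof (rule moduleI)
  have neg: "((-1) \<odot> x) \<oplus> x = \<zero>" if "x \<in> carrier M" for x
    using smult_l_distr[OF that, of "-1" 1] smult_0[OF that] smult_1[OF that] by simp
  show "abelian_group M"
  proof (rule abelian_groupI)
    show "\<exists>y\<in>carrier M. y \<oplus> x = \<zero>" if "x \<in> carrier M" for x
      using neg[OF that] smult[OF that] by blast
  qed (fact add zero assoc comm l_zero)+
qed (simp_all only: cring_rat_field smult smult_1 smult_l_distr smult_r_distr smult_assoc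
  rat_field_simps)

lemma smult_minus_one:
  fixes M (structure)
  assumes "module rat_field M" "x \<in> carrier M"
  shows "(-1) \<odot> x = \<ominus> x"
proof -
  interpret module rat_field M by fact
  have "((-1) \<odot> x) \<oplus> x = \<zero>"
    using smult_l_distr[of "-1" 1 x] smult_one[of x] smult_l_null[of x] assms(2) by simp
  then show ?thesis
    using M.minus_equality[of "(-1) \<odot> x" x] smult_closed[of "-1" x] assms(2) by simp
qed

lemma smult_simps:
  fixes M (structure)
  assumes "module rat_field M" "x \<in> carrier M"
  shows "c \<odot> x \<in> carrier M" "1 \<odot> x = x" "0 \<odot> x = \<zero>" "(b * c) \<odot> x = b \<odot> (c \<odot> x)"
    "(b + c) \<odot> x = b \<odot> x \<oplus> c \<odot> x"
proof -
  interpret module rat_field M by fact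
  show "c \<odot> x \<in> carrier M" "1 \<odot> x = x" "0 \<odot> x = \<zero>" "(b * c) \<odot> x = b \<odot> (c \<odot> x)"
    "(b + c) \<odot> x = b \<odot> x \<oplus> c \<odot> x"
    using smult_closed[of c x] smult_one[of x] smult_l_null[of x] smult_assoc1[of b c x]
      smult_l_distr[of b c x] assms(2) by simp_all
qed

lemma smult_r_distr_rat:
  fixes M (structure)
  assumes "module rat_field M" "x \<in> carrier M" "y \<in> carrier M"
  shows "c \<odot> (x \<oplus> y) = c \<odot> x \<oplus> c \<odot> y"
proof -
  interpret module rat_field M by fact
  show ?thesis using smult_r_distr[of c x y] assms by simp
qed

lemma smult_zero:
  fixes M (structure)
  assumes "module rat_field M"
  shows "c \<odot> \<zero> = \<zero>"
proof -
  interpret module rat_field M by fact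
  show ?thesis using smult_r_null[of c] by simp
qed

lemma linear_mapsI:
  assumes "\<And>x. x \<in> carrier M \<Longrightarrow> h x \<in> carrier N"
    and "\<And>x y. x \<in> carrier M \<Longrightarrow> y \<in> carrier M \<Longrightarrow> h (x \<oplus>\<^bsub>M\<^esub> y) = h x \<oplus>\<^bsub>N\<^esub> h y"
    and "\<And>c x. x \<in> carrier M \<Longrightarrow> h (c \<odot>\<^bsub>M\<^esub> x) = c \<odot>\<^bsub>N\<^esub> h x"
  shows "h \<in> linear_maps M N"
  using assms by (auto simp: linear_maps_def)

lemma
  assumes "h \<in> linear_maps M N"
  shows linear_closed: "x \<in> carrier M \<Longrightarrow> h x \<in> carrier N"
    and linear_add: "x \<in> carrier M \<Longrightarrow> y \<in> carrier M \<Longrightarrow> h (x \<oplus>\<^bsub>M\<^esub> y) = h x \<oplus>\<^bsub>N\<^esub> h y"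
    and linear_smult: "x \<in> carrier M \<Longrightarrow> h (c \<odot>\<^bsub>M\<^esub> x) = c \<odot>\<^bsub>N\<^esub> h x"
  using assms by (auto simp: linear_maps_def)

lemma linear_zero:
  assumes "h \<in> linear_maps M N" "module rat_field M" "module rat_field N"
  shows "h \<zero>\<^bsub>M\<^esub> = \<zero>\<^bsub>N\<^esub>"
proof -
  interpret M: module rat_field M by fact
  interpret N: module rat_field N by fact
  show ?thesis
    using linear_smult[OF assms(1), of "\<zero>\<^bsub>M\<^esub>" 0] smult_simps(3)[OF assms(2), of "\<zero>\<^bsub>M\<^esub>"]
      smult_simps(3)[OF assms(3), of "h \<zero>\<^bsub>M\<^esub>"] linear_closed[OF assms(1), of "\<zero>\<^bsub>M\<^esub>"]
    by simp
qed

lemma linear_minus: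
  assumes "h \<in> linear_maps M N" "module rat_field M" "module rat_field N" "x \<in> carrier M"
  shows "h (\<ominus>\<^bsub>M\<^esub> x) = \<ominus>\<^bsub>N\<^esub> h x"
  using linear_smult[OF assms(1,4), of "-1"] linear_closed[OF assms(1,4)]
  by (simp add: smult_minus_one assms)

lemma linear_diff:
  assumes "h \<in> linear_maps M N" "module rat_field M" "module rat_field N"
    "x \<in> carrier M" "y \<in> carrier M"
  shows "h (x \<ominus>\<^bsub>M\<^esub> y) = h x \<ominus>\<^bsub>N\<^esub> h y"
proof -
  interpret M: module rat_field M by fact
  show ?thesis
    unfolding a_minus_def
    by (simp add: linear_add[OF assms(1)] linear_minus[OF assms(1-3)] assms(4,5))
qed

lemma linear_compose:
  "h \<in> linear_maps M N \<Longrightarrow> g \<in> linear_maps N K \<Longrightarrow> (\<lambda>x. g (h x)) \<in> linear_maps M K"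
  by (auto simp: linear_maps_def Pi_iff)

lemma linear_funpow:
  assumes "h \<in> linear_maps M M"
  shows "h ^^ k \<in> linear_maps M M"
proof (induction k)
  case 0
  show ?case by (auto simp: linear_maps_def)
next
  case (Suc k)
  show ?case
    by (rule linear_mapsI)
      (simp_all add: linear_closed[OF assms] linear_add[OF assms] linear_smult[OF assms]
        linear_closed[OF Suc] linear_add[OF Suc] linear_smult[OF Suc])
qed

text \<open>Every axiom for elements of the target is the image of the same axiom for preimages.\<close>

lemma module_surjection:
  assumes M: "module rat_field M" and h: "h \<in> linear_maps M Q"
    and surj: "carrier Q = h ` carrier M" and zero: "\<zero>\<^bsub>Q\<^esub> = h \<zero>\<^bsub>M\<^esub>"
  shows "module rat_field Q"
proof -
  interpret M: module rat_field M by fact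
  note [simp] = linear_add[OF h, symmetric] linear_smult[OF h, symmetric]
  show ?thesis
  proof (rule rat_moduleI)
    show "\<zero>\<^bsub>Q\<^esub> \<in> carrier Q" by (simp add: surj zero)
  next
    fix x y assume "x \<in> carrier Q" "y \<in> carrier Q"
    then obtain u v where [simp]: "u \<in> carrier M" "x = h u" "v \<in> carrier M" "y = h v"
      by (auto simp: surj)
    show "x \<oplus>\<^bsub>Q\<^esub> y \<in> carrier Q" by (simp add: surj)
    show "x \<oplus>\<^bsub>Q\<^esub> y = y \<oplus>\<^bsub>Q\<^esub> x" by (simp add: M.a_comm)
    show "c \<odot>\<^bsub>Q\<^esub> (x \<oplus>\<^bsub>Q\<^esub> y) = c \<odot>\<^bsub>Q\<^esub> x \<oplus>\<^bsub>Q\<^esub> c \<odot>\<^bsub>Q\<^esub> y" for c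
      by (simp add: smult_simps[OF M] smult_r_distr_rat[OF M])
    show "(x \<oplus>\<^bsub>Q\<^esub> y) \<oplus>\<^bsub>Q\<^esub> z = x \<oplus>\<^bsub>Q\<^esub> (y \<oplus>\<^bsub>Q\<^esub> z)" if "z \<in> carrier Q" for z
      using that by (auto simp: surj M.a_assoc)
  next
    fix x assume "x \<in> carrier Q"
    then obtain u where [simp]: "u \<in> carrier M" "x = h u"
      by (auto simp: surj)
    show "c \<odot>\<^bsub>Q\<^esub> x \<in> carrier Q" "(b * c) \<odot>\<^bsub>Q\<^esub> x = b \<odot>\<^bsub>Q\<^esub> (c \<odot>\<^bsub>Q\<^esub> x)"
      "(b + c) \<odot>\<^bsub>Q\<^esub> x = b \<odot>\<^bsub>Q\<^esub> x \<oplus>\<^bsub>Q\<^esub> c \<odot>\<^bsub>Q\<^esub> x" for b c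
      by (simp_all add: surj smult_simps[OF M])
    show "\<zero>\<^bsub>Q\<^esub> \<oplus>\<^bsub>Q\<^esub> x = x" by (simp add: zero)
    show "0 \<odot>\<^bsub>Q\<^esub> x = \<zero>\<^bsub>Q\<^esub>"
      using linear_smult[OF h \<open>u \<in> carrier M\<close>, of 0] smult_simps(3)[OF M \<open>u \<in> carrier M\<close>]
      by (simp only: zero \<open>x = h u\<close>)
    show "1 \<odot>\<^bsub>Q\<^esub> x = x"
      using linear_smult[OF h \<open>u \<in> carrier M\<close>, of 1] smult_simps(2)[OF M \<open>u \<in> carrier M\<close>]
      by (simp only: \<open>x = h u\<close>)
  qed
qed

lemma linear_descends:
  assumes M: "module rat_field M" and p: "p \<in> linear_maps M N" and surj: "carrier N = p ` carrier M"
    and h: "h \<in> linear_maps M K" and h': "\<And>x. x \<in> carrier M \<Longrightarrow> h' (p x) = h x"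
  shows "h' \<in> linear_maps N K"
proof (rule linear_mapsI)
  interpret M: module rat_field M by fact
  fix x assume "x \<in> carrier N"
  then obtain u where u: "u \<in> carrier M" "x = p u" by (auto simp: surj)
  show "h' x \<in> carrier K"
    unfolding u(2) h'[OF u(1)] by (rule linear_closed[OF h u(1)])
  show "h' (c \<odot>\<^bsub>N\<^esub> x) = c \<odot>\<^bsub>K\<^esub> h' x" for c
    unfolding u(2) linear_smult[OF p u(1), symmetric] h'[OF u(1)] h'[OF smult_simps(1)[OF M u(1)]]
    by (rule linear_smult[OF h u(1)])
  fix y assume "y \<in> carrier N"
  then obtain v where v: "v \<in> carrier M" "y = p v" by (auto simp: surj)
  show "h' (x \<oplus>\<^bsub>N\<^esub> y) = h' x \<oplus>\<^bsub>K\<^esub> h' y"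
    unfolding u(2) v(2) linear_add[OF p u(1) v(1), symmetric] h'[OF u(1)] h'[OF v(1)]
      h'[OF M.a_closed[OF u(1) v(1)]]
    by (rule linear_add[OF h u(1) v(1)])
qed

lemma rat_submoduleI:
  assumes M: "module rat_field M"
    and "N \<subseteq> carrier M" "\<zero>\<^bsub>M\<^esub> \<in> N"
    "\<And>x y. x \<in> N \<Longrightarrow> y \<in> N \<Longrightarrow> x \<oplus>\<^bsub>M\<^esub> y \<in> N"
    and smult: "\<And>c x. x \<in> N \<Longrightarrow> c \<odot>\<^bsub>M\<^esub> x \<in> N"
  shows "submodule N rat_field M"
proof -
  interpret M: module rat_field M by fact
  show ?thesis
  proof (rule M.submoduleI)
    show "\<ominus>\<^bsub>M\<^esub> x \<in> N" if "x \<in> N" for x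
      using smult[OF that, of "-1"] that assms(2) by (auto simp: smult_minus_one[OF M] subset_iff)
  qed (use assms in auto)
qed

lemma
  assumes M: "module rat_field M" and N: "submodule N rat_field M"
  shows submodule_subset: "N \<subseteq> carrier M"
    and submodule_zero: "\<zero>\<^bsub>M\<^esub> \<in> N"
    and submodule_add: "x \<in> N \<Longrightarrow> y \<in> N \<Longrightarrow> x \<oplus>\<^bsub>M\<^esub> y \<in> N"
    and submodule_smult: "x \<in> N \<Longrightarrow> c \<odot>\<^bsub>M\<^esub> x \<in> N"
    and submodule_minus: "x \<in> N \<Longrightarrow> \<ominus>\<^bsub>M\<^esub> x \<in> N"
proof -
  interpret M: module rat_field M by fact
  note E = M.submoduleE[OF N]
  show "N \<subseteq> carrier M" by (rule E)
  show "\<zero>\<^bsub>M\<^esub> \<in> N"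
    using subgroup.one_closed[OF submodule.axioms(1)[OF N]] by simp
  show "x \<in> N \<Longrightarrow> y \<in> N \<Longrightarrow> x \<oplus>\<^bsub>M\<^esub> y \<in> N" by (rule E)
  show "x \<in> N \<Longrightarrow> c \<odot>\<^bsub>M\<^esub> x \<in> N" using E(4)[of c] by simp
  show "x \<in> N \<Longrightarrow> \<ominus>\<^bsub>M\<^esub> x \<in> N" by (rule E)
qed

lemma submodule_abelian_subgroup:
  assumes "module rat_field M" "submodule N rat_field M"
  shows "abelian_subgroup N M"
  using assms by (intro abelian_subgroupI3 additive_subgroup.intro)
    (auto simp: module_def submodule_def)

lemma
  fixes M (structure)
  assumes M: "module rat_field M" and N: "submodule N rat_field M" and x: "x \<in> carrier M"
  shows coset_self: "x \<in> N +> x"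
    and coset_memD: "y \<in> N +> x \<Longrightarrow> y \<in> carrier M \<and> N +> y = N +> x"
    and coset_eq_iff: "y \<in> carrier M \<Longrightarrow> N +> y = N +> x \<longleftrightarrow> y \<ominus> x \<in> N"
proof -
  interpret M: module rat_field M by fact
  interpret N: abelian_subgroup N M by (rule submodule_abelian_subgroup[OF M N])
  show "x \<in> N +> x" by (rule N.a_rcos_self[OF x])
  have *: "y \<in> carrier M \<and> N +> y = N +> x" if "y \<in> N +> x" for y
  proof
    show "y \<in> carrier M" by (rule N.a_elemrcos_carrier[OF x that])
    show "N +> y = N +> x"
      by (rule M.a_repr_independence[OF that x submodule.axioms(1)[OF N], symmetric])
  qed
  then show "y \<in> N +> x \<Longrightarrow> y \<in> carrier M \<and> N +> y = N +> x" .
  show "N +> y = N +> x \<longleftrightarrow> y \<ominus> x \<in> N" if "y \<in> carrier M"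
    using *[of y] N.a_rcos_self[OF that] N.a_rcos_module[OF x that] by (auto simp: a_minus_def)
qed

lemma coset_zero:
  assumes M: "module rat_field M" and N: "submodule N rat_field M"
  shows "N +>\<^bsub>M\<^esub> \<zero>\<^bsub>M\<^esub> = N"
proof -
  interpret M: module rat_field M by fact
  show ?thesis using M.a_coset_add_zero submodule_subset[OF M N] by blast
qed

text \<open>
  Operations on a quotient are unions over all representatives. If the class of the result does not
  depend on the representatives, the union has a single value.
\<close>

lemma UN_coset:
  assumes M: "module rat_field M" and N: "submodule N rat_field M" and x: "x \<in> carrier M"
    and const: "\<And>y. y \<in> carrier M \<Longrightarrow> y \<ominus>\<^bsub>M\<^esub> x \<in> N \<Longrightarrow> F y = F x"
  shows "(\<Union>y\<in>N +>\<^bsub>M\<^esub> x. F y) = F x"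
proof -
  have "F y = F x" if "y \<in> N +>\<^bsub>M\<^esub> x" for y
    using coset_memD[OF M N x that] coset_eq_iff[OF M N x] const by blast
  then show ?thesis using coset_self[OF M N x] by blast
qed

lemma
  assumes M: "module rat_field M" and N: "submodule N rat_field M"
  shows coset_linear: "(\<lambda>x. N +>\<^bsub>M\<^esub> x) \<in> linear_maps M (quot_module M N)"
    and carrier_quot_module: "carrier (quot_module M N) = (\<lambda>x. N +>\<^bsub>M\<^esub> x) ` carrier M"
    and module_quot_module: "module rat_field (quot_module M N)"
proof -
  interpret M: module rat_field M by fact
  interpret N: abelian_subgroup N M by (rule submodule_abelian_subgroup[OF M N])
  show c: "carrier (quot_module M N) = (\<lambda>x. N +>\<^bsub>M\<^esub> x) ` carrier M"
    by (auto simp: quot_module_def A_RCOSETS_def' )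
  show l: "(\<lambda>x. N +>\<^bsub>M\<^esub> x) \<in> linear_maps M (quot_module M N)"
  proof (rule linear_mapsI)
    show "N +>\<^bsub>M\<^esub> (x \<oplus>\<^bsub>M\<^esub> y) = (N +>\<^bsub>M\<^esub> x) \<oplus>\<^bsub>quot_module M N\<^esub> (N +>\<^bsub>M\<^esub> y)"
      if "x \<in> carrier M" "y \<in> carrier M" for x y
      by (simp add: quot_module_def N.a_rcos_sum that)
    fix c x assume x: "x \<in> carrier M"
    have "(\<Union>y\<in>N +>\<^bsub>M\<^esub> x. N +>\<^bsub>M\<^esub> (c \<odot>\<^bsub>M\<^esub> y)) = N +>\<^bsub>M\<^esub> (c \<odot>\<^bsub>M\<^esub> x)"
    proof (rule UN_coset[OF M N x])
      fix y assume y: "y \<in> carrier M" "y \<ominus>\<^bsub>M\<^esub> x \<in> N"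
      have "c \<odot>\<^bsub>M\<^esub> (\<ominus>\<^bsub>M\<^esub> x) = \<ominus>\<^bsub>M\<^esub> (c \<odot>\<^bsub>M\<^esub> x)"
        using M.smult_r_minus[of c x] x by simp
      then have "c \<odot>\<^bsub>M\<^esub> y \<ominus>\<^bsub>M\<^esub> c \<odot>\<^bsub>M\<^esub> x = c \<odot>\<^bsub>M\<^esub> (y \<ominus>\<^bsub>M\<^esub> x)"
        using x y smult_r_distr_rat[OF M, of y "\<ominus>\<^bsub>M\<^esub> x" c] by (simp add: a_minus_def)
      then show "N +>\<^bsub>M\<^esub> (c \<odot>\<^bsub>M\<^esub> y) = N +>\<^bsub>M\<^esub> (c \<odot>\<^bsub>M\<^esub> x)"
        using x y by (simp add: coset_eq_iff[OF M N] smult_simps[OF M] submodule_smult[OF M N])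
    qed
    then show "N +>\<^bsub>M\<^esub> (c \<odot>\<^bsub>M\<^esub> x) = c \<odot>\<^bsub>quot_module M N\<^esub> (N +>\<^bsub>M\<^esub> x)"
      by (simp add: quot_module_def)
  qed (simp add: c)
  show "module rat_field (quot_module M N)"
    by (rule module_surjection[OF M l c]) (simp add: quot_module_def coset_zero[OF M N])
qed


section \<open>Operads, surjections and ideals\<close>

context ns_operad
begin

lemma pcomp_closed:
  assumes "1 \<le> i" "i \<le> m" "1 \<le> n" "f \<in> elems P m" "g \<in> elems P n"
  shows "pcomp P m n i f g \<in> elems P (m + n - 1)"
  using linear_closed[OF pcomp_linear_left[OF assms(1-3,5)]] assms by simp

lemma
  assumes "1 \<le> i" "i \<le> m" "1 \<le> n"
  shows pcomp_zero_left: "g \<in> elems P n \<Longrightarrow>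
      pcomp P m n i \<zero>\<^bsub>comp_space P m\<^esub> g = \<zero>\<^bsub>comp_space P (m + n - 1)\<^esub>"
    and pcomp_zero_right: "f \<in> elems P m \<Longrightarrow>
      pcomp P m n i f \<zero>\<^bsub>comp_space P n\<^esub> = \<zero>\<^bsub>comp_space P (m + n - 1)\<^esub>"
  using linear_zero[OF pcomp_linear_left[OF assms]] linear_zero[OF pcomp_linear_right[OF assms]]
    assms comp_space by auto

end

text \<open>
  All axioms of an operad are identities, so a structure onto which an operad surjects compatibly
  with the operations satisfies them too. This spares quotients a second proof for each kind of
  operad.
\<close>

locale operad_surjection = ns_operad P for P :: "('a, 'm) operad_scheme" +
  fixes Q :: "('b, 'k) operad_scheme" and \<pi> :: "nat \<Rightarrow> 'a \<Rightarrow> 'b"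
  assumes target_space: "1 \<le> n \<Longrightarrow> module rat_field (comp_space Q n)"
    and proj_linear: "1 \<le> n \<Longrightarrow> \<pi> n \<in> linear_maps (comp_space P n) (comp_space Q n)"
    and proj_surj: "1 \<le> n \<Longrightarrow> elems Q n = \<pi> n ` elems P n"
    and proj_unit: "op_unit Q = \<pi> 1 (op_unit P)"
    and proj_pcomp: "\<lbrakk>1 \<le> i; i \<le> m; 1 \<le> n; f \<in> elems P m; g \<in> elems P n\<rbrakk> \<Longrightarrow>
      pcomp Q m n i (\<pi> m f) (\<pi> n g) = \<pi> (m + n - 1) (pcomp P m n i f g)"
begin

lemma proj_closed: "1 \<le> n \<Longrightarrow> f \<in> elems P n \<Longrightarrow> \<pi> n f \<in> elems Q n"
  by (simp add: proj_surj)

lemma proj_add: "\<lbrakk>1 \<le> n; f \<in> elems P n; g \<in> elems P n\<rbrakk> \<Longrightarrow>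
    \<pi> n (f \<oplus>\<^bsub>comp_space P n\<^esub> g) = \<pi> n f \<oplus>\<^bsub>comp_space Q n\<^esub> \<pi> n g"
  by (rule linear_add[OF proj_linear])

lemma proj_smult: "\<lbrakk>1 \<le> n; f \<in> elems P n\<rbrakk> \<Longrightarrow>
    \<pi> n (c \<odot>\<^bsub>comp_space P n\<^esub> f) = c \<odot>\<^bsub>comp_space Q n\<^esub> \<pi> n f"
  by (rule linear_smult[OF proj_linear])

lemma proj_minus: "\<lbrakk>1 \<le> n; f \<in> elems P n\<rbrakk> \<Longrightarrow>
    \<pi> n (\<ominus>\<^bsub>comp_space P n\<^esub> f) = \<ominus>\<^bsub>comp_space Q n\<^esub> \<pi> n f"
  by (rule linear_minus[OF proj_linear]) (auto intro: comp_space target_space)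

lemma target_ns_operad: "ns_operad Q"
proof (rule ns_operad.intro)
  fix i m n :: nat and g assume *: "1 \<le> i" "i \<le> m" "1 \<le> n" and "g \<in> elems Q n"
  then obtain g' where g: "g' \<in> elems P n" "g = \<pi> n g'" by (auto simp: proj_surj)
  have mn: "1 \<le> m" "1 \<le> m + n - 1" using * by auto
  show "(\<lambda>f. pcomp Q m n i f g) \<in> linear_maps (comp_space Q m) (comp_space Q (m + n - 1))"
    unfolding g(2)
    by (rule linear_descends[OF comp_space[OF mn(1)] proj_linear[OF mn(1)] proj_surj[OF mn(1)]
          linear_compose[OF pcomp_linear_left[OF * g(1)] proj_linear[OF mn(2)]]
          proj_pcomp[OF * _ g(1)]])
next
  fix i m n :: nat and f assume *: "1 \<le> i" "i \<le> m" "1 \<le> n" and "f \<in> elems Q m"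
  moreover have mn: "1 \<le> m" "1 \<le> m + n - 1" using * by auto
  ultimately obtain f' where f: "f' \<in> elems P m" "f = \<pi> m f'" by (auto simp: proj_surj)
  show "(\<lambda>g. pcomp Q m n i f g) \<in> linear_maps (comp_space Q n) (comp_space Q (m + n - 1))"
    unfolding f(2)
    by (rule linear_descends[OF comp_space[OF *(3)] proj_linear[OF *(3)] proj_surj[OF *(3)]
          linear_compose[OF pcomp_linear_right[OF * f(1)] proj_linear[OF mn(2)]]
          proj_pcomp[OF * f(1)]])
next
  fix n g assume "1 \<le> n" "g \<in> elems Q n"
  then obtain g' where g: "g' \<in> elems P n" "g = \<pi> n g'" by (auto simp: proj_surj)
  show "pcomp Q 1 n 1 (op_unit Q) g = g"
    using proj_pcomp[of 1 1 n "op_unit P" g'] unit_left[of n g'] \<open>1 \<le> n\<close> g unit_closed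
    by (simp add: proj_unit)
next
  fix i m :: nat and f assume *: "1 \<le> i" "i \<le> m" "f \<in> elems Q m"
  then obtain f' where f: "f' \<in> elems P m" "f = \<pi> m f'" by (auto simp: proj_surj)
  show "pcomp Q m 1 i f (op_unit Q) = f"
    using proj_pcomp[of i m 1 f' "op_unit P"] unit_right[of i m f'] * f unit_closed
    by (simp add: proj_unit)
next
  fix i m j n l :: nat and f g h
  assume *: "1 \<le> i" "i \<le> m" "1 \<le> j" "j \<le> n" "1 \<le> l"
    and e: "f \<in> elems Q m" "g \<in> elems Q n" "h \<in> elems Q l"
  have mn: "1 \<le> m" "1 \<le> n" "i + j - 1 \<le> m + n - 1" "m + n - 1 + l - 1 = m + (n + l - 1) - 1"
    "1 \<le> i + j - 1"
    using * by auto
  obtain f' g' h' where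
    fgh: "f' \<in> elems P m" "f = \<pi> m f'" "g' \<in> elems P n" "g = \<pi> n g'" "h' \<in> elems P l" "h = \<pi> l h'"
    using e * mn(1,2) by (auto simp: proj_surj)
  have c: "pcomp P m n i f' g' \<in> elems P (m + n - 1)" "pcomp P n l j g' h' \<in> elems P (n + l - 1)"
    using * mn(1,2) fgh by (auto intro: pcomp_closed)
  have "pcomp Q (m + n - 1) l (i + j - 1) (pcomp Q m n i f g) h
      = \<pi> (m + n - 1 + l - 1) (pcomp P (m + n - 1) l (i + j - 1) (pcomp P m n i f' g') h')"
    unfolding fgh proj_pcomp[OF *(1,2) mn(2) fgh(1,3)]
    by (rule proj_pcomp[OF mn(5,3) *(5) c(1) fgh(5)])
  also have "\<dots> = \<pi> (m + (n + l - 1) - 1) (pcomp P m (n + l - 1) i f' (pcomp P n l j g' h'))"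
    using assoc_sequential[OF * fgh(1,3,5)] mn(4) by simp
  also have "\<dots> = pcomp Q m (n + l - 1) i f (pcomp Q n l j g h)"
    unfolding fgh proj_pcomp[OF *(3,4,5) fgh(3,5)]
    by (rule proj_pcomp[symmetric]) (use * mn c fgh in auto)
  finally show "pcomp Q (m + n - 1) l (i + j - 1) (pcomp Q m n i f g) h
      = pcomp Q m (n + l - 1) i f (pcomp Q n l j g h)" .
next
  fix i k m n l :: nat and f g h
  assume *: "1 \<le> i" "i < k" "k \<le> m" "1 \<le> n" "1 \<le> l"
    and e: "f \<in> elems Q m" "g \<in> elems Q n" "h \<in> elems Q l"
  have mn: "1 \<le> m" "1 \<le> k" "i \<le> m" "1 \<le> k + n - 1" "k + n - 1 \<le> m + n - 1" "i \<le> m + l - 1"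
    "m + n - 1 + l - 1 = m + l - 1 + n - 1"
    using * by auto
  obtain f' g' h' where
    fgh: "f' \<in> elems P m" "f = \<pi> m f'" "g' \<in> elems P n" "g = \<pi> n g'" "h' \<in> elems P l" "h = \<pi> l h'"
    using e * mn(1) by (auto simp: proj_surj)
  have c: "pcomp P m n i f' g' \<in> elems P (m + n - 1)" "pcomp P m l k f' h' \<in> elems P (m + l - 1)"
    using * mn fgh by (auto intro: pcomp_closed)
  have "pcomp Q (m + n - 1) l (k + n - 1) (pcomp Q m n i f g) h
      = \<pi> (m + n - 1 + l - 1) (pcomp P (m + n - 1) l (k + n - 1) (pcomp P m n i f' g') h')"
    unfolding fgh proj_pcomp[OF *(1) mn(3) *(4) fgh(1,3)]
    by (rule proj_pcomp[OF mn(4,5) *(5) c(1) fgh(5)])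
  also have "\<dots> = \<pi> (m + l - 1 + n - 1) (pcomp P (m + l - 1) n i (pcomp P m l k f' h') g')"
    using assoc_parallel[OF * fgh(1,3,5)] mn(7) by simp
  also have "\<dots> = pcomp Q (m + l - 1) n i (pcomp Q m l k f h) g"
    unfolding fgh proj_pcomp[OF mn(2) *(3,5) fgh(1,5)]
    by (rule proj_pcomp[OF *(1) mn(6) *(4) c(2) fgh(3), symmetric])
  finally show "pcomp Q (m + n - 1) l (k + n - 1) (pcomp Q m n i f g) h
      = pcomp Q (m + l - 1) n i (pcomp Q m l k f h) g" .
next
  show "op_unit Q \<in> elems Q 1" by (simp add: proj_unit proj_closed unit_closed)
qed (rule target_space)

lemma linear_from_source:
  assumes n: "1 \<le> n" and h: "h \<in> linear_maps (comp_space P n) (comp_space P n)"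
    and h': "\<And>f. f \<in> elems P n \<Longrightarrow> h' (\<pi> n f) = \<pi> n (h f)"
  shows "h' \<in> linear_maps (comp_space Q n) (comp_space Q n)"
  by (rule linear_descends[OF comp_space[OF n] proj_linear[OF n] proj_surj[OF n]
        linear_compose[OF h proj_linear[OF n]] h'])

lemma target_ns_anticyclic_operad:
  assumes "ns_anticyclic_operad P \<tau>"
    and *: "\<And>n f. \<lbrakk>1 \<le> n; f \<in> elems P n\<rbrakk> \<Longrightarrow> \<tau>' n (\<pi> n f) = \<pi> n (\<tau> n f)"
  shows "ns_anticyclic_operad Q \<tau>'"
proof -
  interpret A: ns_anticyclic_operad P \<tau> by fact
  interpret Q: ns_operad Q by (rule target_ns_operad)
  have cl: "\<tau> n f \<in> elems P n" if "1 \<le> n" "f \<in> elems P n" for n f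
    using linear_closed[OF A.tau_linear] that by blast
  show ?thesis
  proof (intro ns_anticyclic_operad.intro ns_anticyclic_operad_axioms.intro)
    show "ns_operad Q" by (rule target_ns_operad)
  next
    fix n :: nat assume n: "1 \<le> n"
    show "\<tau>' n \<in> linear_maps (comp_space Q n) (comp_space Q n)"
      by (rule linear_from_source[OF n A.tau_linear]) (use * n in auto)
  next
    fix n :: nat and f assume n: "1 \<le> n" and "f \<in> elems Q n"
    then obtain f' where f: "f' \<in> elems P n" "f = \<pi> n f'" using n by (auto simp: proj_surj)
    have "(\<tau>' n ^^ k) f = \<pi> n ((\<tau> n ^^ k) f') \<and> (\<tau> n ^^ k) f' \<in> elems P n" for k
      by (induction k) (use f n * cl in auto)
    then show "(\<tau>' n ^^ (n + 1)) f = f" using A.tau_order n f by metis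
  next
    show "\<tau>' 1 (op_unit Q) = \<ominus>\<^bsub>comp_space Q 1\<^esub> op_unit Q"
      using unit_closed by (simp add: proj_unit * A.tau_unit proj_minus)
  next
    fix i m n :: nat and f g
    assume i: "2 \<le> i" "i \<le> m" "1 \<le> n" "f \<in> elems Q m" "g \<in> elems Q n"
    then have "1 \<le> i" "1 \<le> m" by auto
    then obtain f' g' where
      fg: "f' \<in> elems P m" "f = \<pi> m f'" "g' \<in> elems P n" "g = \<pi> n g'"
      using i(3-5) by (auto simp: proj_surj)
    have "i - 1 \<le> m" "1 \<le> i - 1" using i by auto
    then show "\<tau>' (m + n - 1) (pcomp Q m n i f g) = pcomp Q m n (i - 1) (\<tau>' m f) g"
      using i(1-3) \<open>1 \<le> m\<close> \<open>1 \<le> i\<close> fg(1,3) unfolding fg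
      by (simp add: proj_pcomp * pcomp_closed cl A.tau_pcomp)
  next
    fix m n :: nat and f g
    assume i: "1 \<le> m" "1 \<le> n" "f \<in> elems Q m" "g \<in> elems Q n"
    then obtain f' g' where
      fg: "f' \<in> elems P m" "f = \<pi> m f'" "g' \<in> elems P n" "g = \<pi> n g'"
      by (auto simp: proj_surj)
    have mn: "1 \<le> m + n - 1" "n + m - 1 = m + n - 1" using i by auto
    have "\<tau>' (m + n - 1) (pcomp Q m n 1 f g) = \<pi> (m + n - 1) (\<tau> (m + n - 1) (pcomp P m n 1 f' g'))"
      unfolding fg proj_pcomp[OF order_refl i(1,2) fg(1,3)]
      by (rule *[OF mn(1) pcomp_closed[OF order_refl i(1,2) fg(1,3)]])
    also have "\<dots> = \<ominus>\<^bsub>comp_space Q (m + n - 1)\<^esub> \<pi> (m + n - 1) (pcomp P n m n (\<tau> n g') (\<tau> m f'))"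
      unfolding A.tau_pcomp_1[OF i(1,2) fg(1,3)]
      by (rule proj_minus[OF mn(1) pcomp_closed[of n n m "\<tau> n g'" "\<tau> m f'", unfolded mn(2)]])
        (use i fg cl in auto)
    also have "\<pi> (m + n - 1) (pcomp P n m n (\<tau> n g') (\<tau> m f')) = pcomp Q n m n (\<tau>' n g) (\<tau>' m f)"
      unfolding fg *[OF i(1) fg(1)] *[OF i(2) fg(3)]
      unfolding mn(2)[symmetric] by (rule proj_pcomp[symmetric]) (use i fg cl in auto)
    finally show "\<tau>' (m + n - 1) (pcomp Q m n 1 f g)
        = \<ominus>\<^bsub>comp_space Q (m + n - 1)\<^esub> pcomp Q n m n (\<tau>' n g) (\<tau>' m f)" .
  qed
qed

end

lemma operad_idealD:
  assumes "operad_ideal P I"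
  shows "1 \<le> n \<Longrightarrow> submodule (I n) rat_field (comp_space P n)"
    and "\<lbrakk>1 \<le> i; i \<le> m; 1 \<le> n; f \<in> elems P m; g \<in> I n\<rbrakk> \<Longrightarrow> pcomp P m n i f g \<in> I (m + n - 1)"
    and "\<lbrakk>1 \<le> i; i \<le> m; 1 \<le> n; f \<in> I m; g \<in> elems P n\<rbrakk> \<Longrightarrow> pcomp P m n i f g \<in> I (m + n - 1)"
  using assms unfolding operad_ideal_def by blast+

lemma operad_idealI:
  assumes "\<And>n. 1 \<le> n \<Longrightarrow> submodule (I n) rat_field (comp_space P n)"
    and "\<And>i m n f g. \<lbrakk>1 \<le> i; i \<le> m; 1 \<le> n; f \<in> elems P m; g \<in> I n\<rbrakk> \<Longrightarrow>
      pcomp P m n i f g \<in> I (m + n - 1)"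
    and "\<And>i m n f g. \<lbrakk>1 \<le> i; i \<le> m; 1 \<le> n; f \<in> I m; g \<in> elems P n\<rbrakk> \<Longrightarrow>
      pcomp P m n i f g \<in> I (m + n - 1)"
  shows "operad_ideal P I"
  using assms unfolding operad_ideal_def by blast

lemma coset_map:
  assumes M: "module rat_field M" and N: "submodule N rat_field M"
    and M': "module rat_field M'" and N': "submodule N' rat_field M'"
    and h: "h \<in> linear_maps M M'" and sub: "\<And>y. y \<in> N \<Longrightarrow> h y \<in> N'" and x: "x \<in> carrier M"
  shows "(\<Union>y\<in>N +>\<^bsub>M\<^esub> x. N' +>\<^bsub>M'\<^esub> h y) = N' +>\<^bsub>M'\<^esub> h x"
proof (rule UN_coset[OF M N x])
  fix y assume y: "y \<in> carrier M" "y \<ominus>\<^bsub>M\<^esub> x \<in> N"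
  show "N' +>\<^bsub>M'\<^esub> h y = N' +>\<^bsub>M'\<^esub> h x"
    using sub[OF y(2)] x y(1)
    by (simp add: coset_eq_iff[OF M' N'] linear_closed[OF h] linear_diff[OF h M M'])
qed

lemma (in ns_operad) quot_surjection:
  assumes I: "operad_ideal P I"
    and Q: "comp_space Q = (\<lambda>n. quot_module (comp_space P n) (I n))"
      "op_unit Q = quot_proj P I 1 (op_unit P)"
      "pcomp Q = (\<lambda>m n i U V. \<Union>f\<in>U. \<Union>g\<in>V. quot_proj P I (m + n - 1) (pcomp P m n i f g))"
  shows "operad_surjection P Q (quot_proj P I)"
proof (intro operad_surjection.intro operad_surjection_axioms.intro)
  show "ns_operad P" by (rule ns_operad_axioms)
next
  fix n :: nat assume n: "1 \<le> n"
  note M = comp_space[OF n] and N = operad_idealD(1)[OF I n]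
  show "module rat_field (comp_space Q n)"
    unfolding Q by (rule module_quot_module[OF M N])
  show "quot_proj P I n \<in> linear_maps (comp_space P n) (comp_space Q n)"
    unfolding Q quot_proj_def by (rule coset_linear[OF M N])
  show "elems Q n = quot_proj P I n ` elems P n"
    unfolding Q quot_proj_def by (rule carrier_quot_module[OF M N])
next
  show "op_unit Q = quot_proj P I 1 (op_unit P)" by (rule Q)
next
  fix i m n :: nat and f g
  assume *: "1 \<le> i" "i \<le> m" "1 \<le> n" and f: "f \<in> elems P m" and g: "g \<in> elems P n"
  then have m: "1 \<le> m" and mn: "1 \<le> m + n - 1" by auto
  note M = comp_space operad_idealD(1)[OF I]
  have inner: "(\<Union>g\<in>quot_proj P I n g. quot_proj P I (m + n - 1) (pcomp P m n i f g))
      = quot_proj P I (m + n - 1) (pcomp P m n i f g)" if "f \<in> elems P m" for f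
    unfolding quot_proj_def
    by (rule coset_map[OF M[OF \<open>1 \<le> n\<close>] M[OF mn] pcomp_linear_right[OF * that] _ g])
      (rule operad_idealD(2)[OF I * that])
  have "pcomp Q m n i (quot_proj P I m f) (quot_proj P I n g)
      = (\<Union>f\<in>quot_proj P I m f. quot_proj P I (m + n - 1) (pcomp P m n i f g))"
    unfolding Q using inner coset_memD[OF M[OF m] f] by (auto simp: quot_proj_def)
  also have "\<dots> = quot_proj P I (m + n - 1) (pcomp P m n i f g)"
    unfolding quot_proj_def
    by (rule coset_map[OF M[OF m] M[OF mn] pcomp_linear_left[OF * g] _ f])
      (rule operad_idealD(3)[OF I * _ g])
  finally show "pcomp Q m n i (quot_proj P I m f) (quot_proj P I n g)
      = quot_proj P I (m + n - 1) (pcomp P m n i f g)" .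
qed

lemma ideal_generated_incl: "S n \<subseteq> ideal_generated is_ideal S n"
  by (auto simp: ideal_generated_def)

lemma ideal_generated_least:
  "is_ideal J \<Longrightarrow> (\<And>k. S k \<subseteq> J k) \<Longrightarrow> ideal_generated is_ideal S n \<subseteq> J n"
  by (auto simp: ideal_generated_def)

lemma ideal_generatedI:
  "(\<And>J. is_ideal J \<Longrightarrow> (\<And>k. S k \<subseteq> J k) \<Longrightarrow> x \<in> J n) \<Longrightarrow> x \<in> ideal_generated is_ideal S n"
  by (auto simp: ideal_generated_def)

text \<open>
  This ideal ensures that the intersection defining a generated ideal is not empty. Arity \<open>0\<close> is
  subject to no condition, and \<open>UNIV\<close> contains all generators that a family may have there.
\<close>

lemma (in ns_operad) operad_ideal_improper:
  "operad_ideal P (\<lambda>n. if n = 0 then UNIV else elems P n)"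
proof (rule operad_idealI)
  fix n :: nat assume n: "1 \<le> n"
  interpret module rat_field "comp_space P n" by (rule comp_space[OF n])
  show "submodule (if n = 0 then UNIV else elems P n) rat_field (comp_space P n)"
    using n carrier_is_submodule by simp
qed (auto intro: pcomp_closed)

lemma (in ns_operad) operad_ideal_generated:
  assumes sub: "\<And>J. is_ideal J \<Longrightarrow> operad_ideal P J"
    and J0: "is_ideal J0" "\<And>k. S k \<subseteq> J0 k"
  shows "operad_ideal P (ideal_generated is_ideal S)"
proof (rule operad_idealI)
  fix n :: nat assume n: "1 \<le> n"
  note M = comp_space[OF n]
  show "submodule (ideal_generated is_ideal S n) rat_field (comp_space P n)"
  proof (rule rat_submoduleI[OF M])
    show "ideal_generated is_ideal S n \<subseteq> elems P n"
      using ideal_generated_least[of is_ideal J0 S, OF J0]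
        submodule_subset[OF M operad_idealD(1)[OF sub[OF J0(1)] n]] by blast
    show "\<zero>\<^bsub>comp_space P n\<^esub> \<in> ideal_generated is_ideal S n"
      by (rule ideal_generatedI) (rule submodule_zero[OF M operad_idealD(1)[OF sub n]])
  next
    fix x y assume "x \<in> ideal_generated is_ideal S n" "y \<in> ideal_generated is_ideal S n"
    then show "x \<oplus>\<^bsub>comp_space P n\<^esub> y \<in> ideal_generated is_ideal S n"
      by (intro ideal_generatedI submodule_add[OF M operad_idealD(1)[OF sub n]])
        (auto dest!: subsetD[OF ideal_generated_least, rotated -1])
  next
    fix c x assume "x \<in> ideal_generated is_ideal S n"
    then show "c \<odot>\<^bsub>comp_space P n\<^esub> x \<in> ideal_generated is_ideal S n"
      by (intro ideal_generatedI submodule_smult[OF M operad_idealD(1)[OF sub n]])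
        (auto dest!: subsetD[OF ideal_generated_least, rotated -1])
  qed
next
  fix i m n :: nat and f g
  assume *: "1 \<le> i" "i \<le> m" "1 \<le> n" "f \<in> elems P m" "g \<in> ideal_generated is_ideal S n"
  show "pcomp P m n i f g \<in> ideal_generated is_ideal S (m + n - 1)"
  proof (rule ideal_generatedI)
    fix J assume J: "is_ideal J" "\<And>k. S k \<subseteq> J k"
    then have "g \<in> J n" using ideal_generated_least[of is_ideal J S, OF J] *(5) by blast
    then show "pcomp P m n i f g \<in> J (m + n - 1)"
      by (rule operad_idealD(2)[OF sub[OF J(1)] *(1-4)])
  qed
next
  fix i m n :: nat and f g
  assume *: "1 \<le> i" "i \<le> m" "1 \<le> n" "f \<in> ideal_generated is_ideal S m" "g \<in> elems P n"
  show "pcomp P m n i f g \<in> ideal_generated is_ideal S (m + n - 1)"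
  proof (rule ideal_generatedI)
    fix J assume J: "is_ideal J" "\<And>k. S k \<subseteq> J k"
    then have "f \<in> J m" using ideal_generated_least[of is_ideal J S, OF J] *(4) by blast
    then show "pcomp P m n i f g \<in> J (m + n - 1)"
      by (rule operad_idealD(3)[OF sub[OF J(1)] *(1-3) _ *(5)])
  qed
qed

text \<open>
  If \<open>\<tau>\<close> sends the generators of an ideal into the ideal, then the elements of the ideal that \<open>\<tau>\<close>
  keeps inside form an ideal, by the two identities for \<open>\<tau>\<close> of a composition.
\<close>

lemma (in ns_anticyclic_operad) tau_stable_ideal:
  fixes S
  defines "I \<equiv> ideal_generated (operad_ideal P) S"
  assumes S: "\<And>n. 1 \<le> n \<Longrightarrow> S n \<subseteq> elems P n"
    and tau_S: "\<And>n f. 1 \<le> n \<Longrightarrow> f \<in> S n \<Longrightarrow> \<tau> n f \<in> I n"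
    and n: "1 \<le> n" and f: "f \<in> I n"
  shows "\<tau> n f \<in> I n"
proof -
  have I: "operad_ideal P I"
    unfolding I_def
    by (rule operad_ideal_generated[where ?J0.0 = "\<lambda>n. if n = 0 then UNIV else elems P n"])
      (use S operad_ideal_improper in auto)
  define J where "J n = {f \<in> I n. 1 \<le> n \<longrightarrow> \<tau> n f \<in> I n}" for n
  have IP: "f \<in> elems P n" if "1 \<le> n" "f \<in> I n" for f n
    using submodule_subset[OF comp_space operad_idealD(1)[OF I]] that by blast
  have tau_cl: "\<tau> n f \<in> elems P n" if "1 \<le> n" "f \<in> elems P n" for n f
    using linear_closed[OF tau_linear] that by blast
  have tau_comp: "\<tau> (m + n - 1) (pcomp P m n i f g) \<in> I (m + n - 1)"
    if i: "1 \<le> i" "i \<le> m" "1 \<le> n" and fg: "f \<in> elems P m" "g \<in> elems P n"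
      and or: "f \<in> J m \<or> g \<in> J n" for i m n f g
  proof (cases "i = 1")
    case True
    have m: "1 \<le> m" and mn: "n + m - 1 = m + n - 1" using i by auto
    have "pcomp P n m n (\<tau> n g) (\<tau> m f) \<in> I (n + m - 1)"
      using or
    proof
      assume "f \<in> J m"
      then have "\<tau> m f \<in> I m" by (simp add: J_def m)
      then show ?thesis by (intro operad_idealD(2)[OF I] tau_cl fg i m order_refl)
    next
      assume "g \<in> J n"
      then have "\<tau> n g \<in> I n" using i by (simp add: J_def)
      then show ?thesis by (intro operad_idealD(3)[OF I] tau_cl fg i m order_refl)
    qed
    then show ?thesis
      unfolding True tau_pcomp_1[OF m i(3) fg] mn
      by (rule submodule_minus[OF comp_space operad_idealD(1)[OF I], rotated 2]) (use m i in auto)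
  next
    case False
    then have i': "2 \<le> i" "1 \<le> i - 1" "i - 1 \<le> m" "1 \<le> m" using i by auto
    show ?thesis
      unfolding tau_pcomp[OF i'(1) i(2,3) fg]
      using or
    proof
      assume "f \<in> J m"
      then have "\<tau> m f \<in> I m" using i' by (simp add: J_def)
      then show "pcomp P m n (i - 1) (\<tau> m f) g \<in> I (m + n - 1)"
        by (intro operad_idealD(3)[OF I] fg i i')
    next
      assume "g \<in> J n"
      then have "g \<in> I n" by (simp add: J_def)
      then show "pcomp P m n (i - 1) (\<tau> m f) g \<in> I (m + n - 1)"
        by (intro operad_idealD(2)[OF I] tau_cl fg i i')
    qed
  qed
  have "operad_ideal P J"
  proof (rule operad_idealI)
    fix n :: nat assume n: "1 \<le> n"
    note M = comp_space[OF n] and N = operad_idealD(1)[OF I n]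
    note l = tau_linear[OF n]
    show "submodule (J n) rat_field (comp_space P n)"
      by (rule rat_submoduleI[OF M])
        (use n IP in \<open>auto simp: J_def submodule_zero[OF M N] submodule_add[OF M N]
          submodule_smult[OF M N] linear_zero[OF l M M] linear_add[OF l] linear_smult[OF l]\<close>)
  next
    fix i m n :: nat and f g
    assume *: "1 \<le> i" "i \<le> m" "1 \<le> n" "f \<in> elems P m" "g \<in> J n"
    then have "g \<in> I n" "g \<in> elems P n" by (auto simp: J_def IP)
    then show "pcomp P m n i f g \<in> J (m + n - 1)"
      using tau_comp[of i m n f g] operad_idealD(2)[OF I *(1-4)] * by (auto simp: J_def)
  next
    fix i m n :: nat and f g
    assume *: "1 \<le> i" "i \<le> m" "1 \<le> n" "f \<in> J m" "g \<in> elems P n"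
    then have "f \<in> I m" "f \<in> elems P m" by (auto simp: J_def IP)
    then show "pcomp P m n i f g \<in> J (m + n - 1)"
      using tau_comp[of i m n f g] operad_idealD(3)[OF I *(1-3) _ *(5)] * by (auto simp: J_def)
  qed
  moreover have "S k \<subseteq> J k" for k
    using tau_S ideal_generated_incl[of S k "operad_ideal P"] by (auto simp: J_def I_def)
  ultimately have "I n \<subseteq> J n" unfolding I_def by (rule ideal_generated_least)
  then show ?thesis using f n by (auto simp: J_def)
qed


section \<open>Rotating a composition\<close>

lemma funpow_1: "(h :: 'c \<Rightarrow> 'c) ^^ 1 = h"
  by (simp add: One_nat_def)

lemma funpow_plus_1:
  fixes h :: "'c \<Rightarrow> 'c"
  shows "(h ^^ (k + 1)) x = h ((h ^^ k) x)"
  unfolding Suc_eq_plus1[symmetric] by (rule funpow_simps_right(2)[THEN fun_cong, unfolded o_apply funpow_swap1[symmetric]])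

text \<open>
  The identities of a cyclic structure without the condition that \<open>\<tau>\<^bsub>n\<^esub>\<close> has order \<open>n + 1\<close>. On a free
  operad these identities define \<open>\<tau>\<close>, and the order is a consequence of its value on generators.
\<close>

locale ns_tau_operad = ns_operad P for P :: "('a, 'm) operad_scheme" +
  fixes \<tau> :: "nat \<Rightarrow> 'a \<Rightarrow> 'a"
  assumes linear_tau: "1 \<le> n \<Longrightarrow> \<tau> n \<in> linear_maps (comp_space P n) (comp_space P n)"
    and tau_of_unit: "\<tau> 1 (op_unit P) = \<ominus>\<^bsub>comp_space P 1\<^esub> op_unit P"
    and tau_comp: "\<lbrakk>2 \<le> i; i \<le> m; 1 \<le> n; f \<in> elems P m; g \<in> elems P n\<rbrakk> \<Longrightarrow>
      \<tau> (m + n - 1) (pcomp P m n i f g) = pcomp P m n (i - 1) (\<tau> m f) g"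
    and tau_comp_1: "\<lbrakk>1 \<le> m; 1 \<le> n; f \<in> elems P m; g \<in> elems P n\<rbrakk> \<Longrightarrow>
      \<tau> (m + n - 1) (pcomp P m n 1 f g)
        = \<ominus>\<^bsub>comp_space P (m + n - 1)\<^esub> pcomp P n m n (\<tau> n g) (\<tau> m f)"
begin

lemma tau_closed: "1 \<le> n \<Longrightarrow> f \<in> elems P n \<Longrightarrow> \<tau> n f \<in> elems P n"
  by (rule linear_closed[OF linear_tau])

lemma tau_pow_closed: "1 \<le> n \<Longrightarrow> f \<in> elems P n \<Longrightarrow> (\<tau> n ^^ k) f \<in> elems P n"
  by (rule linear_closed[OF linear_funpow[OF linear_tau]])

lemma tau_pow_minus:
  "1 \<le> n \<Longrightarrow> f \<in> elems P n \<Longrightarrow>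
    (\<tau> n ^^ k) (\<ominus>\<^bsub>comp_space P n\<^esub> f) = \<ominus>\<^bsub>comp_space P n\<^esub> (\<tau> n ^^ k) f"
  by (rule linear_minus[OF linear_funpow[OF linear_tau]]) (auto intro: comp_space)

lemma tau_pow_comp:
  assumes "t < i" "i \<le> m" "1 \<le> n" "f \<in> elems P m" "g \<in> elems P n"
  shows "(\<tau> (m + n - 1) ^^ t) (pcomp P m n i f g) = pcomp P m n (i - t) ((\<tau> m ^^ t) f) g"
  using assms(1)
proof (induction t)
  case (Suc t)
  have "\<tau> (m + n - 1) (pcomp P m n (i - t) ((\<tau> m ^^ t) f) g)
      = pcomp P m n (i - t - 1) (\<tau> m ((\<tau> m ^^ t) f)) g"
    by (rule tau_comp) (use Suc assms tau_pow_closed in auto)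
  moreover have "i - t - 1 = i - Suc t" by simp
  ultimately show ?case using Suc by simp
qed simp

text \<open>
  After \<open>k - 1\<close> rotations \<open>g\<close> sits at the first input. The next rotation makes \<open>g\<close> the outer
  operation, with the rotated \<open>f\<close> at its last input, and the remaining \<open>u - 1\<close> rotations act on \<open>g\<close>.
\<close>

lemma tau_pow_comp_block:
  assumes "1 \<le> u" "u \<le> n" "1 \<le> k" "k \<le> m" "f \<in> elems P m" "g \<in> elems P n"
  shows "(\<tau> (m + n - 1) ^^ (k - 1 + u)) (pcomp P m n k f g)
    = \<ominus>\<^bsub>comp_space P (m + n - 1)\<^esub> pcomp P n m (n + 1 - u) ((\<tau> n ^^ u) g) ((\<tau> m ^^ k) f)"
proof -
  have mn: "1 \<le> m" "1 \<le> n" "n + m - 1 = m + n - 1" "1 \<le> m + n - 1" using assms by auto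
  let ?f = "(\<tau> m ^^ (k - 1)) f"
  have f: "?f \<in> elems P m" "\<tau> m ?f = (\<tau> m ^^ k) f"
    using assms(3) tau_pow_closed[OF mn(1) assms(5)] funpow_add[of "1" "k - 1" "\<tau> m"]
    by (auto simp: One_nat_def)
  have c: "pcomp P n m n (\<tau> n g) (\<tau> m ?f) \<in> elems P (m + n - 1)"
    unfolding mn(3)[symmetric] by (intro pcomp_closed tau_closed f mn assms order_refl)
  have "(\<tau> (m + n - 1) ^^ (k - 1 + u)) (pcomp P m n k f g)
      = (\<tau> (m + n - 1) ^^ (u - 1 + 1 + (k - 1))) (pcomp P m n k f g)"
    using assms(1) by (simp add: add.commute)
  also have "\<dots> = (\<tau> (m + n - 1) ^^ (u - 1)) (\<tau> (m + n - 1)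
      ((\<tau> (m + n - 1) ^^ (k - 1)) (pcomp P m n k f g)))"
    unfolding funpow_add by (simp add: One_nat_def)
  also have "(\<tau> (m + n - 1) ^^ (k - 1)) (pcomp P m n k f g) = pcomp P m n 1 ?f g"
    using assms by (subst tau_pow_comp) auto
  also have "\<tau> (m + n - 1) (pcomp P m n 1 ?f g)
      = \<ominus>\<^bsub>comp_space P (m + n - 1)\<^esub> pcomp P n m n (\<tau> n g) (\<tau> m ?f)"
    by (rule tau_comp_1[OF mn(1,2) f(1) assms(6)])
  also have "(\<tau> (m + n - 1) ^^ (u - 1)) \<dots>
      = \<ominus>\<^bsub>comp_space P (m + n - 1)\<^esub> (\<tau> (n + m - 1) ^^ (u - 1)) (pcomp P n m n (\<tau> n g) (\<tau> m ?f))"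
    unfolding mn(3) by (rule tau_pow_minus[OF mn(4) c])
  also have "(\<tau> (n + m - 1) ^^ (u - 1)) (pcomp P n m n (\<tau> n g) (\<tau> m ?f))
      = pcomp P n m (n - (u - 1)) ((\<tau> n ^^ (u - 1)) (\<tau> n g)) (\<tau> m ?f)"
    by (rule tau_pow_comp) (use assms mn f(1) tau_closed in auto)
  also have "(\<tau> n ^^ (u - 1)) (\<tau> n g) = (\<tau> n ^^ u) g"
    using assms(1) funpow_add[of "u - 1" 1 "\<tau> n"] by (simp add: One_nat_def)
  also have "n - (u - 1) = n + 1 - u" using assms by simp
  finally show ?thesis unfolding f(2) .
qed

text \<open>
  After a full turn through the inputs of \<open>g\<close>, the operation \<open>f\<close> is at the first input of \<open>g\<close>, and
  one more rotation exchanges the two again. The two signs cancel.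
\<close>

lemma tau_pow_comp_across:
  assumes "1 \<le> k" "k \<le> m" "1 \<le> n" "f \<in> elems P m" "g \<in> elems P n"
  shows "(\<tau> (m + n - 1) ^^ (k + n)) (pcomp P m n k f g)
    = pcomp P m n m ((\<tau> m ^^ (k + 1)) f) ((\<tau> n ^^ (n + 1)) g)"
proof -
  have mn: "1 \<le> m" "n + m - 1 = m + n - 1" "1 \<le> m + n - 1" using assms by auto
  interpret M: module rat_field "comp_space P (m + n - 1)" by (rule comp_space[OF mn(3)])
  let ?g = "(\<tau> n ^^ n) g" and ?f = "(\<tau> m ^^ k) f"
  have cl: "?g \<in> elems P n" "?f \<in> elems P m" using assms mn tau_pow_closed by auto
  have c: "pcomp P n m 1 ?g ?f \<in> elems P (m + n - 1)"
    "pcomp P m n m (\<tau> m ?f) (\<tau> n ?g) \<in> elems P (m + n - 1)"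
    using pcomp_closed[of 1 n m ?g ?f] pcomp_closed[of m m n "\<tau> m ?f" "\<tau> n ?g"]
      assms mn cl tau_closed by auto
  have "(\<tau> (m + n - 1) ^^ (k - 1 + n)) (pcomp P m n k f g)
      = \<ominus>\<^bsub>comp_space P (m + n - 1)\<^esub> pcomp P n m 1 ?g ?f"
    using tau_pow_comp_block[of n n k m f g] assms by simp
  then have "(\<tau> (m + n - 1) ^^ (1 + (k - 1 + n))) (pcomp P m n k f g)
      = \<tau> (m + n - 1) (\<ominus>\<^bsub>comp_space P (m + n - 1)\<^esub> pcomp P n m 1 ?g ?f)"
    unfolding funpow_add by (simp add: One_nat_def)
  also have "\<dots> = \<ominus>\<^bsub>comp_space P (m + n - 1)\<^esub> \<tau> (n + m - 1) (pcomp P n m 1 ?g ?f)"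
    using tau_pow_minus[OF mn(3) c(1), of 1] by (simp only: mn(2) funpow_1)
  also have "\<tau> (n + m - 1) (pcomp P n m 1 ?g ?f)
      = \<ominus>\<^bsub>comp_space P (m + n - 1)\<^esub> pcomp P m n m (\<tau> m ?f) (\<tau> n ?g)"
    unfolding mn(2)[symmetric] by (rule tau_comp_1[OF assms(3) mn(1) cl])
  also have "\<ominus>\<^bsub>comp_space P (m + n - 1)\<^esub> \<dots> = pcomp P m n m (\<tau> m ?f) (\<tau> n ?g)"
    by (rule M.minus_minus[OF c(2)])
  finally show ?thesis using assms(1) unfolding funpow_plus_1 by simp
qed

text \<open>
  A full turn of the composition consists of \<open>k + n\<close> rotations, which move \<open>g\<close> from input \<open>k\<close> across
  the output to input \<open>m\<close>, and of \<open>m - k\<close> rotations, which bring it back to input \<open>k\<close>. They rotate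
  \<open>f\<close> by \<open>m + 1\<close> and \<open>g\<close> by \<open>n + 1\<close> steps in total.
\<close>

lemma tau_order_comp:
  assumes "1 \<le> k" "k \<le> m" "1 \<le> n" "f \<in> elems P m" "g \<in> elems P n"
    and "(\<tau> m ^^ (m + 1)) f = f" "(\<tau> n ^^ (n + 1)) g = g"
  shows "(\<tau> (m + n - 1) ^^ (m + n - 1 + 1)) (pcomp P m n k f g) = pcomp P m n k f g"
proof -
  have mn: "1 \<le> m" "m + n - 1 + 1 = (m - k) + (k + n)" using assms by auto
  have "(\<tau> (m + n - 1) ^^ (m + n - 1 + 1)) (pcomp P m n k f g)
      = (\<tau> (m + n - 1) ^^ (m - k)) (pcomp P m n m ((\<tau> m ^^ (k + 1)) f) g)"
    unfolding mn(2) using tau_pow_comp_across[OF assms(1-5)] assms(7)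
    by (simp add: funpow_add)
  also have "\<dots> = pcomp P m n (m - (m - k)) ((\<tau> m ^^ (m - k)) ((\<tau> m ^^ (k + 1)) f)) g"
    by (rule tau_pow_comp) (use assms mn tau_pow_closed[of m f "k + 1"] in auto)
  also have "(\<tau> m ^^ (m - k)) ((\<tau> m ^^ (k + 1)) f) = (\<tau> m ^^ (m - k + (k + 1))) f"
    by (simp add: funpow_add)
  also have "\<dots> = f" using assms(2,6) by simp
  finally show ?thesis using assms(2) by simp
qed

end

sublocale ns_anticyclic_operad \<subseteq> ns_tau_operad P \<tau>
  by unfold_locales (fact tau_linear tau_unit tau_pcomp tau_pcomp_1)+


section \<open>The free operad on binary operations\<close>

abbreviation scale :: "rat \<Rightarrow> ('k \<Rightarrow>\<^sub>0 rat) \<Rightarrow> ('k \<Rightarrow>\<^sub>0 rat)" where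
  "scale c \<equiv> Poly_Mapping.map ((*) c)"

lemma lookup_scale [simp]: "Poly_Mapping.lookup (scale c p) k = c * Poly_Mapping.lookup p k"
  by (simp add: Poly_Mapping.map.rep_eq when_def)

lemma scale_simps [simp]:
  "scale c 0 = 0" "scale 0 p = 0" "scale 1 p = p" "scale (-1) p = - p"
  "scale c (Poly_Mapping.single k a) = Poly_Mapping.single k (c * a)"
  by (auto intro!: poly_mapping_eqI simp: lookup_single when_def)

lemma scale_add_right: "scale c (p + q) = scale c p + scale c q"
  and scale_add_left: "scale (b + c) p = scale b p + scale c p"
  and scale_scale: "scale b (scale c p) = scale (b * c) p"
  and scale_minus: "scale c (- p) = - scale c p"
  by (auto intro!: poly_mapping_eqI simp: lookup_add algebra_simps)

lemma scale_sum: "scale c (sum f A) = (\<Sum>x\<in>A. scale c (f x))"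
  by (induction A rule: infinite_finite_induct) (auto simp: scale_add_right)

lemma keys_scale: "Poly_Mapping.keys (scale c p) \<subseteq> Poly_Mapping.keys p"
  by (auto simp: in_keys_iff)

lemma keys_uminus [simp]: "Poly_Mapping.keys (- p :: 'k \<Rightarrow>\<^sub>0 rat) = Poly_Mapping.keys p"
  by (auto simp: in_keys_iff)

lemma poly_mapping_span_induct [consumes 1, case_names zero single add]:
  fixes p :: "'k \<Rightarrow>\<^sub>0 rat"
  assumes "Poly_Mapping.keys p \<subseteq> B"
    and zero: "Q 0" and single: "\<And>k a. k \<in> B \<Longrightarrow> Q (Poly_Mapping.single k a)"
    and add: "\<And>p q. Poly_Mapping.keys p \<subseteq> B \<Longrightarrow> Poly_Mapping.keys q \<subseteq> B \<Longrightarrow> Q p \<Longrightarrow> Q q \<Longrightarrow> Q (p + q)"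
  shows "Q p"
proof -
  define r where "r A = (\<Sum>k\<in>A. Poly_Mapping.single k (Poly_Mapping.lookup p k))" for A
  have "Poly_Mapping.keys (r A) \<subseteq> B \<and> Q (r A)" if "finite A" "A \<subseteq> B" for A
    using that
  proof (induction A rule: finite_induct)
    case (insert k A)
    have "r (insert k A) = Poly_Mapping.single k (Poly_Mapping.lookup p k) + r A"
      using insert by (simp add: r_def)
    moreover have "Poly_Mapping.keys (Poly_Mapping.single k (Poly_Mapping.lookup p k)) \<subseteq> B"
      using insert by auto
    ultimately show ?case
      using insert single add keys_add[of "Poly_Mapping.single k (Poly_Mapping.lookup p k)" "r A"]
      by auto
  qed (simp add: r_def zero)
  moreover have "r (Poly_Mapping.keys p) = p"
  proof (rule poly_mapping_eqI)
    fix k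
    show "Poly_Mapping.lookup (r (Poly_Mapping.keys p)) k = Poly_Mapping.lookup p k"
      by (cases "k \<in> Poly_Mapping.keys p")
        (auto simp: r_def lookup_sum lookup_single when_def in_keys_iff sum.delta)
  qed
  ultimately show ?thesis using assms(1) by (metis finite_keys)
qed

definition lin_ext :: "('k \<Rightarrow> ('l \<Rightarrow>\<^sub>0 rat)) \<Rightarrow> ('k \<Rightarrow>\<^sub>0 rat) \<Rightarrow> ('l \<Rightarrow>\<^sub>0 rat)" where
  "lin_ext \<phi> p = (\<Sum>k\<in>Poly_Mapping.keys p. scale (Poly_Mapping.lookup p k) (\<phi> k))"

lemma lin_ext_superset:
  assumes "finite A" "Poly_Mapping.keys p \<subseteq> A"
  shows "lin_ext \<phi> p = (\<Sum>k\<in>A. scale (Poly_Mapping.lookup p k) (\<phi> k))"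
  unfolding lin_ext_def by (rule sum.mono_neutral_left) (use assms in \<open>auto simp: in_keys_iff\<close>)

lemma lin_ext_zero [simp]: "lin_ext \<phi> 0 = 0"
  by (simp add: lin_ext_def)

lemma lin_ext_single [simp]: "lin_ext \<phi> (Poly_Mapping.single k a) = scale a (\<phi> k)"
  by (subst lin_ext_superset[of "{k}"]) auto

lemma lin_ext_add: "lin_ext \<phi> (p + q) = lin_ext \<phi> p + lin_ext \<phi> q"
  using keys_add[of p q]
  by (simp add: lin_ext_superset[of "Poly_Mapping.keys p \<union> Poly_Mapping.keys q"] lookup_add
      scale_add_left sum.distrib)

lemma lin_ext_scale: "lin_ext \<phi> (scale c p) = scale c (lin_ext \<phi> p)"
  using keys_scale[of c p]
  by (simp add: lin_ext_superset[of "Poly_Mapping.keys p"] scale_scale scale_sum)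

lemma lin_ext_minus: "lin_ext \<phi> (- p) = - lin_ext \<phi> p"
  using lin_ext_scale[of \<phi> "-1" p] by simp

lemma lin_ext_diff: "lin_ext \<phi> (p - q) = lin_ext \<phi> p - lin_ext \<phi> q"
  using lin_ext_add[of \<phi> p "- q"] by (simp add: lin_ext_minus)

lemma keys_lin_ext:
  assumes "\<And>k. k \<in> Poly_Mapping.keys p \<Longrightarrow> Poly_Mapping.keys (\<phi> k) \<subseteq> B"
  shows "Poly_Mapping.keys (lin_ext \<phi> p) \<subseteq> B"
  unfolding lin_ext_def
  by (intro order_trans[OF keys_sum] UN_least order_trans[OF keys_scale] assms)

text \<open>The composition of the free operad as a bilinear extension, so that identities reduce to trees.\<close>

definition lin_graft :: "nat \<Rightarrow> ('g tree \<Rightarrow>\<^sub>0 rat) \<Rightarrow> ('g tree \<Rightarrow>\<^sub>0 rat) \<Rightarrow> ('g tree \<Rightarrow>\<^sub>0 rat)" where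
  "lin_graft i p q =
     lin_ext (\<lambda>s. lin_ext (\<lambda>t. Poly_Mapping.single (graft i s t) 1) q) p"

lemma pcomp_free: "pcomp free_binary_operad m n i = lin_graft i"
  by (intro ext) (simp add: free_binary_operad_def lin_graft_def lin_ext_def scale_sum)

lemma lin_graft_single [simp]:
  "lin_graft i (Poly_Mapping.single s a) (Poly_Mapping.single t b)
    = Poly_Mapping.single (graft i s t) (a * b)"
  by (simp add: lin_graft_def)

lemma lin_graft_zero [simp]: "lin_graft i 0 q = 0" "lin_graft i p 0 = 0"
  by (simp_all add: lin_graft_def) (simp add: lin_ext_def)

lemma lin_graft_add_left: "lin_graft i (p + p') q = lin_graft i p q + lin_graft i p' q"
  by (simp add: lin_graft_def lin_ext_add)

lemma lin_graft_add_right: "lin_graft i p (q + q') = lin_graft i p q + lin_graft i p q'"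
  unfolding lin_graft_def lin_ext_add[of _ q q'] by (simp add: lin_ext_def scale_add_right sum.distrib)

lemma lin_graft_scale_left: "lin_graft i (scale c p) q = scale c (lin_graft i p q)"
  by (simp add: lin_graft_def lin_ext_scale)

lemma lin_graft_scale_right: "lin_graft i p (scale c q) = scale c (lin_graft i p q)"
  unfolding lin_graft_def lin_ext_scale[of _ c q]
  by (simp add: lin_ext_def scale_scale scale_sum mult.left_commute)

lemma lin_graft_minus:
  "lin_graft i (- p) q = - lin_graft i p q" "lin_graft i p (- q) = - lin_graft i p q"
  using lin_graft_scale_left[of i "-1" p q] lin_graft_scale_right[of i p "-1" q] by simp_all

lemma lin_graft_diff:
  "lin_graft i (p - p') q = lin_graft i p q - lin_graft i p' q"
  "lin_graft i p (q - q') = lin_graft i p q - lin_graft i p q'"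
  using lin_graft_add_left[of i p "- p'" q] lin_graft_add_right[of i p q "- q'"]
  by (simp_all add: lin_graft_minus)

abbreviation trees :: "nat \<Rightarrow> 'g tree set" where
  "trees n \<equiv> {t. size1 t = n}"

lemma size1_pos: "1 \<le> size1 t"
  by (simp add: size1_size)

lemma size1_graft: "1 \<le> i \<Longrightarrow> i \<le> size1 s \<Longrightarrow> size1 (graft i s t) = size1 s + size1 t - 1"
proof (induction s arbitrary: i)
  case (Node l g r)
  then show ?case using size1_pos[of l] size1_pos[of r] by auto
qed simp

lemma graft_Leaf: "1 \<le> i \<Longrightarrow> i \<le> size1 s \<Longrightarrow> graft i s \<langle>\<rangle> = s"
  by (induction s arbitrary: i) auto

lemma graft_sequential:
  "1 \<le> i \<Longrightarrow> i \<le> size1 s \<Longrightarrow> 1 \<le> j \<Longrightarrow> j \<le> size1 t \<Longrightarrow>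
    graft (i + j - 1) (graft i s t) u = graft i s (graft j t u)"
proof (induction s arbitrary: i)
  case (Node l g r)
  show ?case
  proof (cases "i \<le> size1 l")
    case True
    then have "i + j - 1 \<le> size1 l + size1 t - 1" using Node.prems by simp
    then show ?thesis using True Node by (simp add: size1_graft)
  next
    case False
    then have "i - size1 l + j - 1 = i + j - 1 - size1 l" "\<not> i + j - 1 \<le> size1 l"
      using Node.prems by auto
    then show ?thesis using Node.IH(2)[of "i - size1 l"] Node.prems False by simp
  qed
qed simp

lemma graft_parallel:
  "1 \<le> i \<Longrightarrow> i < k \<Longrightarrow> k \<le> size1 s \<Longrightarrow>
    graft (k + size1 t - 1) (graft i s t) u = graft i (graft k s u) t"
proof (induction s arbitrary: i k)
  case (Node l g r)
  consider "k \<le> size1 l" | "i \<le> size1 l" "size1 l < k" | "size1 l < i" by linarith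
  then show ?case
  proof cases
    case 1
    then have "k + size1 t - 1 \<le> size1 l + size1 t - 1" "i \<le> size1 l + size1 u - 1"
      using Node.prems size1_pos[of u] by auto
    then show ?thesis using Node 1 by (simp add: size1_graft)
  next
    case 2
    then have "k + size1 t - 1 - (size1 l + size1 t - 1) = k - size1 l"
      "\<not> k + size1 t - 1 \<le> size1 l + size1 t - 1"
      using size1_pos[of t] by auto
    then show ?thesis using Node.prems 2 size1_pos[of t] by (simp add: size1_graft)
  next
    case 3
    then have "k - size1 l + size1 t - 1 = k + size1 t - 1 - size1 l"
      "\<not> k + size1 t - 1 \<le> size1 l"
      using \<open>i < k\<close> by linarith+
    then show ?thesis
      using Node.IH(2)[of "i - size1 l" "k - size1 l"] Node.prems 3 size1_pos[of t] by simp
  qed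
qed simp

lemma lin_graft_sequential:
  assumes "1 \<le> i" "i \<le> m" "1 \<le> j" "j \<le> n"
    and p: "Poly_Mapping.keys p \<subseteq> trees m" and q: "Poly_Mapping.keys q \<subseteq> trees n"
  shows "lin_graft (i + j - 1) (lin_graft i p q) r = lin_graft i p (lin_graft j q r)"
  using p
proof (induction p rule: poly_mapping_span_induct)
  case (single s a)
  show ?case
    using q
  proof (induction q rule: poly_mapping_span_induct)
    case (single t b)
    have "Poly_Mapping.keys r \<subseteq> UNIV" by simp
    then show ?case
    proof (induction r rule: poly_mapping_span_induct)
      case (single u c)
      then show ?case using \<open>s \<in> trees m\<close> \<open>t \<in> trees n\<close> assms(1-4)
        by (simp add: graft_sequential mult.assoc)
    qed (simp_all add: lin_graft_add_right)
  qed (simp_all add: lin_graft_add_left lin_graft_add_right)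
qed (simp_all add: lin_graft_add_left)

lemma lin_graft_parallel:
  assumes "1 \<le> i" "i < k" "k \<le> m"
    and p: "Poly_Mapping.keys p \<subseteq> trees m" and q: "Poly_Mapping.keys q \<subseteq> trees n"
  shows "lin_graft (k + n - 1) (lin_graft i p q) r = lin_graft i (lin_graft k p r) q"
  using p
proof (induction p rule: poly_mapping_span_induct)
  case (single s a)
  show ?case
    using q
  proof (induction q rule: poly_mapping_span_induct)
    case (single t b)
    have "Poly_Mapping.keys r \<subseteq> UNIV" by simp
    then show ?case
    proof (induction r rule: poly_mapping_span_induct)
      case (single u c)
      then show ?case using \<open>s \<in> trees m\<close> \<open>t \<in> trees n\<close> assms(1-3)
        by (auto simp: graft_parallel mult_ac)
    qed (simp_all add: lin_graft_add_right lin_graft_add_left)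
  qed (simp_all add: lin_graft_add_left lin_graft_add_right)
qed (simp_all add: lin_graft_add_left)

lemma keys_lin_graft:
  assumes "1 \<le> i" "i \<le> m" "Poly_Mapping.keys p \<subseteq> trees m" "Poly_Mapping.keys q \<subseteq> trees n"
  shows "Poly_Mapping.keys (lin_graft i p q) \<subseteq> trees (m + n - 1)"
  unfolding lin_graft_def
proof (intro keys_lin_ext)
  fix s t assume "s \<in> Poly_Mapping.keys p" "t \<in> Poly_Mapping.keys q"
  then have "size1 s = m" "size1 t = n" using assms(3,4) by auto
  then show "Poly_Mapping.keys (Poly_Mapping.single (graft i s t) (1 :: rat)) \<subseteq> trees (m + n - 1)"
    using assms(1,2) by (simp add: size1_graft)
qed

lemma free_simps [simp]:
  "elems free_binary_operad n = {p. Poly_Mapping.keys p \<subseteq> trees n}"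
  "op_unit free_binary_operad = Poly_Mapping.single \<langle>\<rangle> 1"
  "\<zero>\<^bsub>comp_space free_binary_operad n\<^esub> = 0"
  "p \<oplus>\<^bsub>comp_space free_binary_operad n\<^esub> q = p + q"
  "c \<odot>\<^bsub>comp_space free_binary_operad n\<^esub> p = scale c p"
  by (simp_all add: free_binary_operad_def)

lemma module_free: "module rat_field (comp_space free_binary_operad n)"
proof (rule rat_moduleI)
  show "x \<oplus>\<^bsub>comp_space free_binary_operad n\<^esub> y \<in> elems free_binary_operad n"
    if "x \<in> elems free_binary_operad n" "y \<in> elems free_binary_operad n" for x y
    using that keys_add[of x y] unfolding free_simps by blast
  show "c \<odot>\<^bsub>comp_space free_binary_operad n\<^esub> x \<in> elems free_binary_operad n"
    if "x \<in> elems free_binary_operad n" for c x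
    using that keys_scale[of c x] unfolding free_simps by blast
qed (simp_all only: free_simps scale_simps scale_scale scale_add_left scale_add_right
  add.assoc add.commute add_0_left, simp_all)

lemma free_minus:
  "p \<in> elems free_binary_operad n \<Longrightarrow> \<ominus>\<^bsub>comp_space free_binary_operad n\<^esub> p = - p"
  using smult_minus_one[OF module_free, of p n] by simp

lemma ns_operad_free: "ns_operad (free_binary_operad :: ('g tree \<Rightarrow>\<^sub>0 rat) operad)"
proof (rule ns_operad.intro)
  fix i m n :: nat and g :: "'g tree \<Rightarrow>\<^sub>0 rat"
  assume "1 \<le> i" "i \<le> m" "1 \<le> n" "g \<in> elems free_binary_operad n"
  then show "(\<lambda>f. pcomp free_binary_operad m n i f g)
      \<in> linear_maps (comp_space free_binary_operad m) (comp_space free_binary_operad (m + n - 1))"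
    by (intro linear_mapsI)
      (simp_all add: pcomp_free lin_graft_add_left lin_graft_scale_left keys_lin_graft)
next
  fix i m n :: nat and f :: "'g tree \<Rightarrow>\<^sub>0 rat"
  assume "1 \<le> i" "i \<le> m" "1 \<le> n" "f \<in> elems free_binary_operad m"
  then show "(\<lambda>g. pcomp free_binary_operad m n i f g)
      \<in> linear_maps (comp_space free_binary_operad n) (comp_space free_binary_operad (m + n - 1))"
    by (intro linear_mapsI)
      (simp_all add: pcomp_free lin_graft_add_right lin_graft_scale_right keys_lin_graft)
next
  fix n :: nat and g :: "'g tree \<Rightarrow>\<^sub>0 rat"
  assume "g \<in> elems free_binary_operad n"
  then have "Poly_Mapping.keys g \<subseteq> trees n" by simp
  then have "lin_graft 1 (Poly_Mapping.single \<langle>\<rangle> 1) g = g"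
    by (induction g rule: poly_mapping_span_induct) (auto simp: lin_graft_add_right)
  then show "pcomp free_binary_operad 1 n 1 (op_unit free_binary_operad) g = g"
    by (simp add: pcomp_free)
next
  fix i m :: nat and f :: "'g tree \<Rightarrow>\<^sub>0 rat"
  assume i: "1 \<le> i" "i \<le> m" and "f \<in> elems free_binary_operad m"
  then have "Poly_Mapping.keys f \<subseteq> trees m" by simp
  then have "lin_graft i f (Poly_Mapping.single \<langle>\<rangle> 1) = f"
    by (induction f rule: poly_mapping_span_induct)
      (use i in \<open>auto simp: lin_graft_add_left graft_Leaf\<close>)
  then show "pcomp free_binary_operad m 1 i f (op_unit free_binary_operad) = f"
    by (simp add: pcomp_free)
qed (auto simp: module_free pcomp_free lin_graft_sequential lin_graft_parallel)


section \<open>The cyclic structure of Dend\<close>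

text \<open>
  The value \<open>rotated_gen g r\<close> is \<open>\<tau>(g) \<circ>\<^sub>1 r\<close>. As \<open>\<langle>l, g, r\<rangle> = (g \<circ>\<^sub>2 r) \<circ>\<^sub>1 l\<close>, the identities for
  \<open>\<tau>\<close> of a composition leave only one possible value of \<open>\<tau>\<close> on a tree.
\<close>

fun rotated_gen :: "dend_gen \<Rightarrow> dend_gen tree \<Rightarrow> dend_gen tree \<Rightarrow>\<^sub>0 rat" where
  "rotated_gen Succ r = tree_monomial \<langle>r, Prec, \<langle>\<rangle>\<rangle>"
| "rotated_gen Prec r = - tree_monomial \<langle>r, Prec, \<langle>\<rangle>\<rangle> - tree_monomial \<langle>r, Succ, \<langle>\<rangle>\<rangle>"

fun tree_tau :: "dend_gen tree \<Rightarrow> dend_gen tree \<Rightarrow>\<^sub>0 rat" where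
  "tree_tau \<langle>\<rangle> = - tree_monomial \<langle>\<rangle>"
| "tree_tau \<langle>l, g, r\<rangle> = - lin_graft (size1 l) (tree_tau l) (rotated_gen g r)"

definition free_tau :: "nat \<Rightarrow> (dend_gen tree \<Rightarrow>\<^sub>0 rat) \<Rightarrow> (dend_gen tree \<Rightarrow>\<^sub>0 rat)" where
  "free_tau n = lin_ext tree_tau"

lemma keys_diff_subset:
  "Poly_Mapping.keys p \<subseteq> B \<Longrightarrow> Poly_Mapping.keys q \<subseteq> B \<Longrightarrow> Poly_Mapping.keys (p - q :: 'k \<Rightarrow>\<^sub>0 rat) \<subseteq> B"
  using keys_add[of p "- q"] by auto

lemma keys_rotated_gen: "Poly_Mapping.keys (rotated_gen g r) \<subseteq> trees (size1 r + 1)"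
  by (cases g) (simp_all add: keys_diff_subset)

lemma keys_tree_tau: "Poly_Mapping.keys (tree_tau t) \<subseteq> trees (size1 t)"
proof (induction t)
  case (Node l g r)
  then show ?case
    using keys_lin_graft[of "size1 l" "size1 l" "tree_tau l" "rotated_gen g r" "size1 r + 1"]
      size1_pos[of l] keys_rotated_gen[of g r] by simp
qed simp

lemma rotated_gen_graft:
  "1 \<le> i \<Longrightarrow> i \<le> size1 r \<Longrightarrow>
    rotated_gen g (graft i r t) = lin_graft i (rotated_gen g r) (tree_monomial t)"
  by (cases g) (simp_all add: lin_graft_minus lin_graft_diff)

lemma tree_tau_graft:
  "2 \<le> i \<Longrightarrow> i \<le> size1 s \<Longrightarrow>
    tree_tau (graft i s t) = lin_graft (i - 1) (tree_tau s) (tree_monomial t)"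
proof (induction s arbitrary: i)
  case (Node l g r)
  note k = keys_tree_tau[of l] keys_rotated_gen[of g r]
  show ?case
  proof (cases "i \<le> size1 l")
    case True
    then have IH: "tree_tau (graft i l t) = lin_graft (i - 1) (tree_tau l) (tree_monomial t)"
      using Node by auto
    have "lin_graft (size1 l + size1 t - 1)
        (lin_graft (i - 1) (tree_tau l) (tree_monomial t)) (rotated_gen g r)
      = lin_graft (i - 1) (lin_graft (size1 l) (tree_tau l) (rotated_gen g r)) (tree_monomial t)"
      by (rule lin_graft_parallel[of "i - 1" "size1 l" "size1 l"]) (use True Node.prems k in auto)
    then show ?thesis
      using True Node.prems by (simp add: IH size1_graft lin_graft_minus)
  next
    case False
    have "lin_graft (size1 l + (i - size1 l) - 1)
        (lin_graft (size1 l) (tree_tau l) (rotated_gen g r)) (tree_monomial t)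
      = lin_graft (size1 l) (tree_tau l)
          (lin_graft (i - size1 l) (rotated_gen g r) (tree_monomial t))"
      by (rule lin_graft_sequential[of _ "size1 l" _ "size1 r + 1"])
        (use False Node.prems k size1_pos[of l] in auto)
    then show ?thesis
      using False Node.prems by (simp add: rotated_gen_graft lin_graft_minus)
  qed
qed simp

lemma tree_tau_graft_1:
  "tree_tau (graft 1 s t) = - lin_graft (size1 t) (tree_tau t) (tree_tau s)"
proof (induction s)
  case Leaf
  have "lin_graft (size1 t) p (tree_monomial \<langle>\<rangle>) = p" if "Poly_Mapping.keys p \<subseteq> trees (size1 t)"
    for p :: "dend_gen tree \<Rightarrow>\<^sub>0 rat"
    using that by (induction p rule: poly_mapping_span_induct)
      (use size1_pos[of t] in \<open>auto simp: lin_graft_add_left graft_Leaf\<close>)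
  then show ?case by (simp add: lin_graft_minus keys_tree_tau)
next
  case (Node l g r)
  have l: "1 \<le> size1 l" "1 \<le> size1 t" by (simp_all add: size1_pos)
  have "lin_graft (size1 t + size1 l - 1)
      (lin_graft (size1 t) (tree_tau t) (tree_tau l)) (rotated_gen g r)
    = lin_graft (size1 t) (tree_tau t) (lin_graft (size1 l) (tree_tau l) (rotated_gen g r))"
    by (rule lin_graft_sequential[OF l(2) order_refl l(1) order_refl]) (rule keys_tree_tau)+
  then show ?case
    using l Node.IH(1) by (simp add: size1_graft lin_graft_minus add.commute)
qed

lemma tree_Node_eq_grafts:
  "tree_monomial \<langle>l, g, r\<rangle> = lin_graft 1 (lin_graft 2 (tree_monomial \<langle>\<langle>\<rangle>, g, \<langle>\<rangle>\<rangle>) (tree_monomial r))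
    (tree_monomial l)"
  by simp

lemma free_tau_linear:
  "free_tau n \<in> linear_maps (comp_space free_binary_operad n) (comp_space free_binary_operad n)"
proof (rule linear_mapsI)
  show "free_tau n x \<in> elems free_binary_operad n" if "x \<in> elems free_binary_operad n" for x
  proof -
    have "Poly_Mapping.keys (tree_tau t) \<subseteq> trees n" if "t \<in> Poly_Mapping.keys x" for t
      using keys_tree_tau[of t] that \<open>x \<in> elems free_binary_operad n\<close> by auto
    then have "Poly_Mapping.keys (lin_ext tree_tau x) \<subseteq> trees n" by (rule keys_lin_ext)
    then show ?thesis by (simp add: free_tau_def)
  qed
qed (simp_all add: free_tau_def lin_ext_add lin_ext_scale)

lemma free_tau_operad: "ns_tau_operad free_binary_operad free_tau"
proof (intro ns_tau_operad.intro ns_operad_free ns_tau_operad_axioms.intro)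
  fix i m n :: nat and f g :: "dend_gen tree \<Rightarrow>\<^sub>0 rat"
  assume *: "2 \<le> i" "i \<le> m" and "f \<in> elems free_binary_operad m" "g \<in> elems free_binary_operad n"
  then have f: "Poly_Mapping.keys f \<subseteq> trees m" and g: "Poly_Mapping.keys g \<subseteq> trees n" by auto
  have "lin_ext tree_tau (lin_graft i f g) = lin_graft (i - 1) (lin_ext tree_tau f) g"
    using f
  proof (induction f rule: poly_mapping_span_induct)
    case (single s a)
    show ?case
      using g
    proof (induction g rule: poly_mapping_span_induct)
      case (single t b)
      have "lin_graft (i - 1) (scale a (tree_tau s)) (scale b (tree_monomial t))
          = scale (a * b) (lin_graft (i - 1) (tree_tau s) (tree_monomial t))"
        by (simp only: mult.commute lin_graft_scale_left lin_graft_scale_right scale_scale)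
      then show ?case using tree_tau_graft[of i s t] * \<open>s \<in> trees m\<close> by simp
    qed (simp_all add: lin_graft_add_right lin_ext_add)
  qed (simp_all add: lin_graft_add_left lin_ext_add)
  then show "free_tau (m + n - 1) (pcomp free_binary_operad m n i f g)
      = pcomp free_binary_operad m n (i - 1) (free_tau m f) g"
    by (simp add: free_tau_def pcomp_free)
next
  fix m n :: nat and f g :: "dend_gen tree \<Rightarrow>\<^sub>0 rat"
  assume *: "1 \<le> m" "1 \<le> n"
    and "f \<in> elems free_binary_operad m" "g \<in> elems free_binary_operad n"
  then have f: "Poly_Mapping.keys f \<subseteq> trees m" and g: "Poly_Mapping.keys g \<subseteq> trees n" by auto
  have "lin_ext tree_tau (lin_graft 1 f g) = - lin_graft n (lin_ext tree_tau g) (lin_ext tree_tau f)"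
    using f
  proof (induction f rule: poly_mapping_span_induct)
    case (single s a)
    show ?case
      using g
    proof (induction g rule: poly_mapping_span_induct)
      case (single t b)
      have "lin_graft n (scale b (tree_tau t)) (scale a (tree_tau s))
          = scale (a * b) (lin_graft n (tree_tau t) (tree_tau s))"
        by (simp only: mult.commute lin_graft_scale_left lin_graft_scale_right scale_scale)
      then show ?case using tree_tau_graft_1[of s t] \<open>t \<in> trees n\<close> by (simp add: scale_minus)
    qed (simp_all add: lin_graft_add_right lin_graft_add_left lin_ext_add)
  qed (simp_all add: lin_graft_add_left lin_graft_add_right lin_ext_add)
  moreover have "pcomp free_binary_operad n m n (free_tau n g) (free_tau m f)
      \<in> elems free_binary_operad (n + m - 1)"
    by (rule ns_operad.pcomp_closed[OF ns_operad_free])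
      (use * f g linear_closed[OF free_tau_linear] in auto)
  ultimately show "free_tau (m + n - 1) (pcomp free_binary_operad m n 1 f g)
      = \<ominus>\<^bsub>comp_space free_binary_operad (m + n - 1)\<^esub>
          pcomp free_binary_operad n m n (free_tau n g) (free_tau m f)"
    by (simp add: free_minus pcomp_free free_tau_def add.commute)
next
  show "free_tau 1 (op_unit free_binary_operad)
      = \<ominus>\<^bsub>comp_space free_binary_operad 1\<^esub> op_unit free_binary_operad"
    by (simp add: free_minus free_tau_def)
qed (rule free_tau_linear)

text \<open>
  On generators \<open>\<tau>\<^sub>2\<close> is \<open>\<succ> \<mapsto> \<prec> \<mapsto> - \<prec> - \<succ> \<mapsto> \<succ>\<close>, of order \<open>3\<close>. A tree
  is a composition of generators, and compositions inherit the order.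
\<close>

lemma free_tau_order_tree: "(lin_ext tree_tau ^^ (size1 t + 1)) (tree_monomial t) = tree_monomial t"
proof -
  interpret F: ns_tau_operad free_binary_operad free_tau by (rule free_tau_operad)
  note order_graft = F.tau_order_comp[unfolded pcomp_free free_tau_def]
  show ?thesis
  proof (induction t)
    case Leaf
    then show ?case by (simp add: lin_ext_minus numeral_2_eq_2)
  next
    case (Node l g r)
    let ?g = "tree_monomial \<langle>\<langle>\<rangle>, g, \<langle>\<rangle>\<rangle>"
    have e: "2 + size1 r - 1 + 1 = size1 r + 1 + 1"
      "size1 r + 1 + size1 l - 1 + 1 = size1 \<langle>l, g, r\<rangle> + 1"
      by simp_all
    have "(lin_ext tree_tau ^^ (2 + 1)) ?g = ?g"
      by (cases g) (simp_all add: numeral_3_eq_3 lin_ext_minus lin_ext_diff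
          lin_graft_minus lin_graft_diff)
    then have "(lin_ext tree_tau ^^ (2 + size1 r - 1 + 1)) (lin_graft 2 ?g (tree_monomial r))
        = lin_graft 2 ?g (tree_monomial r)"
      by (intro order_graft) (use size1_pos[of r] Node.IH(2) in auto)
    then have "(lin_ext tree_tau ^^ (size1 r + 1 + size1 l - 1 + 1))
        (lin_graft 1 (lin_graft 2 ?g (tree_monomial r)) (tree_monomial l))
      = lin_graft 1 (lin_graft 2 ?g (tree_monomial r)) (tree_monomial l)"
      unfolding e(1)
      by (intro order_graft Node.IH(1)) (use size1_pos[of l] size1_pos[of r] in auto)
    then show ?case unfolding e(2) tree_Node_eq_grafts[symmetric] .
  qed
qed

lemma free_tau_order:
  assumes "Poly_Mapping.keys p \<subseteq> trees n"
  shows "(free_tau n ^^ (n + 1)) p = p"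
proof -
  note L = linear_funpow[OF free_tau_linear, of "n + 1" n]
  show ?thesis
    using assms
  proof (induction p rule: poly_mapping_span_induct)
    case zero
    show ?case using linear_zero[OF L module_free module_free] by simp
  next
    case (single t a)
    have "tree_monomial t \<in> elems free_binary_operad n" using single by simp
    from linear_smult[OF L this, of a] free_tau_order_tree[of t] show ?case
      using single by (simp add: free_tau_def)
  next
    case (add p q)
    then show ?case using linear_add[OF L, of p q] by simp
  qed
qed

lemma free_anticyclic: "ns_anticyclic_operad free_binary_operad free_tau"
proof -
  interpret ns_tau_operad free_binary_operad free_tau by (rule free_tau_operad)
  show ?thesis
    by (intro ns_anticyclic_operad.intro ns_operad_axioms ns_anticyclic_operad_axioms.intro)
      (use linear_tau tau_of_unit tau_comp tau_comp_1 free_tau_order in auto)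
qed

lemma dend_relations_subset: "dend_relations n \<subseteq> elems free_binary_operad n"
proof -
  have "Poly_Mapping.keys (p + q) \<subseteq> B" if "Poly_Mapping.keys p \<subseteq> B" "Poly_Mapping.keys q \<subseteq> B"
    for p q :: "dend_gen tree \<Rightarrow>\<^sub>0 rat" and B
    using that keys_add[of p q] by blast
  then show ?thesis
    by (simp add: dend_relations_def keys_diff_subset)
qed

lemma dend_ideal: "operad_ideal free_binary_operad dend_ideal"
proof -
  interpret ns_operad "free_binary_operad :: (dend_gen tree \<Rightarrow>\<^sub>0 rat) operad"
    by (rule ns_operad_free)
  have "dend_relations k \<subseteq> (if k = 0 then UNIV else elems free_binary_operad k)" for k
    using dend_relations_subset by simp
  then show ?thesis
    unfolding dend_ideal_def
    by (intro operad_ideal_generated[where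
          ?J0.0 = "\<lambda>k. if k = 0 then UNIV else elems free_binary_operad k"]
        operad_ideal_improper)
qed

text \<open>
  With \<open>r\<^sub>1\<close>, \<open>r\<^sub>2\<close>, \<open>r\<^sub>3\<close> the three relations, \<open>\<tau> r\<^sub>2 = r\<^sub>1\<close>, \<open>\<tau> r\<^sub>3 = - r\<^sub>2\<close> and
  \<open>\<tau> r\<^sub>1 = r\<^sub>1 - r\<^sub>2 - r\<^sub>3\<close>.
\<close>

lemma free_tau_relations:
  assumes "f \<in> dend_relations n"
  shows "free_tau n f \<in> dend_ideal n"
proof -
  define r1 where "r1 = tree_monomial \<langle>\<langle>\<langle>\<rangle>, Prec, \<langle>\<rangle>\<rangle>, Prec, \<langle>\<rangle>\<rangle>
    - (tree_monomial \<langle>\<langle>\<rangle>, Prec, \<langle>\<langle>\<rangle>, Prec, \<langle>\<rangle>\<rangle>\<rangle> + tree_monomial \<langle>\<langle>\<rangle>, Prec, \<langle>\<langle>\<rangle>, Succ, \<langle>\<rangle>\<rangle>\<rangle>)"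
  define r2 where "r2 = tree_monomial \<langle>\<langle>\<rangle>, Succ, \<langle>\<langle>\<rangle>, Prec, \<langle>\<rangle>\<rangle>\<rangle>
    - tree_monomial \<langle>\<langle>\<langle>\<rangle>, Succ, \<langle>\<rangle>\<rangle>, Prec, \<langle>\<rangle>\<rangle>"
  define r3 where "r3 = tree_monomial \<langle>\<langle>\<rangle>, Succ, \<langle>\<langle>\<rangle>, Succ, \<langle>\<rangle>\<rangle>\<rangle>
    - (tree_monomial \<langle>\<langle>\<langle>\<rangle>, Succ, \<langle>\<rangle>\<rangle>, Succ, \<langle>\<rangle>\<rangle> + tree_monomial \<langle>\<langle>\<langle>\<rangle>, Prec, \<langle>\<rangle>\<rangle>, Succ, \<langle>\<rangle>\<rangle>)"
  have n: "n = 3" and f: "f \<in> {r1, r2, r3}"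
    using assms by (auto simp: dend_relations_def r1_def r2_def r3_def split: if_splits)
  have tau: "free_tau 3 r1 = r1 - r2 - r3" "free_tau 3 r2 = r1" "free_tau 3 r3 = - r2"
    by (simp_all add: r1_def r2_def r3_def free_tau_def lin_ext_add lin_ext_diff
        lin_graft_minus lin_graft_diff algebra_simps)
  note I = module_free operad_idealD(1)[OF dend_ideal, of 3]
  have r: "r1 \<in> dend_ideal 3" "r2 \<in> dend_ideal 3" "r3 \<in> dend_ideal 3"
    using ideal_generated_incl[of dend_relations 3 "operad_ideal free_binary_operad"]
    by (auto simp: dend_relations_def r1_def r2_def r3_def dend_ideal_def)
  have minus: "- p \<in> dend_ideal 3" if "p \<in> dend_ideal 3" for p
    using submodule_smult[OF I that, of "-1"] by simp
  have add: "p + q \<in> dend_ideal 3" if "p \<in> dend_ideal 3" "q \<in> dend_ideal 3" for p q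
    using submodule_add[OF I that] by simp
  have "free_tau 3 r1 \<in> dend_ideal 3" "free_tau 3 r2 \<in> dend_ideal 3" "free_tau 3 r3 \<in> dend_ideal 3"
    using add[OF add[OF r(1) minus[OF r(2)]] minus[OF r(3)]] r(1) minus[OF r(2)]
    by (simp_all add: tau)
  then show ?thesis using f n by auto
qed

abbreviation dend_proj :: "nat \<Rightarrow> (dend_gen tree \<Rightarrow>\<^sub>0 rat) \<Rightarrow> ns_dend_elem" where
  "dend_proj \<equiv> quot_proj free_binary_operad dend_ideal"

lemma dend_surjection: "operad_surjection free_binary_operad ns_Dend dend_proj"
  by (rule ns_operad.quot_surjection[OF ns_operad_free dend_ideal])
    (simp_all add: ns_Dend_def quot_operad_def)

interpretation dend_quot: operad_surjection free_binary_operad ns_Dend dend_proj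
  by (rule dend_surjection)

lemma dend_proj_tree_Node:
  "dend_proj (size1 \<langle>l, g, r\<rangle>) (tree_monomial \<langle>l, g, r\<rangle>)
    = pcomp ns_Dend (2 + size1 r - 1) (size1 l) 1
        (pcomp ns_Dend 2 (size1 r) 2 (dend_op g) (dend_proj (size1 r) (tree_monomial r)))
        (dend_proj (size1 l) (tree_monomial l))"
proof -
  have "pcomp ns_Dend 2 (size1 r) 2 (dend_op g) (dend_proj (size1 r) (tree_monomial r))
      = dend_proj (2 + size1 r - 1) (lin_graft 2 (tree_monomial \<langle>\<langle>\<rangle>, g, \<langle>\<rangle>\<rangle>) (tree_monomial r))"
    unfolding dend_op_def by (subst dend_quot.proj_pcomp) (simp_all add: size1_pos pcomp_free)
  also have "pcomp ns_Dend (2 + size1 r - 1) (size1 l) 1 \<dots> (dend_proj (size1 l) (tree_monomial l))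
      = dend_proj (2 + size1 r - 1 + size1 l - 1) (tree_monomial \<langle>l, g, r\<rangle>)"
    by (subst dend_quot.proj_pcomp) (simp_all add: size1_pos pcomp_free)
  finally show ?thesis by (simp add: add.commute)
qed

text \<open>
  The class of a tree is a composition of generators and the unit, and the axioms compute \<open>\<tau>\<close> of a
  composition from \<open>\<tau>\<close> of its parts.
\<close>

lemma dend_tau_unique:
  assumes "ns_anticyclic_operad ns_Dend \<tau>" "ns_anticyclic_operad ns_Dend \<tau>'"
    and gen: "\<And>g. \<tau> 2 (dend_op g) = \<tau>' 2 (dend_op g)"
    and n: "1 \<le> n" and u: "u \<in> elems ns_Dend n"
  shows "\<tau> n u = \<tau>' n u"
proof -
  interpret ns_operad ns_Dend by (rule dend_quot.target_ns_operad)
  let ?c = "\<lambda>t. dend_proj (size1 t) (tree_monomial t)"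
  have cl: "?c t \<in> elems ns_Dend (size1 t)" "dend_op g \<in> elems ns_Dend 2" for t g
    unfolding dend_op_def by (auto intro!: dend_quot.proj_closed simp: size1_pos)
  have node: "\<tau> (size1 \<langle>l, g, r\<rangle>) (?c \<langle>l, g, r\<rangle>) = \<ominus>\<^bsub>comp_space ns_Dend (size1 \<langle>l, g, r\<rangle>)\<^esub>
      pcomp ns_Dend (size1 l) (2 + size1 r - 1) (size1 l) (\<tau> (size1 l) (?c l))
        (pcomp ns_Dend 2 (size1 r) 1 (\<tau> 2 (dend_op g)) (?c r))"
    if "ns_anticyclic_operad ns_Dend \<tau>" for \<tau> l g r
  proof -
    interpret ns_anticyclic_operad ns_Dend \<tau> by fact
    have s: "1 \<le> size1 l" "1 \<le> 2 + size1 r - 1" "size1 \<langle>l, g, r\<rangle> = 2 + size1 r - 1 + size1 l - 1"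
      using size1_pos[of l] by auto
    have r: "\<tau> (2 + size1 r - 1) (pcomp ns_Dend 2 (size1 r) 2 (dend_op g) (?c r))
        = pcomp ns_Dend 2 (size1 r) 1 (\<tau> 2 (dend_op g)) (?c r)"
      using tau_comp[of 2 2 "size1 r" "dend_op g" "?c r"] cl size1_pos[of r]
      by (simp add: One_nat_def)
    show ?thesis
      unfolding dend_proj_tree_Node
      unfolding s(3) r[symmetric]
      by (rule tau_comp_1[OF s(2,1) _ cl(1)]) (intro pcomp_closed cl size1_pos, auto)
  qed
  have tree: "\<tau> (size1 t) (?c t) = \<tau>' (size1 t) (?c t)" for t
  proof (induction t)
    case Leaf
    have "?c \<langle>\<rangle> = op_unit ns_Dend" by (simp add: dend_quot.proj_unit)
    then show ?case
      using ns_anticyclic_operad.tau_unit[OF assms(1)] ns_anticyclic_operad.tau_unit[OF assms(2)]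
      by simp
  next
    case (Node l g r)
    then show ?case unfolding node[OF assms(1)] node[OF assms(2)] by (simp only: gen)
  qed
  obtain p where p: "Poly_Mapping.keys p \<subseteq> trees n" "u = dend_proj n p"
    using u n by (auto simp: dend_quot.proj_surj)
  note L = ns_anticyclic_operad.tau_linear[OF assms(1) n] ns_anticyclic_operad.tau_linear[OF assms(2) n]
  note M = dend_quot.target_space[OF n]
  show ?thesis
    using p(1) unfolding p(2)
  proof (induction p rule: poly_mapping_span_induct)
    case zero
    show ?case
      using linear_zero[OF dend_quot.proj_linear[OF n] module_free M] linear_zero[OF L(1) M M]
        linear_zero[OF L(2) M M] by simp
  next
    case (single t a)
    then have "dend_proj n (Poly_Mapping.single t a) = a \<odot>\<^bsub>comp_space ns_Dend n\<^esub> ?c t"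
      using dend_quot.proj_smult[of n "tree_monomial t" a] n by simp
    then show ?case
      using single tree[of t] cl(1)[of t] by (simp add: linear_smult[OF L(1)] linear_smult[OF L(2)])
  next
    case (add p q)
    then show ?case
      using dend_quot.proj_add[of n p q] n dend_quot.proj_closed[of n]
      by (simp add: linear_add[OF L(1)] linear_add[OF L(2)])
  qed
qed

definition quot_tau :: "nat \<Rightarrow> ns_dend_elem \<Rightarrow> ns_dend_elem" where
  "quot_tau n U = (if 1 \<le> n \<and> U \<in> elems ns_Dend n
     then \<Union>f\<in>U. dend_proj n (free_tau n f) else undefined)"

lemma quot_tau_proj:
  assumes "1 \<le> n" "f \<in> elems free_binary_operad n"
  shows "quot_tau n (dend_proj n f) = dend_proj n (free_tau n f)"
proof -
  interpret ns_anticyclic_operad free_binary_operad free_tau by (rule free_anticyclic)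
  have stable: "free_tau n y \<in> dend_ideal n" if "y \<in> dend_ideal n" for y
    using tau_stable_ideal[of dend_relations, folded dend_ideal_def, OF dend_relations_subset
        free_tau_relations assms(1) that] .
  note I = module_free operad_idealD(1)[OF dend_ideal assms(1)]
  show ?thesis
    using coset_map[OF I I free_tau_linear stable assms(2)] assms dend_quot.proj_closed
    by (simp add: quot_tau_def quot_proj_def)
qed

lemma quot_tau_anticyclic: "ns_anticyclic_operad ns_Dend quot_tau"
  by (rule dend_quot.target_ns_anticyclic_operad[OF free_anticyclic]) (rule quot_tau_proj)

lemma quot_tau_values:
  "f \<in> elems ns_Dend 1 \<Longrightarrow> quot_tau 1 f = \<ominus>\<^bsub>comp_space ns_Dend 1\<^esub> f"
  "quot_tau 2 (dend_op Succ) = dend_op Prec"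
  "quot_tau 2 (dend_op Prec) =
    (\<ominus>\<^bsub>comp_space ns_Dend 2\<^esub> dend_op Prec) \<ominus>\<^bsub>comp_space ns_Dend 2\<^esub> dend_op Succ"
proof -
  assume "f \<in> elems ns_Dend 1"
  then obtain p where p: "Poly_Mapping.keys p \<subseteq> trees 1" "f = dend_proj 1 p"
    by (auto simp: dend_quot.proj_surj)
  have "trees 1 = {\<langle>\<rangle> :: dend_gen tree}" by (auto simp: size1_size)
  with p(1) have "lin_ext tree_tau p = - p"
    by (induction p rule: poly_mapping_span_induct) (auto simp: lin_ext_add scale_minus)
  then have "quot_tau 1 f = dend_proj 1 (\<ominus>\<^bsub>comp_space free_binary_operad 1\<^esub> p)"
    using p by (simp add: quot_tau_proj free_tau_def free_minus)
  also have "\<dots> = \<ominus>\<^bsub>comp_space ns_Dend 1\<^esub> f"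
    unfolding p(2) by (rule dend_quot.proj_minus) (use p(1) in auto)
  finally show "quot_tau 1 f = \<ominus>\<^bsub>comp_space ns_Dend 1\<^esub> f" .
next
  show "quot_tau 2 (dend_op Succ) = dend_op Prec"
    unfolding dend_op_def by (subst quot_tau_proj) (simp_all add: free_tau_def lin_graft_minus)
next
  let ?s = "tree_monomial \<langle>\<langle>\<rangle>, Succ, \<langle>\<rangle>\<rangle>" and ?p = "tree_monomial \<langle>\<langle>\<rangle>, Prec, \<langle>\<rangle>\<rangle>"
  have e: "?s \<in> elems free_binary_operad 2" "?p \<in> elems free_binary_operad 2" by simp_all
  interpret M: module rat_field "comp_space (free_binary_operad :: (dend_gen tree \<Rightarrow>\<^sub>0 rat) operad) 2"
    by (rule module_free)
  have "quot_tau 2 (dend_op Prec) = dend_proj 2 (- ?p - ?s)"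
    unfolding dend_op_def
    by (subst quot_tau_proj) (simp_all add: free_tau_def lin_graft_minus lin_graft_diff)
  also have "- ?p - ?s = (\<ominus>\<^bsub>comp_space free_binary_operad 2\<^esub> ?p) \<ominus>\<^bsub>comp_space free_binary_operad 2\<^esub> ?s"
    using e by (simp add: a_minus_def free_minus)
  also have "dend_proj 2 \<dots>
      = (\<ominus>\<^bsub>comp_space ns_Dend 2\<^esub> dend_op Prec) \<ominus>\<^bsub>comp_space ns_Dend 2\<^esub> dend_op Succ"
    unfolding dend_op_def a_minus_def using e
    by (simp only: dend_quot.proj_add dend_quot.proj_minus M.a_inv_closed one_le_numeral)
  finally show "quot_tau 2 (dend_op Prec) =
    (\<ominus>\<^bsub>comp_space ns_Dend 2\<^esub> dend_op Prec) \<ominus>\<^bsub>comp_space ns_Dend 2\<^esub> dend_op Succ" .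
qed

lemma dend_tau_eq: "dend_tau = quot_tau"
  unfolding dend_tau_def
proof (rule the_equality)
  have undef: "extensional_tau ns_Dend quot_tau"
    by (simp add: extensional_tau_def quot_tau_def)
  show "extensional_tau ns_Dend quot_tau \<and> ns_anticyclic_operad ns_Dend quot_tau \<and>
     (\<forall>f\<in>elems ns_Dend 1. quot_tau 1 f = \<ominus>\<^bsub>comp_space ns_Dend 1\<^esub> f) \<and>
     quot_tau 2 (dend_op Succ) = dend_op Prec \<and>
     quot_tau 2 (dend_op Prec) =
       (\<ominus>\<^bsub>comp_space ns_Dend 2\<^esub> dend_op Prec) \<ominus>\<^bsub>comp_space ns_Dend 2\<^esub> dend_op Succ"
    by (intro conjI ballI undef quot_tau_anticyclic quot_tau_values)
  fix \<tau>
  assume *: "extensional_tau ns_Dend \<tau> \<and> ns_anticyclic_operad ns_Dend \<tau> \<and>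
     (\<forall>f\<in>elems ns_Dend 1. \<tau> 1 f = \<ominus>\<^bsub>comp_space ns_Dend 1\<^esub> f) \<and>
     \<tau> 2 (dend_op Succ) = dend_op Prec \<and>
     \<tau> 2 (dend_op Prec) =
       (\<ominus>\<^bsub>comp_space ns_Dend 2\<^esub> dend_op Prec) \<ominus>\<^bsub>comp_space ns_Dend 2\<^esub> dend_op Succ"
  have gen: "\<tau> 2 (dend_op g) = quot_tau 2 (dend_op g)" for g
    using * quot_tau_values(2,3) by (cases g) simp_all
  show "\<tau> = quot_tau"
  proof (intro ext)
    fix n u
    show "\<tau> n u = quot_tau n u"
    proof (cases "1 \<le> n \<and> u \<in> elems ns_Dend n")
      case True
      then show ?thesis using dend_tau_unique[of \<tau> quot_tau, OF _ quot_tau_anticyclic gen] * by blast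
    next
      case False
      then show ?thesis using * undef unfolding extensional_tau_def by metis
    qed
  qed
qed

lemma dend_tau:
  shows dend_tau_anticyclic: "ns_anticyclic_operad ns_Dend dend_tau"
    and dend_tau_Succ: "dend_tau 2 (dend_op Succ) = dend_op Prec"
    and dend_tau_Prec: "dend_tau 2 (dend_op Prec) =
      (\<ominus>\<^bsub>comp_space ns_Dend 2\<^esub> dend_op Prec) \<ominus>\<^bsub>comp_space ns_Dend 2\<^esub> dend_op Succ"
  unfolding dend_tau_eq by (fact quot_tau_anticyclic quot_tau_values)+

lemma dend_op_closed: "dend_op g \<in> elems ns_Dend 2"
  unfolding dend_op_def by (rule dend_quot.proj_closed) simp_all


section \<open>Long cycles and composition of permutations\<close>

lemma permutes_eqI:
  "f permutes S \<Longrightarrow> g permutes S \<Longrightarrow> (\<And>x. x \<in> S \<Longrightarrow> f x = g x) \<Longrightarrow> f = g"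
  by (rule ext) (metis permutes_not_in)

lemma permutes_fix_last:
  assumes "\<sigma> permutes {1..n + 1 :: nat}" "\<sigma> (n + 1) = n + 1"
  shows "\<sigma> permutes {1..n}"
proof (rule permutes_superset[OF assms(1)])
  fix x assume "x \<in> {1..n + 1} - {1..n}"
  then have "x = n + 1" by auto
  then show "\<sigma> x = x" using assms(2) by simp
qed

lemma permutes_Suc: "\<sigma> permutes {1..n} \<Longrightarrow> \<sigma> permutes {1..n + 1 :: nat}"
  by (rule permutes_subset) auto

lemma permutes_last: "\<sigma> permutes {1..n :: nat} \<Longrightarrow> \<sigma> (n + 1) = n + 1"
  by (rule permutes_not_in) auto

lemma permutes_bounds:
  assumes "\<sigma> permutes {1..n}" "1 \<le> k" "k \<le> n"
  shows "1 \<le> \<sigma> k" "\<sigma> k \<le> n"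
  using permutes_in_image[OF assms(1), of k] assms(2,3) by auto

lemma perm_inv_bounds:
  assumes "\<sigma> permutes {1..n}" "1 \<le> i" "i \<le> n"
  shows "1 \<le> perm_inv \<sigma> i" "perm_inv \<sigma> i \<le> n"
  using permutes_bounds[OF permutes_inv[OF assms(1)] assms(2,3)] by auto

lemma perm_inv_eqI: "\<sigma> permutes S \<Longrightarrow> \<sigma> x = y \<Longrightarrow> perm_inv \<sigma> y = x"
  using permutes_inverses(2) by fastforce

lemma long_cycle_permutes: "long_cycle n permutes {1..n + 1}"
proof (rule bij_imp_permutes)
  show "bij_betw (long_cycle n) {1..n + 1} {1..n + 1}"
    by (rule bij_betwI[where g = "\<lambda>i. if i = n + 1 then 1 else i + 1"])
      (auto simp: long_cycle_def)
qed (auto simp: long_cycle_def)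

lemma long_cycle_pow_permutes: "(long_cycle n ^^ k) permutes {1..n + 1}"
proof (induction k)
  case (Suc k)
  then show ?case using permutes_compose[OF Suc long_cycle_permutes] by (simp only: funpow.simps)
qed (simp add: permutes_id flip: id_def)

lemma long_cycle_pow:
  "1 \<le> p \<Longrightarrow> p \<le> n + 1 \<Longrightarrow> k \<le> n + 1 \<Longrightarrow>
    (long_cycle n ^^ k) p = (if k < p then p - k else p + n + 1 - k)"
proof (induction k)
  case (Suc k)
  then have IH: "(long_cycle n ^^ k) p = (if k < p then p - k else p + n + 1 - k)" by simp
  have "(long_cycle n ^^ Suc k) p = long_cycle n (if k < p then p - k else p + n + 1 - k)"
    by (simp add: IH)
  also have "\<dots> = (if Suc k < p then p - Suc k else p + n + 1 - Suc k)"
    using Suc.prems by (cases "p = Suc k") (auto simp: long_cycle_def)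
  finally show ?case .
qed simp

lemma long_cycle_order: "long_cycle n ^^ (n + 1) = id"
proof (rule permutes_eqI[OF long_cycle_pow_permutes permutes_id])
  fix x assume "x \<in> {1..n + 1}"
  then show "(long_cycle n ^^ (n + 1)) x = id x" using long_cycle_pow[of x n "n + 1"] by auto
qed

lemma long_cycle_pow_mod: "long_cycle n ^^ (k mod (n + 1)) = long_cycle n ^^ k"
  by (rule ext, rule funpow_mod_eq) (use long_cycle_order in \<open>metis id_apply\<close>)

text \<open>
  The powers of the long cycle act transitively. Composing \<open>\<sigma>\<close> with the power that sends \<open>n + 1\<close> to
  the preimage of \<open>n + 1\<close> under \<open>\<sigma>\<close> gives a permutation that fixes \<open>n + 1\<close>.
\<close>

lemma permutes_decomp:
  assumes \<sigma>: "\<sigma> permutes {1..n + 1}"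
  obtains \<theta> k where "k \<le> n" "\<theta> permutes {1..n}" "\<sigma> = \<theta> \<circ> long_cycle n ^^ k"
proof -
  define p where "p = perm_inv \<sigma> (n + 1)"
  have p: "1 \<le> p" "p \<le> n + 1" "\<sigma> p = n + 1"
    using perm_inv_bounds[OF \<sigma>, of "n + 1"] permutes_inverses(1)[OF \<sigma>] by (auto simp: p_def)
  define k where "k = (if p = n + 1 then 0 else p)"
  have k: "k \<le> n" "(long_cycle n ^^ (n + 1 - k)) (n + 1) = p"
    using p long_cycle_pow[of "n + 1" n "n + 1 - k"] by (auto simp: k_def)
  define \<theta> where "\<theta> = \<sigma> \<circ> long_cycle n ^^ (n + 1 - k)"
  have "\<theta> permutes {1..n}"
    by (rule permutes_fix_last)
      (use k p permutes_compose[OF long_cycle_pow_permutes \<sigma>] in \<open>auto simp: \<theta>_def\<close>)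
  moreover have "\<theta> \<circ> long_cycle n ^^ k = \<sigma>"
    unfolding \<theta>_def comp_assoc funpow_add[symmetric] using k(1) long_cycle_order[of n] by simp
  ultimately show ?thesis using that k(1) by metis
qed

lemma permutes_decomp_unique:
  assumes \<theta>: "\<theta> permutes {1..n}" "\<theta>' permutes {1..n}" and k: "k \<le> n" "k' \<le> n"
    and eq: "\<theta> \<circ> long_cycle n ^^ k = \<theta>' \<circ> long_cycle n ^^ k'"
  shows "k = k'" "\<theta> = \<theta>'"
proof -
  \<comment> \<open>the letter that is sent to \<open>n + 1\<close> by the \<open>k'\<close>-th power\<close>
  define p where "p = (if k' = 0 then n + 1 else k')"
  have p: "1 \<le> p" "p \<le> n + 1" "(long_cycle n ^^ k') p = n + 1"
    using k long_cycle_pow[of p n k'] by (auto simp: p_def)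
  have "\<theta> ((long_cycle n ^^ k) p) = n + 1"
    using fun_cong[OF eq, of p] p(3) permutes_last[OF \<theta>(2)] by simp
  then have "(long_cycle n ^^ k) p = n + 1"
    using permutes_last[OF \<theta>(1)] permutes_inj[OF \<theta>(1)] by (metis injD)
  then show k': "k = k'"
    using p k long_cycle_pow[of p n k] by (auto simp: p_def split: if_splits)
  show "\<theta> = \<theta>'"
  proof
    fix x
    obtain y where "x = (long_cycle n ^^ k) y"
      using permutes_surj[OF long_cycle_pow_permutes[where n = n and k = k]] by (metis surjD)
    then show "\<theta> x = \<theta>' x" using fun_cong[OF eq, of y] k' by simp
  qed
qed

text \<open>
  In \<open>f \<circ>\<^sub>k g\<close> with \<open>g\<close> of arity \<open>n\<close>, the input \<open>x \<noteq> k\<close> of \<open>f\<close> becomes the input \<open>ins n k x\<close>, and the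
  input \<open>z\<close> of \<open>g\<close> becomes the input \<open>k - 1 + z\<close>. The two descriptions of \<open>perm_comp\<close> below in these
  terms reduce every identity of permutations to one between positions.
\<close>

definition ins :: "nat \<Rightarrow> nat \<Rightarrow> nat \<Rightarrow> nat" where
  "ins n k x = (if x < k then x else x + n - 1)"

lemma perm_comp_ins:
  assumes "inj \<sigma>" "1 \<le> n" "x \<noteq> k"
  shows "perm_comp n k \<sigma> \<rho> (ins n k x) = ins n (\<sigma> k) (\<sigma> x)"
proof (cases "x < k")
  case True
  then show ?thesis by (simp add: perm_comp_def ins_def Let_def)
next
  case False
  then have "\<not> x + n - 1 < k" "\<not> x + n - 1 < k + n" "x + n - 1 + 1 - n = x"
    using assms by auto
  then show ?thesis using False by (simp add: perm_comp_def ins_def Let_def)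
qed

lemma perm_comp_block:
  assumes "1 \<le> z" "z \<le> n" "1 \<le> k"
  shows "perm_comp n k \<sigma> \<rho> (k - 1 + z) = \<sigma> k - 1 + \<rho> z"
proof -
  have "\<not> k - 1 + z < k" "k - 1 + z < k + n" "k - 1 + z + 1 - k = z"
    using assms by auto
  then show ?thesis by (simp add: perm_comp_def)
qed

lemma position_cases:
  assumes "1 \<le> n" "1 \<le> k"
  obtains x where "x \<noteq> k" "p = ins n k x" | z where "1 \<le> z" "z \<le> n" "p = k - 1 + z"
proof -
  consider "p < k" | "k \<le> p" "p < k + n" | "k + n \<le> p" by linarith
  then show ?thesis
  proof cases
    case 1
    then show ?thesis using that(1)[of p] by (simp add: ins_def)
  next
    case 2
    then show ?thesis using that(2)[of "p + 1 - k"] assms by auto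
  next
    case 3
    then show ?thesis using that(1)[of "p + 1 - n"] assms by (simp add: ins_def)
  qed
qed

lemma ins_bounds:
  assumes "1 \<le> n" "1 \<le> k" "k \<le> m" "x \<noteq> k"
  shows "ins n k x \<in> {1..m + n - 1} \<longleftrightarrow> x \<in> {1..m}"
  using assms by (auto simp: ins_def)

lemma ins_inj: "1 \<le> n \<Longrightarrow> x \<noteq> k \<Longrightarrow> y \<noteq> k \<Longrightarrow> ins n k x = ins n k y \<Longrightarrow> x = y"
  by (auto simp: ins_def split: if_splits)

lemma perm_comp_comp:
  assumes "inj \<sigma>" "inj \<sigma>'" "1 \<le> k" "1 \<le> \<sigma>' k" "1 \<le> n" "\<rho>' permutes {1..n}"
  shows "perm_comp n (\<sigma>' k) \<sigma> \<rho> \<circ> perm_comp n k \<sigma>' \<rho>' = perm_comp n k (\<sigma> \<circ> \<sigma>') (\<rho> \<circ> \<rho>')"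
proof
  fix p
  show "(perm_comp n (\<sigma>' k) \<sigma> \<rho> \<circ> perm_comp n k \<sigma>' \<rho>') p = perm_comp n k (\<sigma> \<circ> \<sigma>') (\<rho> \<circ> \<rho>') p"

  proof (cases rule: position_cases[OF assms(5) assms(3), of p])
    case (1 x)
    then have "\<sigma>' x \<noteq> \<sigma>' k" using assms(2) by (metis injD)
    then show ?thesis using 1 assms by (simp add: perm_comp_ins inj_compose)
  next
    case (2 z)
    then show ?thesis
      using assms(3,4) permutes_bounds[OF assms(6), of z] by (simp only: o_apply perm_comp_block)
  qed
qed

lemma perm_comp_id:
  assumes "1 \<le> k" "1 \<le> n"
  shows "perm_comp n k id id = id"
proof
  fix p
  show "perm_comp n k id id p = id p"
  proof (cases rule: position_cases[OF assms(2,1), of p])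
    case (1 x)
    show ?thesis unfolding 1(2) perm_comp_ins[OF inj_on_id assms(2) 1(1)] id_apply ..
  next
    case (2 z)
    show ?thesis unfolding 2(3) perm_comp_block[OF 2(1,2) assms(1)] id_apply ..
  qed
qed

lemma perm_comp_permutes:
  assumes \<sigma>: "\<sigma> permutes {1..m}" and \<rho>: "\<rho> permutes {1..n}" and k: "1 \<le> k" "k \<le> m" "1 \<le> n"
  shows "perm_comp n k \<sigma> \<rho> permutes {1..m + n - 1}"
proof (rule bij_imp_permutes)
  let ?f = "perm_comp n k \<sigma> \<rho>" and ?g = "perm_comp n (\<sigma> k) (perm_inv \<sigma>) (perm_inv \<rho>)"
  note i = permutes_inv[OF \<sigma>] permutes_inv[OF \<rho>]
  note b = permutes_bounds[OF \<sigma> k(1,2)]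
  have inv: "perm_inv \<sigma> (\<sigma> k) = k" using permutes_inverses(2)[OF \<sigma>] by simp
  have gf: "?g \<circ> ?f = id"
    using perm_comp_comp[OF permutes_inj[OF i(1)] permutes_inj[OF \<sigma>] k(1) b(1) k(3) \<rho>]
    by (simp add: permutes_inv_o[OF \<sigma>] permutes_inv_o[OF \<rho>] perm_comp_id k)
  have fg: "?f \<circ> ?g = id"
    using perm_comp_comp[OF permutes_inj[OF \<sigma>] permutes_inj[OF i(1)] b(1) _ k(3) i(2), of \<rho>] b k
    by (simp add: permutes_inv_o[OF \<sigma>] permutes_inv_o[OF \<rho>] perm_comp_id inv)
  have maps: "perm_comp n k \<sigma> \<rho> p \<in> {1..m + n - 1} \<longleftrightarrow> p \<in> {1..m + n - 1}"
    if "\<sigma> permutes {1..m}" "\<rho> permutes {1..n}" "1 \<le> k" "k \<le> m" for \<sigma> \<rho> k p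

  proof (cases rule: position_cases[OF k(3) that(3), of p])
    case (1 x)
    have "\<sigma> x \<noteq> \<sigma> k" using 1(1) permutes_inj[OF that(1)] by (metis injD)
    then show ?thesis
      unfolding 1(2) perm_comp_ins[OF permutes_inj[OF that(1)] k(3) 1(1)]
      using ins_bounds[OF k(3) that(3,4) 1(1)] permutes_in_image[OF that(1), of x]
        ins_bounds[OF k(3) permutes_bounds[OF that(1,3,4)] \<open>\<sigma> x \<noteq> \<sigma> k\<close>] by blast
  next
    case (2 z)
    show ?thesis
      unfolding 2(3) perm_comp_block[OF 2(1,2) that(3)]
      using permutes_bounds[OF that(1,3,4)] permutes_bounds[OF that(2) 2(1,2)] that 2(1,2) by auto
  qed
  have "perm_inv \<sigma> permutes {1..m}" "perm_inv \<rho> permutes {1..n}" by (rule i)+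
  then show "bij_betw ?f {1..m + n - 1} {1..m + n - 1}"
    using maps[OF \<sigma> \<rho> k(1,2)] maps[OF i b] fun_cong[OF gf] fun_cong[OF fg]
    by (intro bij_betwI[where g = ?g]) auto
  fix p assume p: "p \<notin> {1..m + n - 1}"
  show "perm_comp n k \<sigma> \<rho> p = p"

  proof (cases rule: position_cases[OF k(3) k(1), of p])
    case (1 x)
    then have "x \<notin> {1..m}" using p ins_bounds[OF k(3,1,2) 1(1)] unfolding 1(2) by blast
    then have "\<sigma> x = x" "x = 0 \<or> m < x" using permutes_not_in[OF \<sigma>] by auto
    then show ?thesis
      using 1 k b permutes_inj[OF \<sigma>] by (auto simp: perm_comp_ins) (auto simp: ins_def)
  next
    case (2 z)
    then show ?thesis using p k by auto
  qed
qed

lemma ins_ins: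
  "\<lbrakk>1 \<le> n; 1 \<le> l; 1 \<le> i; 1 \<le> j; j \<le> n; x \<noteq> i\<rbrakk> \<Longrightarrow>
    ins l (i - 1 + j) (ins n i x) = ins (n + l - 1) i x"
  by (auto simp: ins_def)

lemma ins_in_block:
  "\<lbrakk>1 \<le> l; 1 \<le> i\<rbrakk> \<Longrightarrow> ins l (i - 1 + j) (i - 1 + z) = i - 1 + ins l j z"
  by (auto simp: ins_def)

lemma ins_not_block:
  "\<lbrakk>1 \<le> n; x \<noteq> i; 1 \<le> z; z \<le> n; 1 \<le> i\<rbrakk> \<Longrightarrow> ins n i x \<noteq> i - 1 + z"
  by (auto simp: ins_def)

text \<open>
  An input of an iterated composition \<open>(f \<circ> g) \<circ> h\<close> comes from \<open>f\<close>, \<open>g\<close> or \<open>h\<close>. Each of these cases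
  is one of the preceding identities between positions; the same holds for the parallel axiom.
\<close>

lemma perm_comp_sequential:
  assumes \<sigma>: "\<sigma> permutes {1..m}" and \<rho>: "\<rho> permutes {1..n}"
    and i: "1 \<le> i" "i \<le> m" and j: "1 \<le> j" "j \<le> n" and l: "1 \<le> l"
  shows "perm_comp l (i - 1 + j) (perm_comp n i \<sigma> \<rho>) \<pi> = perm_comp (n + l - 1) i \<sigma> (perm_comp l j \<rho> \<pi>)"
proof
  fix p
  have n: "1 \<le> n" "1 \<le> n + l - 1" "1 \<le> i - 1 + j" using i j l by auto
  note b = permutes_bounds[OF \<sigma> i] permutes_bounds[OF \<rho> j]
  note inj = permutes_inj[OF \<sigma>] permutes_inj[OF \<rho>]
    permutes_inj[OF perm_comp_permutes[OF \<sigma> \<rho> i n(1)]]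
  show "perm_comp l (i - 1 + j) (perm_comp n i \<sigma> \<rho>) \<pi> p
      = perm_comp (n + l - 1) i \<sigma> (perm_comp l j \<rho> \<pi>) p"

  proof (cases rule: position_cases[OF n(2) i(1), of p])
    case (1 x)
    then have "\<sigma> x \<noteq> \<sigma> i" using inj(1) by (metis injD)
    have p: "p = ins l (i - 1 + j) (ins n i x)" "ins n i x \<noteq> i - 1 + j"
      using 1 ins_ins[OF n(1) l i(1) j 1(1)] ins_not_block[OF n(1) 1(1) j i(1)] by auto
    have "perm_comp l (i - 1 + j) (perm_comp n i \<sigma> \<rho>) \<pi> p
        = ins l (\<sigma> i - 1 + \<rho> j) (ins n (\<sigma> i) (\<sigma> x))"
      unfolding p(1) perm_comp_ins[OF inj(3) l p(2)] perm_comp_ins[OF inj(1) n(1) 1(1)]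
        perm_comp_block[OF j i(1)] ..
    also have "\<dots> = ins (n + l - 1) (\<sigma> i) (\<sigma> x)"
      by (rule ins_ins[OF n(1) l b(1,3,4) \<open>\<sigma> x \<noteq> \<sigma> i\<close>])
    also have "\<dots> = perm_comp (n + l - 1) i \<sigma> (perm_comp l j \<rho> \<pi>) p"
      unfolding 1(2) perm_comp_ins[OF inj(1) n(2) 1(1)] ..
    finally show ?thesis .
  next
    case (2 z')
    show ?thesis

    proof (cases rule: position_cases[OF l j(1), of z'])
      case (1 z)
      have z: "1 \<le> z" "z \<le> n"
        using 1 2 ins_bounds[of l j n z] j l by auto
      have "p = ins l (i - 1 + j) (i - 1 + z)" "i - 1 + z \<noteq> i - 1 + j"
        using 1 2 ins_in_block[OF l i(1), of j z] by auto
      note p = this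
      have "perm_comp l (i - 1 + j) (perm_comp n i \<sigma> \<rho>) \<pi> p = ins l (\<sigma> i - 1 + \<rho> j) (\<sigma> i - 1 + \<rho> z)"
        unfolding p(1) perm_comp_ins[OF inj(3) l p(2)] perm_comp_block[OF j i(1)]
          perm_comp_block[OF z i(1)] ..
      also have "\<dots> = \<sigma> i - 1 + ins l (\<rho> j) (\<rho> z)"
        by (rule ins_in_block[OF l b(1)])
      also have "\<dots> = perm_comp (n + l - 1) i \<sigma> (perm_comp l j \<rho> \<pi>) p"
        unfolding 2(3) perm_comp_block[OF 2(1,2) i(1)] perm_comp_ins[OF inj(2) l 1(1), folded 1(2)] ..
      finally show ?thesis .
    next
      case (2 w)
      have "p = i - 1 + j - 1 + w" using 2 \<open>p = i - 1 + z'\<close> j by simp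
      then have "perm_comp l (i - 1 + j) (perm_comp n i \<sigma> \<rho>) \<pi> p = \<sigma> i - 1 + \<rho> j - 1 + \<pi> w"
        using 2 n i j by (simp only: perm_comp_block)
      also have "\<dots> = \<sigma> i - 1 + (\<rho> j - 1 + \<pi> w)" using b by simp
      also have "\<dots> = perm_comp (n + l - 1) i \<sigma> (perm_comp l j \<rho> \<pi>) p"
        using 2 \<open>p = i - 1 + z'\<close> \<open>1 \<le> z'\<close> \<open>z' \<le> n + l - 1\<close> i j
        by (simp only: perm_comp_block)
      finally show ?thesis .
    qed
  qed
qed

lemma ins_commute:
  "\<lbrakk>1 \<le> n; 1 \<le> l; i \<noteq> k; x \<noteq> i; x \<noteq> k\<rbrakk> \<Longrightarrow>
    ins l (ins n i k) (ins n i x) = ins n (ins l k i) (ins l k x)"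
  by (auto simp: ins_def)

lemma ins_block_commute:
  "\<lbrakk>1 \<le> n; 1 \<le> l; i \<noteq> k; 1 \<le> i; 1 \<le> z; z \<le> n\<rbrakk> \<Longrightarrow>
    ins l (ins n i k) (i - 1 + z) = ins l k i - 1 + z"
  by (auto simp: ins_def)

lemma perm_comp_parallel:
  assumes \<sigma>: "\<sigma> permutes {1..m}" and \<rho>: "\<rho> permutes {1..n}" and \<pi>: "\<pi> permutes {1..l}"
    and i: "1 \<le> i" "i \<le> m" and k: "1 \<le> k" "k \<le> m" and ik: "i \<noteq> k" and nl: "1 \<le> n" "1 \<le> l"
  shows "perm_comp l (ins n i k) (perm_comp n i \<sigma> \<rho>) \<pi> = perm_comp n (ins l k i) (perm_comp l k \<sigma> \<pi>) \<rho>"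
proof
  fix p
  have pos: "1 \<le> ins n i k" "1 \<le> ins l k i" using i k nl by (auto simp: ins_def)
  have s: "\<sigma> i \<noteq> \<sigma> k" using ik permutes_inj[OF \<sigma>] by (metis injD)
  note b = permutes_bounds[OF \<sigma> i] permutes_bounds[OF \<sigma> k]
  note inj = permutes_inj[OF \<sigma>] permutes_inj[OF perm_comp_permutes[OF \<sigma> \<rho> i nl(1)]]
    permutes_inj[OF perm_comp_permutes[OF \<sigma> \<pi> k nl(2)]]
  show "perm_comp l (ins n i k) (perm_comp n i \<sigma> \<rho>) \<pi> p
      = perm_comp n (ins l k i) (perm_comp l k \<sigma> \<pi>) \<rho> p"

  proof (cases rule: position_cases[OF nl(2) pos(1), of p])
    case p: (1 y)
    show ?thesis

    proof (cases rule: position_cases[OF nl(1) i(1), of y])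
      case (1 x)
      have x: "x \<noteq> k" using 1 p by auto
      then have sx: "\<sigma> x \<noteq> \<sigma> k" "\<sigma> x \<noteq> \<sigma> i" using 1 inj(1) by (metis injD)+
      have ne: "ins l k x \<noteq> ins l k i" using ins_inj[OF nl(2) x ik] 1 by blast
      have "perm_comp l (ins n i k) (perm_comp n i \<sigma> \<rho>) \<pi> p
          = ins l (ins n (\<sigma> i) (\<sigma> k)) (ins n (\<sigma> i) (\<sigma> x))"
        using 1 p inj nl ik by (simp add: perm_comp_ins)
      also have "\<dots> = ins n (ins l (\<sigma> k) (\<sigma> i)) (ins l (\<sigma> k) (\<sigma> x))"
        using ins_commute[OF nl s sx(2,1)] .
      also have "\<dots> = perm_comp n (ins l k i) (perm_comp l k \<sigma> \<pi>) \<rho> (ins n (ins l k i) (ins l k x))"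
        using inj nl ik x ne by (simp add: perm_comp_ins)
      finally show ?thesis using 1 p ins_commute[OF nl ik 1(1) x] by simp
    next
      case (2 z)
      have z: "1 \<le> \<rho> z" "\<rho> z \<le> n" using permutes_bounds[OF \<rho> 2(1,2)] .
      have "perm_comp l (ins n i k) (perm_comp n i \<sigma> \<rho>) \<pi> p
          = ins l (ins n (\<sigma> i) (\<sigma> k)) (\<sigma> i - 1 + \<rho> z)"
        using p 2 inj nl i ik by (simp only: perm_comp_ins perm_comp_block not_sym[OF ik] not_False_eq_True)
      also have "\<dots> = ins l (\<sigma> k) (\<sigma> i) - 1 + \<rho> z"
        by (rule ins_block_commute[OF nl s b(1) z])
      also have "\<dots> = perm_comp n (ins l k i) (perm_comp l k \<sigma> \<pi>) \<rho> (ins l k i - 1 + z)"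
        using 2 inj nl ik pos(2) by (simp only: perm_comp_ins perm_comp_block not_False_eq_True)
      finally show ?thesis using 2 p ins_block_commute[OF nl ik i(1) 2(1,2)] by simp
    qed
  next
    case p: (2 w)
    have w: "1 \<le> \<pi> w" "\<pi> w \<le> l" using permutes_bounds[OF \<pi> p(1,2)] .
    have e: "p = ins n (ins l k i) (k - 1 + w)"
      using p ins_block_commute[OF nl(2,1) not_sym[OF ik] k(1) p(1,2)] by simp
    have ne: "k - 1 + w \<noteq> ins l k i" using ins_not_block[OF nl(2) ik p(1,2) k(1)] by simp
    have "perm_comp l (ins n i k) (perm_comp n i \<sigma> \<rho>) \<pi> p = ins n (\<sigma> i) (\<sigma> k) - 1 + \<pi> w"
      using p pos inj nl ik by (simp only: perm_comp_ins perm_comp_block not_sym[OF ik] not_False_eq_True)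
    also have "\<dots> = ins n (ins l (\<sigma> k) (\<sigma> i)) (\<sigma> k - 1 + \<pi> w)"
      by (rule ins_block_commute[OF nl(2,1) not_sym[OF s] b(3) w, symmetric])
    also have "\<dots> = perm_comp n (ins l k i) (perm_comp l k \<sigma> \<pi>) \<rho> p"
      unfolding e using p inj nl ik k ne by (simp only: perm_comp_ins perm_comp_block not_False_eq_True)
    finally show ?thesis .
  qed
qed

lemma perm_comp_unit_left:
  assumes "\<rho> permutes {1..n}" "1 \<le> n"
  shows "perm_comp n 1 id \<rho> = \<rho>"
proof
  fix p
  show "perm_comp n 1 id \<rho> p = \<rho> p"

  proof (cases rule: position_cases[OF assms(2) order_refl, of p])
    case (1 x)
    then have "p \<notin> {1..n}" by (auto simp: ins_def)
    then show ?thesis using 1 assms permutes_not_in[OF assms(1)] by (simp add: perm_comp_ins)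
  next
    case (2 z)
    then show ?thesis by (simp only: perm_comp_block order_refl id_apply) simp
  qed
qed

lemma perm_comp_unit_right:
  assumes "\<sigma> permutes {1..m}" "1 \<le> k" "k \<le> m"
  shows "perm_comp 1 k \<sigma> id = \<sigma>"
proof
  fix p
  have [simp]: "ins 1 a x = x" for a x by (simp add: ins_def)
  show "perm_comp 1 k \<sigma> id p = \<sigma> p"

  proof (cases rule: position_cases[OF order_refl[of 1] assms(2), of p])
    case (1 x)
    then show ?thesis using perm_comp_ins[OF permutes_inj[OF assms(1)], of 1 x k] by simp
  next
    case (2 z)
    then have "z = 1" by simp
    then show ?thesis
      using 2 perm_comp_block[of z 1 k \<sigma> id] permutes_bounds[OF assms] assms by simp
  qed
qed

text \<open>
  While \<open>g\<close> is not at the first input of \<open>f\<close>, rotating \<open>f \<circ>\<^sub>i g\<close> by one step amounts to rotating \<open>f\<close>.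
\<close>

lemma long_cycle_eq_perm_comp:
  assumes "2 \<le> i" "i \<le> m" "1 \<le> n"
  shows "perm_comp n i (long_cycle m) id = long_cycle (m + n - 1)"
proof
  fix p
  have i: "1 \<le> i" "long_cycle m i = i - 1" using assms by (auto simp: long_cycle_def)
  show "perm_comp n i (long_cycle m) id p = long_cycle (m + n - 1) p"

  proof (cases rule: position_cases[OF assms(3) i(1), of p])
    case (1 x)
    then have "perm_comp n i (long_cycle m) id p = ins n (i - 1) (long_cycle m x)"
      using permutes_inj[OF long_cycle_permutes] assms i by (simp add: perm_comp_ins)
    also have "\<dots> = long_cycle (m + n - 1) p"
    proof -
      consider "x = 0" | "x = 1" | "2 \<le> x" "x < i" | "i < x" "x \<le> m + 1" | "m + 1 < x"
        using 1(1) by linarith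
      then show ?thesis
        unfolding 1(2) using assms by cases (auto simp: ins_def long_cycle_def)
    qed
    finally show ?thesis .
  next
    case (2 z)
    then have "perm_comp n i (long_cycle m) id p = i - 1 - 1 + z"
      using i by (simp only: perm_comp_block id_apply)
    then show ?thesis using 2 assms by (auto simp: long_cycle_def)
  qed
qed

text \<open>
  Two rotations of \<open>f\<close> take \<open>g\<close> from the first input past the output to the last input. In terms of
  the composition all \<open>n\<close> inputs of \<open>g\<close> and one more letter have to pass.
\<close>

lemma long_cycle_across_block:
  assumes "2 \<le> m" "1 \<le> n"
  shows "perm_comp n 1 (long_cycle m ^^ 2) id = long_cycle (m + n - 1) ^^ (n + 1)"
proof (rule permutes_eqI)
  have N: "m + n - 1 + 1 = m + 1 + n - 1" using assms by simp
  show "perm_comp n 1 (long_cycle m ^^ 2) id permutes {1..m + n - 1 + 1}"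
    unfolding N by (rule perm_comp_permutes[OF long_cycle_pow_permutes permutes_id])
      (use assms in auto)
  show "(long_cycle (m + n - 1) ^^ (n + 1)) permutes {1..m + n - 1 + 1}"
    by (rule long_cycle_pow_permutes)
  fix p assume p: "p \<in> {1..m + n - 1 + 1}"
  have R: "(long_cycle (m + n - 1) ^^ (n + 1)) p
      = (if n + 1 < p then p - (n + 1) else p + m - 1)"
    using p assms by (subst long_cycle_pow) auto
  have one: "(long_cycle m ^^ 2) 1 = m" using assms by (subst long_cycle_pow) auto
  show "perm_comp n 1 (long_cycle m ^^ 2) id p = (long_cycle (m + n - 1) ^^ (n + 1)) p"

  proof (cases rule: position_cases[OF assms(2) order_refl, of p])
    case (1 x)
    then have x: "2 \<le> x" "x \<le> m + 1" using p assms by (auto simp: ins_def split: if_splits)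
    have "perm_comp n 1 (long_cycle m ^^ 2) id p = ins n m ((long_cycle m ^^ 2) x)"
      using 1 permutes_inj[OF long_cycle_pow_permutes[where n = m and k = 2]] assms one
      by (simp add: perm_comp_ins)
    also have "(long_cycle m ^^ 2) x = (if 2 < x then x - 2 else x + m - 1)"
      using x assms by (subst long_cycle_pow) auto
    also have "ins n m \<dots> = (long_cycle (m + n - 1) ^^ (n + 1)) p"
      unfolding R using 1 x assms by (auto simp: ins_def)
    finally show ?thesis .
  next
    case (2 z)
    then have "perm_comp n 1 (long_cycle m ^^ 2) id p = m - 1 + z"
      using one by (simp only: perm_comp_block id_apply order_refl)
    also have "\<dots> = (long_cycle (m + n - 1) ^^ (n + 1)) p"
      unfolding R using 2 assms by auto
    finally show ?thesis .
  qed
qed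

text \<open>
  The identity of permutations behind \<open>c (f \<circ>\<^sub>1 g) = - (c g) \<circ>\<^sub>n (c f)\<close>: on the left the block belongs
  to \<open>g\<close> and is described by \<open>\<rho>\<close>; on the right it belongs to \<open>f\<close> and is described by \<open>\<theta>\<close>.
\<close>

lemma long_cycle_swap:
  assumes \<sigma>: "\<sigma> permutes {1..m}" and \<rho>: "\<rho> permutes {1..n}"
    and \<theta>: "\<theta> permutes {1..m}" and \<theta>': "\<theta>' permutes {1..n}"
    and mn: "1 \<le> m" "1 \<le> n" and k: "1 \<le> k" "k \<le> m" "\<sigma> k = 1" and u: "1 \<le> u" "u \<le> n" "\<rho> u = 1"
    and \<sigma>\<theta>: "long_cycle m \<circ> \<sigma> = \<theta> \<circ> long_cycle m ^^ k"
    and \<rho>\<theta>: "long_cycle n \<circ> \<rho> = \<theta>' \<circ> long_cycle n ^^ u"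
  shows "long_cycle (m + n - 1) \<circ> perm_comp n k \<sigma> \<rho>
    = perm_comp m (n + 1 - u) \<theta>' \<theta> \<circ> long_cycle (m + n - 1) ^^ (k - 1 + u)"
proof (rule permutes_eqI)
  let ?N = "m + n - 1" and ?w = "n + 1 - u"
  have w: "1 \<le> ?w" "?w \<le> n" using u by auto
  have mn': "n + m - 1 = m + n - 1" by simp
  show "long_cycle ?N \<circ> perm_comp n k \<sigma> \<rho> permutes {1..?N + 1}"
    by (rule permutes_compose[OF permutes_Suc[OF perm_comp_permutes] long_cycle_permutes])
      (use assms in auto)
  show "perm_comp m ?w \<theta>' \<theta> \<circ> long_cycle ?N ^^ (k - 1 + u) permutes {1..?N + 1}"
    by (rule permutes_compose[OF long_cycle_pow_permutes permutes_Suc[OF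
            perm_comp_permutes[OF \<theta>' \<theta> w mn(1), unfolded mn']]])
  have \<theta>'w: "\<theta>' ?w = n"
    using fun_cong[OF \<rho>\<theta>, of "n + 1"] permutes_last[OF \<rho>] u
    by (simp add: long_cycle_pow) (simp add: long_cycle_def)
  fix p assume p: "p \<in> {1..?N + 1}"
  have pow: "(long_cycle ?N ^^ (k - 1 + u)) p
      = (if k - 1 + u < p then p - (k - 1 + u) else p + ?N + 1 - (k - 1 + u))"
    using p k u by (subst long_cycle_pow) auto
  show "(long_cycle ?N \<circ> perm_comp n k \<sigma> \<rho>) p
      = (perm_comp m ?w \<theta>' \<theta> \<circ> long_cycle ?N ^^ (k - 1 + u)) p"

  proof (cases rule: position_cases[OF mn(2) k(1), of p])
    case (1 x)
    then have x: "1 \<le> x" "x \<le> m + 1" using p k mn by (auto simp: ins_def split: if_splits)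
    let ?z = "(long_cycle m ^^ k) x"
    have z: "?z = (if k < x then x - k else x + m + 1 - k)"
      using x k by (subst long_cycle_pow) auto
    have z': "1 \<le> ?z" "?z \<le> m" using z x k 1(1) by (auto split: if_splits)
    have "(long_cycle ?N ^^ (k - 1 + u)) p = ?w - 1 + ?z"
      unfolding pow z using 1 x k u by (auto simp: ins_def)
    then have "(perm_comp m ?w \<theta>' \<theta> \<circ> long_cycle ?N ^^ (k - 1 + u)) p = n - 1 + \<theta> ?z"
      using z' w by (simp only: o_apply perm_comp_block \<theta>'w)
    also have "\<theta> ?z = long_cycle m (\<sigma> x)" using fun_cong[OF \<sigma>\<theta>, of x] by simp
    finally have R: "(perm_comp m ?w \<theta>' \<theta> \<circ> long_cycle ?N ^^ (k - 1 + u)) p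
      = n - 1 + long_cycle m (\<sigma> x)" .
    have sx: "2 \<le> \<sigma> x" "\<sigma> x \<le> m + 1"
    proof -
      have "\<sigma> x \<noteq> \<sigma> k" using 1(1) permutes_inj[OF \<sigma>] by (metis injD)
      then show "2 \<le> \<sigma> x" "\<sigma> x \<le> m + 1"
        using k(3) permutes_bounds[OF permutes_Suc[OF \<sigma>] x] by auto
    qed
    have "perm_comp n k \<sigma> \<rho> p = ins n 1 (\<sigma> x)"
      unfolding 1(2) perm_comp_ins[OF permutes_inj[OF \<sigma>] mn(2) 1(1)] k(3) ..
    also have "\<dots> = \<sigma> x + n - 1" using sx by (simp add: ins_def)
    finally have "(long_cycle ?N \<circ> perm_comp n k \<sigma> \<rho>) p = long_cycle ?N (\<sigma> x + n - 1)" by simp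
    also have "\<dots> = n - 1 + long_cycle m (\<sigma> x)"
      using sx mn by (auto simp: long_cycle_def)
    finally show ?thesis unfolding R .
  next
    case (2 z)
    let ?x = "(long_cycle n ^^ u) z"
    have x: "?x = (if u < z then z - u else z + n + 1 - u)"
      using 2 u by (subst long_cycle_pow) auto
    have "(long_cycle ?N ^^ (k - 1 + u)) p = ins m ?w ?x" and xw: "?x \<noteq> ?w"
      unfolding pow x using 2 k u by (auto simp: ins_def)
    then have "(perm_comp m ?w \<theta>' \<theta> \<circ> long_cycle ?N ^^ (k - 1 + u)) p = ins m n (\<theta>' ?x)"
      using permutes_inj[OF \<theta>'] mn xw by (simp only: o_apply perm_comp_ins \<theta>'w not_False_eq_True)
    also have "\<theta>' ?x = long_cycle n (\<rho> z)" using fun_cong[OF \<rho>\<theta>, of z] by simp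
    finally have R: "(perm_comp m ?w \<theta>' \<theta> \<circ> long_cycle ?N ^^ (k - 1 + u)) p
      = ins m n (long_cycle n (\<rho> z))" .
    have rz: "1 \<le> \<rho> z" "\<rho> z \<le> n" using permutes_bounds[OF \<rho> 2(1,2)] .
    have "perm_comp n k \<sigma> \<rho> p = \<rho> z"
      using 2 k perm_comp_block[OF 2(1,2) k(1), of \<sigma> \<rho>] by simp
    then have "(long_cycle ?N \<circ> perm_comp n k \<sigma> \<rho>) p = long_cycle ?N (\<rho> z)" by simp
    also have "\<dots> = ins m n (long_cycle n (\<rho> z))"
      using rz mn by (auto simp: ins_def long_cycle_def)
    finally show ?thesis unfolding R .
  qed
qed

text \<open>
  Rotating \<open>f\<close> by \<open>t\<close> steps moves the whole block \<open>g\<close> with it. As long as the block has not reached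
  the output, this is the same as rotating the composition by \<open>t\<close> steps; after the block has passed
  the output at \<open>t = k\<close>, the composition needs \<open>n - 1\<close> further steps.
\<close>

lemma long_cycle_pow_before_block:
  assumes "t < k" "k \<le> m" "1 \<le> n"
  shows "perm_comp n k (long_cycle m ^^ t) id = long_cycle (m + n - 1) ^^ t"
  using assms(1)
proof (induction t)
  case 0
  then show ?case using perm_comp_id[of k n] assms by (simp add: id_def)
next
  case (Suc t)
  have k: "(long_cycle m ^^ t) k = k - t" "1 \<le> k - t" "1 \<le> k" "2 \<le> k - t" "k - t \<le> m"
    using Suc.prems assms by (auto simp: long_cycle_pow)
  have "long_cycle m ^^ Suc t = long_cycle m \<circ> long_cycle m ^^ t" by simp
  then have "perm_comp n k (long_cycle m ^^ Suc t) (id \<circ> id)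
      = perm_comp n (k - t) (long_cycle m) id \<circ> perm_comp n k (long_cycle m ^^ t) id"
    using perm_comp_comp[OF permutes_inj[OF long_cycle_permutes[of m]]
        permutes_inj[OF long_cycle_pow_permutes[where n = m and k = t]] k(3) _ assms(3) permutes_id,
        of id] k(1,2)
    by (simp only:)
  also have "\<dots> = long_cycle (m + n - 1) \<circ> long_cycle (m + n - 1) ^^ t"
    using Suc k(4,5) assms by (simp only: long_cycle_eq_perm_comp)
  finally show ?case by (simp only: comp_id funpow.simps)
qed

lemma long_cycle_pow_after_block:
  assumes "1 \<le> k" "k < t" "t \<le> m" "1 \<le> n"
  shows "perm_comp n k (long_cycle m ^^ t) id = long_cycle (m + n - 1) ^^ (t + n - 1)"
  using assms(2,3)
proof (induction t)
  case (Suc t)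
  show ?case
  proof (cases "t = k")
    case True
    have k: "(long_cycle m ^^ (k - 1)) k = 1"
      using assms Suc.prems by (subst long_cycle_pow) auto
    have "long_cycle m ^^ Suc t = long_cycle m ^^ 2 \<circ> long_cycle m ^^ (k - 1)"
      unfolding funpow_add[symmetric] using True assms by simp
    then have "perm_comp n k (long_cycle m ^^ Suc t) (id \<circ> id)
        = perm_comp n 1 (long_cycle m ^^ 2) id \<circ> perm_comp n k (long_cycle m ^^ (k - 1)) id"
      using perm_comp_comp[OF permutes_inj[OF long_cycle_pow_permutes[where n = m and k = 2]]
          permutes_inj[OF long_cycle_pow_permutes[where n = m and k = "k - 1"]] assms(1) _ assms(4)
          permutes_id, of id] k
      by (simp only: order_refl)
    also have "\<dots> = long_cycle (m + n - 1) ^^ (n + 1) \<circ> long_cycle (m + n - 1) ^^ (k - 1)"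
    proof -
      have "2 \<le> m" "k - 1 < k" "k \<le> m" using Suc.prems True assms by auto
      then show ?thesis
        using assms(4) by (simp only: long_cycle_across_block long_cycle_pow_before_block)
    qed
    also have "\<dots> = long_cycle (m + n - 1) ^^ (Suc t + n - 1)"
      unfolding funpow_add[symmetric] using True assms by (simp add: add.commute)
    finally show ?thesis by (simp only: comp_id)
  next
    case False
    then have k: "(long_cycle m ^^ t) k = k + m + 1 - t" "1 \<le> k + m + 1 - t"
      "2 \<le> k + m + 1 - t" "k + m + 1 - t \<le> m"
      using Suc.prems assms by (auto simp: long_cycle_pow)
    have "long_cycle m ^^ Suc t = long_cycle m \<circ> long_cycle m ^^ t" by simp
    then have "perm_comp n k (long_cycle m ^^ Suc t) (id \<circ> id)
        = perm_comp n (k + m + 1 - t) (long_cycle m) id \<circ> perm_comp n k (long_cycle m ^^ t) id"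
      using perm_comp_comp[OF permutes_inj[OF long_cycle_permutes[of m]]
          permutes_inj[OF long_cycle_pow_permutes[where n = m and k = t]] assms(1) _ assms(4)
          permutes_id, of id] k(1,2)
      by (simp only:)
    also have "\<dots> = long_cycle (m + n - 1) ^^ 1 \<circ> long_cycle (m + n - 1) ^^ (t + n - 1)"
    proof -
      have "perm_comp n k (long_cycle m ^^ t) id = long_cycle (m + n - 1) ^^ (t + n - 1)"
        by (rule Suc.IH) (use Suc.prems False in auto)
      then show ?thesis
        unfolding long_cycle_eq_perm_comp[OF k(3,4) assms(4)] funpow_1 by (simp only:)
    qed
    also have "\<dots> = long_cycle (m + n - 1) ^^ (Suc t + n - 1)"
      unfolding funpow_add[symmetric] using assms by simp
    finally show ?thesis by (simp only: comp_id)
  qed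
qed simp

lemma long_cycle_decomp:
  assumes \<sigma>: "\<sigma> permutes {1..n}" and t: "1 \<le> t" "t \<le> n" "\<sigma> t = 1"
  obtains \<theta> where "\<theta> permutes {1..n}" "long_cycle n \<circ> \<sigma> = \<theta> \<circ> long_cycle n ^^ t"
proof -
  define \<theta> where "\<theta> = long_cycle n \<circ> \<sigma> \<circ> long_cycle n ^^ (n + 1 - t)"
  have "(long_cycle n ^^ (n + 1 - t)) (n + 1) = t"
    using t by (subst long_cycle_pow) auto
  then have "\<theta> (n + 1) = n + 1" using t(3) by (simp add: \<theta>_def long_cycle_def)
  moreover have "\<theta> permutes {1..n + 1}"
    unfolding \<theta>_def
    by (rule permutes_compose[OF long_cycle_pow_permutes
          permutes_compose[OF permutes_Suc[OF \<sigma>] long_cycle_permutes]])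
  ultimately have "\<theta> permutes {1..n}" by (rule permutes_fix_last[rotated])
  moreover have "\<theta> \<circ> long_cycle n ^^ t = long_cycle n \<circ> \<sigma>"
    unfolding \<theta>_def comp_assoc funpow_add[symmetric] using t(2) long_cycle_order[of n] by simp
  ultimately show ?thesis using that by metis
qed


section \<open>The symmetrization is a symmetric operad\<close>

lemma linear_uminus:
  assumes h: "h \<in> linear_maps M N" and N: "module rat_field N"
  shows "(\<lambda>x. \<ominus>\<^bsub>N\<^esub> h x) \<in> linear_maps M N"
proof -
  interpret N: module rat_field N by fact
  show ?thesis
  proof (rule linear_mapsI)
    fix x y assume "x \<in> carrier M" "y \<in> carrier M"
    then show "\<ominus>\<^bsub>N\<^esub> h (x \<oplus>\<^bsub>M\<^esub> y) = (\<ominus>\<^bsub>N\<^esub> h x) \<oplus>\<^bsub>N\<^esub> (\<ominus>\<^bsub>N\<^esub> h y)"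
      using linear_closed[OF h] by (simp add: linear_add[OF h] N.minus_add)
  next
    fix c x assume "x \<in> carrier M"
    then show "\<ominus>\<^bsub>N\<^esub> h (c \<odot>\<^bsub>M\<^esub> x) = c \<odot>\<^bsub>N\<^esub> (\<ominus>\<^bsub>N\<^esub> h x)"
      using linear_closed[OF h] N.smult_r_minus[of c "h x"] by (simp add: linear_smult[OF h])
  qed (use linear_closed[OF h] in simp)
qed

lemma linear_finsum:
  assumes N: "module rat_field N" and A: "finite A" and h: "\<And>x. x \<in> A \<Longrightarrow> h x \<in> linear_maps M N"
  shows "(\<lambda>F. finsum N (\<lambda>x. h x F) A) \<in> linear_maps M N"
proof (rule linear_mapsI)
  interpret N: module rat_field N by fact
  have cl: "(\<lambda>x. h x F) \<in> A \<rightarrow> carrier N" if "F \<in> carrier M" for F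
    using linear_closed[OF h that] by blast
  show "F \<in> carrier M \<Longrightarrow> finsum N (\<lambda>x. h x F) A \<in> carrier N" for F
    by (rule N.add.finprod_closed[OF cl])
  fix F assume F: "F \<in> carrier M"
  show "finsum N (\<lambda>x. h x (F \<oplus>\<^bsub>M\<^esub> G)) A
      = finsum N (\<lambda>x. h x F) A \<oplus>\<^bsub>N\<^esub> finsum N (\<lambda>x. h x G) A" if G: "G \<in> carrier M" for G
    unfolding N.add.finprod_multf[OF cl[OF F] cl[OF G], symmetric]
    by (rule N.add.finprod_cong'[OF refl])
      (use linear_add[OF h F G] linear_closed[OF h F] linear_closed[OF h G] in auto)
  show "finsum N (\<lambda>x. h x (c \<odot>\<^bsub>M\<^esub> F)) A = c \<odot>\<^bsub>N\<^esub> finsum N (\<lambda>x. h x F) A" for c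
    unfolding N.finsum_smult_ldistr[OF A _ cl[OF F], simplified]
    by (rule N.add.finprod_cong'[OF refl])
      (use linear_smult[OF h F] linear_closed[OF h F] smult_simps(1)[OF N] in auto)
qed

lemma finsum_single:
  assumes M: "abelian_monoid M" and "finite A" and f: "\<And>x. x \<in> A \<Longrightarrow> f x \<in> carrier M"
    and 0: "\<And>x. x \<in> A \<Longrightarrow> x \<noteq> a \<Longrightarrow> f x = \<zero>\<^bsub>M\<^esub>"
  shows "finsum M f A = (if a \<in> A then f a else \<zero>\<^bsub>M\<^esub>)"
proof -
  interpret abelian_monoid M by fact
  have rest: "finsum M f (A - {a}) = \<zero>\<^bsub>M\<^esub>"
    by (rule add.finprod_one_eqI) (use 0 in auto)
  show ?thesis
  proof (cases "a \<in> A")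
    case True
    then have "finsum M f (insert a (A - {a})) = f a \<oplus>\<^bsub>M\<^esub> finsum M f (A - {a})"
      using assms(2) f by (intro add.finprod_insert) auto
    then show ?thesis using True rest f by (simp add: insert_absorb)
  next
    case False
    then show ?thesis using rest by simp
  qed
qed

lemma permutes_comp_inv_eq_iff:
  assumes "\<rho> permutes S"
  shows "perm_inv \<rho> \<circ> \<theta> = \<sigma> \<longleftrightarrow> \<theta> = \<rho> \<circ> \<sigma>"
proof
  assume "perm_inv \<rho> \<circ> \<theta> = \<sigma>"
  then have "\<rho> \<circ> \<sigma> = (\<rho> \<circ> perm_inv \<rho>) \<circ> \<theta>" by (simp add: comp_assoc)
  then show "\<theta> = \<rho> \<circ> \<sigma>" by (simp add: permutes_inv_o[OF assms])
qed (simp add: permutes_inv_o[OF assms] flip: comp_assoc)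

context ns_operad
begin

abbreviation symm :: "((nat \<Rightarrow> nat) \<Rightarrow> 'a) sym_operad" where
  "symm \<equiv> symmetrization P"

lemma symm_elems: "elems symm n = perms n \<rightarrow>\<^sub>E elems P n"
  by (simp add: symmetrization_def)

lemma symm_unit: "op_unit symm = pure_tensor P 1 (op_unit P) id"
  by (simp add: symmetrization_def)

lemma symm_value_closed: "F \<in> elems symm n \<Longrightarrow> \<sigma> permutes {1..n} \<Longrightarrow> F \<sigma> \<in> elems P n"
  by (auto simp: symm_elems)

lemma
  assumes "\<theta> permutes {1..n}"
  shows symm_zero: "\<zero>\<^bsub>comp_space symm n\<^esub> \<theta> = \<zero>\<^bsub>comp_space P n\<^esub>"
    and symm_add: "(F \<oplus>\<^bsub>comp_space symm n\<^esub> G) \<theta> = F \<theta> \<oplus>\<^bsub>comp_space P n\<^esub> G \<theta>"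
    and symm_smult: "(c \<odot>\<^bsub>comp_space symm n\<^esub> F) \<theta> = c \<odot>\<^bsub>comp_space P n\<^esub> F \<theta>"
    and pure_tensor_apply: "pure_tensor P n E \<sigma> \<theta> = (if \<theta> = \<sigma> then E else \<zero>\<^bsub>comp_space P n\<^esub>)"
    and symm_perm_act: "perm_act symm n \<rho> F \<theta> = F (perm_inv \<rho> \<circ> \<theta>)"
  using assms by (simp_all add: symmetrization_def pure_tensor_def)

lemma symm_eqI:
  "F \<in> elems symm n \<Longrightarrow> G \<in> elems symm n \<Longrightarrow> (\<And>\<theta>. \<theta> permutes {1..n} \<Longrightarrow> F \<theta> = G \<theta>) \<Longrightarrow> F = G"
  unfolding symm_elems by (rule PiE_ext) auto

lemma symm_closed:
  assumes n: "1 \<le> n"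
  shows "\<zero>\<^bsub>comp_space symm n\<^esub> \<in> elems symm n"
    and "F \<in> elems symm n \<Longrightarrow> G \<in> elems symm n \<Longrightarrow> F \<oplus>\<^bsub>comp_space symm n\<^esub> G \<in> elems symm n"
    and "F \<in> elems symm n \<Longrightarrow> c \<odot>\<^bsub>comp_space symm n\<^esub> F \<in> elems symm n"
    and pure_tensor_closed: "E \<in> elems P n \<Longrightarrow> pure_tensor P n E \<sigma> \<in> elems symm n"
proof -
  interpret M: module rat_field "comp_space P n" by (rule comp_space[OF n])
  note [simp] = smult_simps(1)[OF comp_space[OF n]]
  show "\<zero>\<^bsub>comp_space symm n\<^esub> \<in> elems symm n"
    by (simp add: symmetrization_def)
  show "F \<in> elems symm n \<Longrightarrow> G \<in> elems symm n \<Longrightarrow> F \<oplus>\<^bsub>comp_space symm n\<^esub> G \<in> elems symm n"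
    by (simp add: symmetrization_def PiE_iff)
  show "F \<in> elems symm n \<Longrightarrow> c \<odot>\<^bsub>comp_space symm n\<^esub> F \<in> elems symm n"
    by (simp add: symmetrization_def PiE_iff)
  show "E \<in> elems P n \<Longrightarrow> pure_tensor P n E \<sigma> \<in> elems symm n"
    by (simp add: symmetrization_def pure_tensor_def PiE_iff)
qed

lemma symm_module:
  assumes n: "1 \<le> n"
  shows "module rat_field (comp_space symm n)"
proof -
  interpret M: module rat_field "comp_space P n" by (rule comp_space[OF n])
  note cl = symm_closed[OF n] and v = symm_value_closed[of _ n]
    and s = smult_simps[OF comp_space[OF n]]
  show ?thesis
    by (rule rat_moduleI; (rule symm_eqI[where n = n])?)
      (simp_all only: cl symm_zero symm_add symm_smult v M.a_assoc M.l_zero s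
        smult_r_distr_rat[OF comp_space[OF n]] M.a_comm)
qed

lemma symm_eval_linear:
  "\<sigma> permutes {1..n} \<Longrightarrow> (\<lambda>F. F \<sigma>) \<in> linear_maps (comp_space symm n) (comp_space P n)"
  by (rule linear_mapsI) (simp_all add: symm_value_closed symm_add symm_smult)

lemma symm_linearI:
  assumes n: "1 \<le> n"
    and val: "\<And>\<theta>. \<theta> permutes {1..n} \<Longrightarrow> (\<lambda>F. h F \<theta>) \<in> linear_maps M (comp_space P n)"
    and ext: "\<And>F. h F \<in> extensional (perms n)"
  shows "h \<in> linear_maps M (comp_space symm n)"
proof (rule linear_mapsI)
  have M: "h F \<in> elems symm n" if "F \<in> carrier M" for F
    using linear_closed[OF val that] ext by (simp add: symm_elems PiE_iff)
  then show "F \<in> carrier M \<Longrightarrow> h F \<in> elems symm n" for F .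
  have ext_ops: "F \<oplus>\<^bsub>comp_space symm n\<^esub> G \<in> extensional (perms n)"
    "c \<odot>\<^bsub>comp_space symm n\<^esub> F \<in> extensional (perms n)" for F G c
    by (simp_all add: symmetrization_def)
  show "h (F \<oplus>\<^bsub>M\<^esub> G) = h F \<oplus>\<^bsub>comp_space symm n\<^esub> h G" if "F \<in> carrier M" "G \<in> carrier M" for F G
    by (rule extensionalityI[OF ext ext_ops(1)]) (simp add: linear_add[OF val] symm_add that)
  show "h (c \<odot>\<^bsub>M\<^esub> F) = c \<odot>\<^bsub>comp_space symm n\<^esub> h F" if "F \<in> carrier M" for c F
    by (rule extensionalityI[OF ext ext_ops(2)]) (simp add: linear_smult[OF val] symm_smult that)
qed

lemma pure_tensor_linear:
  assumes n: "1 \<le> n"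
  shows "(\<lambda>E. pure_tensor P n E \<sigma>) \<in> linear_maps (comp_space P n) (comp_space symm n)"
proof (rule linear_mapsI)
  interpret M: module rat_field "comp_space P n" by (rule comp_space[OF n])
  note cl = symm_closed[OF n] pure_tensor_closed[OF n] smult_simps(1)[OF comp_space[OF n]] M.a_closed
  show "pure_tensor P n (x \<oplus>\<^bsub>comp_space P n\<^esub> y) \<sigma>
      = pure_tensor P n x \<sigma> \<oplus>\<^bsub>comp_space symm n\<^esub> pure_tensor P n y \<sigma>"
    if "x \<in> elems P n" "y \<in> elems P n" for x y
    by (rule symm_eqI[where n = n]) (use that cl in \<open>simp_all add: symm_add pure_tensor_apply\<close>)
  show "pure_tensor P n (c \<odot>\<^bsub>comp_space P n\<^esub> x) \<sigma> = c \<odot>\<^bsub>comp_space symm n\<^esub> pure_tensor P n x \<sigma>"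
    if "x \<in> elems P n" for c x
    by (rule symm_eqI[where n = n])
      (use that cl in \<open>simp_all add: symm_smult pure_tensor_apply smult_zero[OF comp_space[OF n]]\<close>)
qed (rule pure_tensor_closed[OF n])

text \<open>Every element is the sum of the pure tensors of its values.\<close>

lemma symm_linear_eqI:
  assumes n: "1 \<le> n" and h: "h \<in> linear_maps (comp_space symm n) N"
    and h': "h' \<in> linear_maps (comp_space symm n) N"
    and eq: "\<And>E \<sigma>. E \<in> elems P n \<Longrightarrow> \<sigma> permutes {1..n} \<Longrightarrow>
      h (pure_tensor P n E \<sigma>) = h' (pure_tensor P n E \<sigma>)"
    and F: "F \<in> elems symm n"
  shows "h F = h' F"
proof -
  interpret M: module rat_field "comp_space P n" by (rule comp_space[OF n])
  define R where "R A = (\<lambda>\<theta>\<in>perms n. if \<theta> \<in> A then F \<theta> else \<zero>\<^bsub>comp_space P n\<^esub>)" for A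
  have R: "R A \<in> elems symm n" for A
    using F by (auto simp: R_def symm_elems)
  have val: "R A \<theta> = (if \<theta> \<in> A then F \<theta> else \<zero>\<^bsub>comp_space P n\<^esub>)" if "\<theta> permutes {1..n}" for A \<theta>
    using that by (simp add: R_def)
  have "h (R A) = h' (R A)" if "finite A" "A \<subseteq> perms n" for A
    using that
  proof (induction A rule: finite_induct)
    case empty
    have "R {} = pure_tensor P n \<zero>\<^bsub>comp_space P n\<^esub> id"
      by (rule symm_eqI[OF R pure_tensor_closed[OF n M.zero_closed]])
        (simp add: val pure_tensor_apply)
    then show ?case using eq[OF M.zero_closed permutes_id] by simp
  next
    case (insert \<sigma> A)
    then have \<sigma>: "\<sigma> permutes {1..n}" and v: "F \<sigma> \<in> elems P n" using F by (auto simp: symm_elems)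
    have e: "R (insert \<sigma> A) = R A \<oplus>\<^bsub>comp_space symm n\<^esub> pure_tensor P n (F \<sigma>) \<sigma>"
      by (rule symm_eqI[OF R symm_closed(2)[OF n R pure_tensor_closed[OF n v]]])
        (use insert symm_value_closed[OF F] in \<open>auto simp: val symm_add pure_tensor_apply\<close>)
    show ?case
      unfolding e using insert eq[OF v \<sigma>] R pure_tensor_closed[OF n v]
      by (simp add: linear_add[OF h] linear_add[OF h'])
  qed
  moreover have "finite (perms n)" by (rule finite_permutations) simp
  moreover have "R (perms n) = F" by (rule symm_eqI[OF R F]) (simp add: val)
  ultimately show ?thesis by force
qed

lemma symm_bilinear_eqI:
  assumes mn: "1 \<le> m" "1 \<le> n"
    and left: "\<And>G. G \<in> elems symm n \<Longrightarrow> (\<lambda>F. T F G) \<in> linear_maps (comp_space symm m) N"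
      "\<And>G. G \<in> elems symm n \<Longrightarrow> (\<lambda>F. T' F G) \<in> linear_maps (comp_space symm m) N"
    and right: "\<And>F. F \<in> elems symm m \<Longrightarrow> (\<lambda>G. T F G) \<in> linear_maps (comp_space symm n) N"
      "\<And>F. F \<in> elems symm m \<Longrightarrow> (\<lambda>G. T' F G) \<in> linear_maps (comp_space symm n) N"
    and pure: "\<And>E E' \<sigma> \<rho>. \<lbrakk>E \<in> elems P m; E' \<in> elems P n; \<sigma> permutes {1..m}; \<rho> permutes {1..n}\<rbrakk> \<Longrightarrow>
      T (pure_tensor P m E \<sigma>) (pure_tensor P n E' \<rho>) = T' (pure_tensor P m E \<sigma>) (pure_tensor P n E' \<rho>)"
    and F: "F \<in> elems symm m" and G: "G \<in> elems symm n"
  shows "T F G = T' F G"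
proof (rule symm_linear_eqI[OF mn(1) left(1)[OF G] left(2)[OF G] _ F])
  fix E \<sigma> assume *: "E \<in> elems P m" "\<sigma> permutes {1..m}"
  note c = pure_tensor_closed[OF mn(1) *(1)]
  show "T (pure_tensor P m E \<sigma>) G = T' (pure_tensor P m E \<sigma>) G"
    by (rule symm_linear_eqI[OF mn(2) right(1)[OF c] right(2)[OF c] pure[OF *(1) _ *(2)] G])
qed

lemma symm_trilinear_eqI:
  assumes n: "1 \<le> m" "1 \<le> n" "1 \<le> l"
    and 1: "\<And>G H. G \<in> elems symm n \<Longrightarrow> H \<in> elems symm l \<Longrightarrow>
        (\<lambda>F. T F G H) \<in> linear_maps (comp_space symm m) N"
      "\<And>G H. G \<in> elems symm n \<Longrightarrow> H \<in> elems symm l \<Longrightarrow>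
        (\<lambda>F. T' F G H) \<in> linear_maps (comp_space symm m) N"
    and 2: "\<And>F H. F \<in> elems symm m \<Longrightarrow> H \<in> elems symm l \<Longrightarrow>
        (\<lambda>G. T F G H) \<in> linear_maps (comp_space symm n) N"
      "\<And>F H. F \<in> elems symm m \<Longrightarrow> H \<in> elems symm l \<Longrightarrow>
        (\<lambda>G. T' F G H) \<in> linear_maps (comp_space symm n) N"
    and 3: "\<And>F G. F \<in> elems symm m \<Longrightarrow> G \<in> elems symm n \<Longrightarrow>
        (\<lambda>H. T F G H) \<in> linear_maps (comp_space symm l) N"
      "\<And>F G. F \<in> elems symm m \<Longrightarrow> G \<in> elems symm n \<Longrightarrow>
        (\<lambda>H. T' F G H) \<in> linear_maps (comp_space symm l) N"
    and pure: "\<And>E E' E'' \<sigma> \<rho> \<pi>. \<lbrakk>E \<in> elems P m; E' \<in> elems P n; E'' \<in> elems P l;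
      \<sigma> permutes {1..m}; \<rho> permutes {1..n}; \<pi> permutes {1..l}\<rbrakk> \<Longrightarrow>
      T (pure_tensor P m E \<sigma>) (pure_tensor P n E' \<rho>) (pure_tensor P l E'' \<pi>)
        = T' (pure_tensor P m E \<sigma>) (pure_tensor P n E' \<rho>) (pure_tensor P l E'' \<pi>)"
    and F: "F \<in> elems symm m" and G: "G \<in> elems symm n" and H: "H \<in> elems symm l"
  shows "T F G H = T' F G H"
proof (rule symm_linear_eqI[OF n(1) 1(1)[OF G H] 1(2)[OF G H] _ F])
  fix E \<sigma> assume *: "E \<in> elems P m" "\<sigma> permutes {1..m}"
  note c = pure_tensor_closed[OF n(1) *(1), of \<sigma>]
  show "T (pure_tensor P m E \<sigma>) G H = T' (pure_tensor P m E \<sigma>) G H"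
    by (rule symm_bilinear_eqI[OF n(2,3) 2(1)[OF c] 2(2)[OF c] 3(1)[OF c] 3(2)[OF c]
          pure[OF *(1) _ _ *(2)] G H])
qed

lemma symm_pcomp:
  fixes i
  defines "pos x \<equiv> perm_inv (fst x) i"
  assumes "\<theta> permutes {1..m + n - 1}"
  shows "pcomp symm m n i F G \<theta> = finsum (comp_space P (m + n - 1))
    (\<lambda>x. pcomp P m n (pos x) (F (fst x)) (G (snd x)))
    {x \<in> perms m \<times> perms n. perm_comp n (pos x) (fst x) (snd x) = \<theta>}"
  using assms(2) unfolding pos_def
  by (auto simp: symmetrization_def split_def intro!: arg_cong[where f = "finsum _ _"])

lemma
  assumes i: "1 \<le> i" "i \<le> m" "1 \<le> n"
  shows symm_pcomp_linear_left: "G \<in> elems symm n \<Longrightarrow>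
      (\<lambda>F. pcomp symm m n i F G) \<in> linear_maps (comp_space symm m) (comp_space symm (m + n - 1))"
    and symm_pcomp_linear_right: "F \<in> elems symm m \<Longrightarrow>
      (\<lambda>G. pcomp symm m n i F G) \<in> linear_maps (comp_space symm n) (comp_space symm (m + n - 1))"
proof -
  let ?I = "\<lambda>\<theta>. {x \<in> perms m \<times> perms n. perm_comp n (perm_inv (fst x) i) (fst x) (snd x) = \<theta>}"
  have N: "1 \<le> m + n - 1" using i by auto
  have fin: "finite (?I \<theta>)" for \<theta>
    by (rule finite_subset[of _ "perms m \<times> perms n"])
      (auto intro!: finite_cartesian_product finite_permutations)
  have I: "fst x permutes {1..m}" "snd x permutes {1..n}" if "x \<in> ?I \<theta>" for x \<theta>
    using that by auto
  note pos = perm_inv_bounds[OF I(1) i(1,2)]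
  have ext: "pcomp symm m n i F G \<in> extensional (perms (m + n - 1))" for F G
    by (simp add: symmetrization_def)
  show "(\<lambda>F. pcomp symm m n i F G) \<in> linear_maps (comp_space symm m) (comp_space symm (m + n - 1))"
    if G: "G \<in> elems symm n"
  proof (rule symm_linearI[OF N _ ext], unfold symm_pcomp, rule linear_finsum[OF comp_space[OF N] fin])
    fix \<theta> x assume x: "x \<in> ?I \<theta>"
    show "(\<lambda>F. pcomp P m n (perm_inv (fst x) i) (F (fst x)) (G (snd x)))
        \<in> linear_maps (comp_space symm m) (comp_space P (m + n - 1))"
      by (rule linear_compose[OF symm_eval_linear[OF I(1)[OF x]]
            pcomp_linear_left[OF pos[OF x] i(3) symm_value_closed[OF G I(2)[OF x]]]])
  qed
  show "(\<lambda>G. pcomp symm m n i F G) \<in> linear_maps (comp_space symm n) (comp_space symm (m + n - 1))"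
    if F: "F \<in> elems symm m"
  proof (rule symm_linearI[OF N _ ext], unfold symm_pcomp, rule linear_finsum[OF comp_space[OF N] fin])
    fix \<theta> x assume x: "x \<in> ?I \<theta>"
    show "(\<lambda>G. pcomp P m n (perm_inv (fst x) i) (F (fst x)) (G (snd x)))
        \<in> linear_maps (comp_space symm n) (comp_space P (m + n - 1))"
      by (rule linear_compose[OF symm_eval_linear[OF I(2)[OF x]]
            pcomp_linear_right[OF pos[OF x] i(3) symm_value_closed[OF F I(1)[OF x]]]])
  qed
qed

lemma symm_pcomp_closed:
  assumes "1 \<le> i" "i \<le> m" "1 \<le> n" "F \<in> elems symm m" "G \<in> elems symm n"
  shows "pcomp symm m n i F G \<in> elems symm (m + n - 1)"
  by (rule linear_closed[OF symm_pcomp_linear_left[OF assms(1-3,5)] assms(4)])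

text \<open>Only the summand indexed by the pair of the two permutations does not vanish.\<close>

lemma symm_pcomp_pure:
  assumes \<sigma>: "\<sigma> permutes {1..m}" and \<rho>: "\<rho> permutes {1..n}" and k: "1 \<le> k" "k \<le> m" "1 \<le> n"
    and E: "E \<in> elems P m" "E' \<in> elems P n" and i: "i = \<sigma> k"
  shows "pcomp symm m n i (pure_tensor P m E \<sigma>) (pure_tensor P n E' \<rho>)
    = pure_tensor P (m + n - 1) (pcomp P m n k E E') (perm_comp n k \<sigma> \<rho>)"
proof (rule symm_eqI)
  have m: "1 \<le> m" "1 \<le> m + n - 1" using k by auto
  interpret M: module rat_field "comp_space P (m + n - 1)" by (rule comp_space[OF m(2)])
  have ib: "1 \<le> i" "i \<le> m" unfolding i using permutes_bounds[OF \<sigma> k(1,2)] by auto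
  show "pcomp symm m n i (pure_tensor P m E \<sigma>) (pure_tensor P n E' \<rho>) \<in> elems symm (m + n - 1)"
    by (intro symm_pcomp_closed pure_tensor_closed ib k E m)
  show "pure_tensor P (m + n - 1) (pcomp P m n k E E') (perm_comp n k \<sigma> \<rho>)
      \<in> elems symm (m + n - 1)"
    by (intro pcomp_closed pure_tensor_closed k E m)
  fix \<theta> assume \<theta>: "\<theta> permutes {1..m + n - 1}"
  have pos: "perm_inv \<sigma> i = k" by (rule perm_inv_eqI[OF \<sigma> i[symmetric]])
  let ?t = "\<lambda>x. pcomp P m n (perm_inv (fst x) i) (pure_tensor P m E \<sigma> (fst x)) (pure_tensor P n E' \<rho> (snd x))"
  let ?I = "{x \<in> perms m \<times> perms n. perm_comp n (perm_inv (fst x) i) (fst x) (snd x) = \<theta>}"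
  have "finsum (comp_space P (m + n - 1)) ?t ?I
      = (if (\<sigma>, \<rho>) \<in> ?I then ?t (\<sigma>, \<rho>) else \<zero>\<^bsub>comp_space P (m + n - 1)\<^esub>)"
  proof (rule finsum_single)
    show "abelian_monoid (comp_space P (m + n - 1))" by (rule M.abelian_monoid_axioms)
    show "finite ?I"
      by (rule finite_subset[of _ "perms m \<times> perms n"])
        (auto intro!: finite_cartesian_product finite_permutations)
    fix x assume x: "x \<in> ?I"
    then have x': "fst x permutes {1..m}" "snd x permutes {1..n}" by auto
    note p = perm_inv_bounds[OF x'(1) ib]
    note v = symm_value_closed[OF pure_tensor_closed[OF m(1) E(1)] x'(1), of \<sigma>]
      symm_value_closed[OF pure_tensor_closed[OF k(3) E(2)] x'(2), of \<rho>]
    show "?t x \<in> elems P (m + n - 1)"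
      by (rule pcomp_closed[OF p k(3) v])
    assume "x \<noteq> (\<sigma>, \<rho>)"
    then have "fst x \<noteq> \<sigma> \<or> snd x \<noteq> \<rho>" by (metis prod.collapse)
    then show "?t x = \<zero>\<^bsub>comp_space P (m + n - 1)\<^esub>"
      using pcomp_zero_left[OF p k(3) v(2)] pcomp_zero_right[OF p k(3) v(1)]
      by (auto simp: pure_tensor_apply[OF x'(1)] pure_tensor_apply[OF x'(2)])
  qed
  also have "\<dots> = pure_tensor P (m + n - 1) (pcomp P m n k E E') (perm_comp n k \<sigma> \<rho>) \<theta>"
    using \<sigma> \<rho> by (auto simp: pure_tensor_apply[OF \<theta>] pure_tensor_apply[OF \<sigma>]
        pure_tensor_apply[OF \<rho>] pos)
  finally show "pcomp symm m n i (pure_tensor P m E \<sigma>) (pure_tensor P n E' \<rho>) \<theta>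
      = pure_tensor P (m + n - 1) (pcomp P m n k E E') (perm_comp n k \<sigma> \<rho>) \<theta>"
    unfolding symm_pcomp[OF \<theta>] .
qed

lemma symm_perm_act_linear:
  assumes n: "1 \<le> n" and \<rho>: "\<rho> permutes {1..n}"
  shows "perm_act symm n \<rho> \<in> linear_maps (comp_space symm n) (comp_space symm n)"
proof (rule symm_linearI[OF n])
  fix \<theta> assume \<theta>: "\<theta> permutes {1..n}"
  show "(\<lambda>F. perm_act symm n \<rho> F \<theta>) \<in> linear_maps (comp_space symm n) (comp_space P n)"
    unfolding symm_perm_act[OF \<theta>]
    by (rule symm_eval_linear[OF permutes_compose[OF \<theta> permutes_inv[OF \<rho>]]])
qed (simp add: symmetrization_def)

lemma symm_perm_act_pure:
  assumes n: "1 \<le> n" and \<rho>: "\<rho> permutes {1..n}" and E: "E \<in> elems P n"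
  shows "perm_act symm n \<rho> (pure_tensor P n E \<sigma>) = pure_tensor P n E (\<rho> \<circ> \<sigma>)"
proof (rule symm_eqI)
  show "perm_act symm n \<rho> (pure_tensor P n E \<sigma>) \<in> elems symm n"
    by (rule linear_closed[OF symm_perm_act_linear[OF n \<rho>] pure_tensor_closed[OF n E]])
  show "pure_tensor P n E (\<rho> \<circ> \<sigma>) \<in> elems symm n" by (rule pure_tensor_closed[OF n E])
  fix \<theta> assume \<theta>: "\<theta> permutes {1..n}"
  have p: "perm_inv \<rho> \<circ> \<theta> permutes {1..n}"
    by (rule permutes_compose[OF \<theta> permutes_inv[OF \<rho>]])
  show "perm_act symm n \<rho> (pure_tensor P n E \<sigma>) \<theta> = pure_tensor P n E (\<rho> \<circ> \<sigma>) \<theta>"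
    unfolding symm_perm_act[OF \<theta>] pure_tensor_apply[OF \<theta>] pure_tensor_apply[OF p]
      permutes_comp_inv_eq_iff[OF \<rho>] ..
qed

text \<open>
  Both sides of each axiom are linear in every argument, so it suffices to compare them on pure
  tensors. There they agree by the same axiom of \<open>P\<close> and an identity of permutations.
\<close>

lemma symm_ns_operad: "ns_operad symm"
proof (rule ns_operad.intro)
  show "op_unit symm \<in> elems symm 1"
    unfolding symm_unit by (rule pure_tensor_closed[OF order_refl unit_closed])
next
  fix n :: nat and g assume n: "1 \<le> n" and g: "g \<in> elems symm n"
  have u: "op_unit symm \<in> elems symm 1"
    unfolding symm_unit by (rule pure_tensor_closed[OF order_refl unit_closed])
  have "pcomp symm 1 n 1 (op_unit symm) g = (\<lambda>g. g) g"
  proof (rule symm_linear_eqI[OF n _ _ _ g])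
    show "(\<lambda>g. pcomp symm 1 n 1 (op_unit symm) g) \<in> linear_maps (comp_space symm n) (comp_space symm n)"
      using symm_pcomp_linear_right[OF order_refl order_refl n u] by simp
    show "(\<lambda>g. g) \<in> linear_maps (comp_space symm n) (comp_space symm n)"
      by (simp add: linear_maps_def)
    fix E \<sigma> assume *: "E \<in> elems P n" "\<sigma> permutes {1..n}"
    show "pcomp symm 1 n 1 (op_unit symm) (pure_tensor P n E \<sigma>) = pure_tensor P n E \<sigma>"
      unfolding symm_unit
      using symm_pcomp_pure[OF permutes_id *(2) order_refl order_refl n unit_closed *(1)]
      by (simp add: unit_left[OF n *(1)] perm_comp_unit_left[OF *(2) n])
  qed
  then show "pcomp symm 1 n 1 (op_unit symm) g = g" .
next
  fix i m :: nat and f assume i: "1 \<le> i" "i \<le> m" and f: "f \<in> elems symm m"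
  have m: "1 \<le> m" using i by simp
  have u: "op_unit symm \<in> elems symm 1"
    unfolding symm_unit by (rule pure_tensor_closed[OF order_refl unit_closed])
  have "pcomp symm m 1 i f (op_unit symm) = (\<lambda>g. g) f"
  proof (rule symm_linear_eqI[OF m _ _ _ f])
    show "(\<lambda>f. pcomp symm m 1 i f (op_unit symm)) \<in> linear_maps (comp_space symm m) (comp_space symm m)"
      using symm_pcomp_linear_left[OF i order_refl u] by simp
    show "(\<lambda>g. g) \<in> linear_maps (comp_space symm m) (comp_space symm m)"
      by (simp add: linear_maps_def)
    fix E \<sigma> assume *: "E \<in> elems P m" "\<sigma> permutes {1..m}"
    note k = perm_inv_bounds[OF *(2) i]
    have "i = \<sigma> (perm_inv \<sigma> i)" using permutes_inverses(1)[OF *(2)] by simp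
    from symm_pcomp_pure[OF *(2) permutes_id k order_refl *(1) unit_closed this]
    show "pcomp symm m 1 i (pure_tensor P m E \<sigma>) (op_unit symm) = pure_tensor P m E \<sigma>"
      unfolding symm_unit
      by (simp add: unit_right[OF k *(1)] perm_comp_unit_right[OF *(2) k])
  qed
  then show "pcomp symm m 1 i f (op_unit symm) = f" .
next
  fix i m j n l :: nat and f g h
  assume *: "1 \<le> i" "i \<le> m" "1 \<le> j" "j \<le> n" "1 \<le> l"
    and f: "f \<in> elems symm m" and g: "g \<in> elems symm n" and h: "h \<in> elems symm l"
  have n: "1 \<le> m" "1 \<le> n" "1 \<le> m + n - 1" "1 \<le> n + l - 1" "1 \<le> i + j - 1"
    "i + j - 1 \<le> m + n - 1" "m + n - 1 + l - 1 = m + (n + l - 1) - 1"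
    using * by auto
  note L = symm_pcomp_linear_left and R = symm_pcomp_linear_right and C = symm_pcomp_closed
  have pure: "pcomp symm (m + n - 1) l (i + j - 1)
        (pcomp symm m n i (pure_tensor P m E \<sigma>) (pure_tensor P n E' \<rho>)) (pure_tensor P l E'' \<pi>)
      = pcomp symm m (n + l - 1) i (pure_tensor P m E \<sigma>)
        (pcomp symm n l j (pure_tensor P n E' \<rho>) (pure_tensor P l E'' \<pi>))"
    if E: "E \<in> elems P m" "E' \<in> elems P n" "E'' \<in> elems P l"
      and p: "\<sigma> permutes {1..m}" "\<rho> permutes {1..n}" "\<pi> permutes {1..l}" for E E' E'' \<sigma> \<rho> \<pi>
  proof -
    define k where "k = perm_inv \<sigma> i"
    define k' where "k' = perm_inv \<rho> j"
    have k: "1 \<le> k" "k \<le> m" "i = \<sigma> k" "1 \<le> k'" "k' \<le> n" "j = \<rho> k'"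
      using perm_inv_bounds[OF p(1) *(1,2)] perm_inv_bounds[OF p(2) *(3,4)]
        permutes_inverses(1)[OF p(1)] permutes_inverses(1)[OF p(2)] by (auto simp: k_def k'_def)
    have pos: "i + j - 1 = perm_comp n k \<sigma> \<rho> (k - 1 + k')" "k - 1 + k' = k + k' - 1"
      "1 \<le> k - 1 + k'" "k - 1 + k' \<le> m + n - 1"
      unfolding perm_comp_block[OF k(4,5,1)] using * k by auto
    note q = perm_comp_permutes[OF p(1,2) k(1,2) n(2)] perm_comp_permutes[OF p(2,3) k(4,5) *(5)]
    note e = pcomp_closed[OF k(1,2) n(2) E(1,2)] pcomp_closed[OF k(4,5) *(5) E(2,3)]
    show ?thesis
      unfolding symm_pcomp_pure[OF p(1,2) k(1,2) n(2) E(1,2) k(3)]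
        symm_pcomp_pure[OF p(2,3) k(4,5) *(5) E(2,3) k(6)]
        symm_pcomp_pure[OF p(1) q(2) k(1,2) n(4) E(1) e(2) k(3)]
        symm_pcomp_pure[OF q(1) p(3) pos(3,4) *(5) e(1) E(3) pos(1)]
        perm_comp_sequential[OF p(1,2) k(1,2,4,5) *(5)]
      using assoc_sequential[OF k(1,2,4,5) *(5) E] by (simp only: pos(2) n(7))
  qed
  note lin = linear_compose[OF L[OF *(1,2) n(2)] L[OF n(5,6) *(5)]]
    linear_compose[OF R[OF *(1,2) n(2)] L[OF n(5,6) *(5)]] R[OF n(5,6) *(5) C[OF *(1,2) n(2)]]
    L[OF *(1,2) n(4) C[OF *(3-5)], folded n(7)]
    linear_compose[OF L[OF *(3-5)] R[OF *(1,2) n(4)], folded n(7)]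
    linear_compose[OF R[OF *(3-5)] R[OF *(1,2) n(4)], folded n(7)]
  show "pcomp symm (m + n - 1) l (i + j - 1) (pcomp symm m n i f g) h
      = pcomp symm m (n + l - 1) i f (pcomp symm n l j g h)"
    by (rule symm_trilinear_eqI[where
          T = "\<lambda>f g h. pcomp symm (m + n - 1) l (i + j - 1) (pcomp symm m n i f g) h"
          and T' = "\<lambda>f g h. pcomp symm m (n + l - 1) i f (pcomp symm n l j g h)",
          OF n(1,2) *(5) _ _ _ _ _ _ pure f g h]; (rule lin)?; assumption)
next
  fix i k m n l :: nat and f g h
  assume *: "1 \<le> i" "i < k" "k \<le> m" "1 \<le> n" "1 \<le> l"
    and f: "f \<in> elems symm m" and g: "g \<in> elems symm n" and h: "h \<in> elems symm l"
  have n: "1 \<le> m" "1 \<le> k" "i \<le> m" "1 \<le> k + n - 1" "k + n - 1 \<le> m + n - 1" "i \<le> m + l - 1"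
    "m + n - 1 + l - 1 = m + l - 1 + n - 1"
    using * by auto
  note L = symm_pcomp_linear_left and R = symm_pcomp_linear_right and C = symm_pcomp_closed
  have pure: "pcomp symm (m + n - 1) l (k + n - 1)
        (pcomp symm m n i (pure_tensor P m E \<sigma>) (pure_tensor P n E' \<rho>)) (pure_tensor P l E'' \<pi>)
      = pcomp symm (m + l - 1) n i
        (pcomp symm m l k (pure_tensor P m E \<sigma>) (pure_tensor P l E'' \<pi>)) (pure_tensor P n E' \<rho>)"
    if E: "E \<in> elems P m" "E' \<in> elems P n" "E'' \<in> elems P l"
      and p: "\<sigma> permutes {1..m}" "\<rho> permutes {1..n}" "\<pi> permutes {1..l}" for E E' E'' \<sigma> \<rho> \<pi>
  proof -
    define a where "a = perm_inv \<sigma> i"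
    define b where "b = perm_inv \<sigma> k"
    have ab: "1 \<le> a" "a \<le> m" "i = \<sigma> a" "1 \<le> b" "b \<le> m" "k = \<sigma> b"
      using perm_inv_bounds[OF p(1) *(1) n(3)] perm_inv_bounds[OF p(1) n(2) *(3)]
        permutes_inverses(1)[OF p(1)] by (auto simp: a_def b_def)
    then have ne: "a \<noteq> b" using *(2) by auto
    note inj = permutes_inj[OF p(1)]
    have pos: "k + n - 1 = perm_comp n a \<sigma> \<rho> (ins n a b)" "1 \<le> ins n a b" "ins n a b \<le> m + n - 1"
      "i = perm_comp l b \<sigma> \<pi> (ins l b a)" "1 \<le> ins l b a" "ins l b a \<le> m + l - 1"
      unfolding perm_comp_ins[OF inj *(4) not_sym[OF ne]] perm_comp_ins[OF inj *(5) ne]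
      using ab * by (auto simp: ins_def)
    note q = perm_comp_permutes[OF p(1,2) ab(1,2) *(4)] perm_comp_permutes[OF p(1,3) ab(4,5) *(5)]
    note e = pcomp_closed[OF ab(1,2) *(4) E(1,2)] pcomp_closed[OF ab(4,5) *(5) E(1,3)]
    have "pcomp P (m + n - 1) l (ins n a b) (pcomp P m n a E E') E''
        = pcomp P (m + l - 1) n (ins l b a) (pcomp P m l b E E'') E'"
    proof (cases "a < b")
      case True
      then show ?thesis using assoc_parallel[OF ab(1) True ab(5) *(4,5) E] by (simp add: ins_def)
    next
      case False
      then have "b < a" using ne by simp
      then show ?thesis
        using assoc_parallel[OF ab(4) \<open>b < a\<close> ab(2) *(5,4) E(1,3,2)] by (simp add: ins_def)
    qed
    then show ?thesis
      unfolding symm_pcomp_pure[OF p(1,2) ab(1,2) *(4) E(1,2) ab(3)]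
        symm_pcomp_pure[OF p(1,3) ab(4,5) *(5) E(1,3) ab(6)]
        symm_pcomp_pure[OF q(1) p(3) pos(2,3) *(5) e(1) E(3) pos(1)]
        symm_pcomp_pure[OF q(2) p(2) pos(5,6) *(4) e(2) E(2) pos(4)]
        perm_comp_parallel[OF p ab(1,2,4,5) ne *(4,5)]
      by (simp only: n(7))
  qed
  note lin = linear_compose[OF L[OF *(1) n(3) *(4)] L[OF n(4,5) *(5)]]
    linear_compose[OF R[OF *(1) n(3) *(4)] L[OF n(4,5) *(5)]] R[OF n(4,5) *(5) C[OF *(1) n(3) *(4)]]
    linear_compose[OF L[OF n(2) *(3,5)] L[OF *(1) n(6) *(4)], folded n(7)]
    R[OF *(1) n(6) *(4) C[OF n(2) *(3,5)], folded n(7)]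
    linear_compose[OF R[OF n(2) *(3,5)] L[OF *(1) n(6) *(4)], folded n(7)]
  show "pcomp symm (m + n - 1) l (k + n - 1) (pcomp symm m n i f g) h
      = pcomp symm (m + l - 1) n i (pcomp symm m l k f h) g"
    by (rule symm_trilinear_eqI[where
          T = "\<lambda>f g h. pcomp symm (m + n - 1) l (k + n - 1) (pcomp symm m n i f g) h"
          and T' = "\<lambda>f g h. pcomp symm (m + l - 1) n i (pcomp symm m l k f h) g",
          OF n(1) *(4,5) _ _ _ _ _ _ pure f g h]; (rule lin)?; assumption)
qed (rule symm_module symm_pcomp_linear_left symm_pcomp_linear_right; assumption)+

lemma symm_sym_operad: "sym_operad symm"
proof (intro sym_operad.intro sym_operad_axioms.intro symm_ns_operad)
  fix n :: nat and f assume n: "1 \<le> n" and f: "f \<in> elems symm n"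
  have "(\<lambda>g. g) \<in> linear_maps (comp_space symm n) (comp_space symm n)"
    by (simp add: linear_maps_def)
  from symm_linear_eqI[OF n symm_perm_act_linear[OF n permutes_id] this _ f]
  show "perm_act symm n id f = f"
    using symm_perm_act_pure[OF n permutes_id] by simp
  fix \<sigma> \<rho> assume p: "\<sigma> permutes {1..n}" "\<rho> permutes {1..n}"
  note c = permutes_compose[OF p(2,1)]
  show "perm_act symm n (\<sigma> \<circ> \<rho>) f = perm_act symm n \<sigma> (perm_act symm n \<rho> f)"
    by (rule symm_linear_eqI[OF n symm_perm_act_linear[OF n c]
          linear_compose[OF symm_perm_act_linear[OF n p(2)] symm_perm_act_linear[OF n p(1)]] _ f])
      (simp add: symm_perm_act_pure[OF n] c p comp_assoc)
next
  fix k m n :: nat and \<sigma> \<rho> f g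
  assume k: "1 \<le> k" "k \<le> m" "1 \<le> n" and p: "\<sigma> permutes {1..m}" "\<rho> permutes {1..n}"
    and f: "f \<in> elems symm m" and g: "g \<in> elems symm n"
  have m: "1 \<le> m" "1 \<le> m + n - 1" using k by auto
  note b = permutes_bounds[OF p(1) k(1,2)]
  note q = perm_comp_permutes[OF p k]
  note A = symm_perm_act_linear[OF m(1) p(1)] symm_perm_act_linear[OF k(3) p(2)]
    symm_perm_act_linear[OF m(2) q]
  note L = symm_pcomp_linear_left and R = symm_pcomp_linear_right
  have pure: "pcomp symm m n (\<sigma> k) (perm_act symm m \<sigma> (pure_tensor P m E \<sigma>'))
        (perm_act symm n \<rho> (pure_tensor P n E' \<rho>'))
      = perm_act symm (m + n - 1) (perm_comp n k \<sigma> \<rho>)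
        (pcomp symm m n k (pure_tensor P m E \<sigma>') (pure_tensor P n E' \<rho>'))"
    if E: "E \<in> elems P m" "E' \<in> elems P n" and p': "\<sigma>' permutes {1..m}" "\<rho>' permutes {1..n}"
    for E E' \<sigma>' \<rho>'
  proof -
    define k' where "k' = perm_inv \<sigma>' k"
    have k': "1 \<le> k'" "k' \<le> m" "k = \<sigma>' k'" "\<sigma> k = (\<sigma> \<circ> \<sigma>') k'"
      using perm_inv_bounds[OF p'(1) k(1,2)] permutes_inverses(1)[OF p'(1)] by (auto simp: k'_def)
    note c = permutes_compose[OF p'(1) p(1)] permutes_compose[OF p'(2) p(2)]
    have "1 \<le> \<sigma>' k'" using k(1) k'(3) by simp
    then have "perm_comp n k \<sigma> \<rho> \<circ> perm_comp n k' \<sigma>' \<rho>' = perm_comp n k' (\<sigma> \<circ> \<sigma>') (\<rho> \<circ> \<rho>')"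
      using perm_comp_comp[OF permutes_inj[OF p(1)] permutes_inj[OF p'(1)] k'(1) _ k(3) p'(2), of \<rho>]
      by (simp only: k'(3))
    then show ?thesis
      unfolding symm_perm_act_pure[OF m(1) p(1) E(1)] symm_perm_act_pure[OF k(3) p(2) E(2)]
        symm_pcomp_pure[OF p' k'(1,2) k(3) E k'(3)]
        symm_pcomp_pure[OF c k'(1,2) k(3) E k'(4)]
        symm_perm_act_pure[OF m(2) q pcomp_closed[OF k'(1,2) k(3) E]]
      by simp
  qed
  note lin = linear_compose[OF A(1) L[OF b k(3) linear_closed[OF A(2)]]]
    linear_compose[OF L[OF k] A(3)] linear_compose[OF A(2) R[OF b k(3) linear_closed[OF A(1)]]]
    linear_compose[OF R[OF k] A(3)]
  show "pcomp symm m n (\<sigma> k) (perm_act symm m \<sigma> f) (perm_act symm n \<rho> g)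
      = perm_act symm (m + n - 1) (perm_comp n k \<sigma> \<rho>) (pcomp symm m n k f g)"
    by (rule symm_bilinear_eqI[where
          T = "\<lambda>f g. pcomp symm m n (\<sigma> k) (perm_act symm m \<sigma> f) (perm_act symm n \<rho> g)"
          and T' = "\<lambda>f g. perm_act symm (m + n - 1) (perm_comp n k \<sigma> \<rho>) (pcomp symm m n k f g)",
          OF m(1) k(3) _ _ _ _ pure f g]; (rule lin)?; assumption)
qed (rule symm_perm_act_linear)

end


section \<open>The symmetrization is an anticyclic operad\<close>

context ns_anticyclic_operad
begin

abbreviation act :: "nat \<Rightarrow> (nat \<Rightarrow> nat) \<Rightarrow> ((nat \<Rightarrow> nat) \<Rightarrow> 'a) \<Rightarrow> ((nat \<Rightarrow> nat) \<Rightarrow> 'a)" where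
  "act \<equiv> symmetrization_act \<tau>"

lemma tau_pow_mod:
  assumes "1 \<le> n" "E \<in> elems P n"
  shows "(\<tau> n ^^ (k mod (n + 1))) E = (\<tau> n ^^ k) E"
  by (rule funpow_mod_eq) (rule tau_order[OF assms])

lemma act_index:
  assumes \<rho>: "\<rho> permutes {1..n + 1}" and \<theta>: "\<theta> permutes {1..n}"
  defines "k \<equiv> n + 1 - perm_inv \<theta> (\<rho> (n + 1))"
  shows "k \<le> n" "perm_inv \<rho> \<circ> \<theta> \<circ> long_cycle n ^^ k permutes {1..n}"
proof -
  let ?v = "perm_inv \<theta> (\<rho> (n + 1))"
  have "1 \<le> \<rho> (n + 1)" "\<rho> (n + 1) \<le> n + 1" using permutes_bounds[OF \<rho>, of "n + 1"] by auto
  then have v: "1 \<le> ?v" "?v \<le> n + 1" using perm_inv_bounds[OF permutes_Suc[OF \<theta>]] by auto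
  then show k: "k \<le> n" by (simp add: k_def)
  have "(long_cycle n ^^ k) (n + 1) = ?v"
    unfolding k_def using v by (subst long_cycle_pow) auto
  then have "(perm_inv \<rho> \<circ> \<theta> \<circ> long_cycle n ^^ k) (n + 1) = n + 1"
    using permutes_inverses(1)[OF \<theta>] permutes_inverses(2)[OF \<rho>] by simp
  then show "perm_inv \<rho> \<circ> \<theta> \<circ> long_cycle n ^^ k permutes {1..n}"
    by (rule permutes_fix_last[OF permutes_compose[OF long_cycle_pow_permutes
          permutes_compose[OF permutes_Suc[OF \<theta>] permutes_inv[OF \<rho>]]]])
qed

lemma act_apply:
  "\<theta> permutes {1..n} \<Longrightarrow> act n \<rho> F \<theta> = (\<tau> n ^^ (n + 1 - perm_inv \<theta> (\<rho> (n + 1))))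
    (F (perm_inv \<rho> \<circ> \<theta> \<circ> long_cycle n ^^ (n + 1 - perm_inv \<theta> (\<rho> (n + 1)))))"
  by (simp add: symmetrization_act_def Let_def)

lemma symm_act_linear:
  assumes n: "1 \<le> n" and \<rho>: "\<rho> permutes {1..n + 1}"
  shows "act n \<rho> \<in> linear_maps (comp_space symm n) (comp_space symm n)"
proof (rule symm_linearI[OF n])
  fix \<theta> assume \<theta>: "\<theta> permutes {1..n}"
  show "(\<lambda>F. act n \<rho> F \<theta>) \<in> linear_maps (comp_space symm n) (comp_space P n)"
    unfolding act_apply[OF \<theta>]
    by (rule linear_compose[OF symm_eval_linear[OF act_index(2)[OF \<rho> \<theta>]]
          linear_funpow[OF tau_linear[OF n]]])
qed (simp add: symmetrization_act_def)

text \<open>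
  This describes the action completely: \<open>\<rho>\<close> times \<open>\<sigma>\<close> always factors as \<open>\<theta> c\<^sup>k\<close>. The exponent is
  not restricted to \<open>k \<le> n\<close>, so that factorizations can be composed.
\<close>

lemma act_pure:
  assumes n: "1 \<le> n" and \<rho>: "\<rho> permutes {1..n + 1}" and \<sigma>: "\<sigma> permutes {1..n}"
    and \<theta>: "\<theta> permutes {1..n}" and E: "E \<in> elems P n"
    and eq: "\<rho> \<circ> \<sigma> = \<theta> \<circ> long_cycle n ^^ k"
  shows "act n \<rho> (pure_tensor P n E \<sigma>) = pure_tensor P n ((\<tau> n ^^ k) E) \<theta>"
proof (rule symm_eqI)
  note T = linear_funpow[OF tau_linear[OF n]] and M = comp_space[OF n]
  show "act n \<rho> (pure_tensor P n E \<sigma>) \<in> elems symm n"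
    by (rule linear_closed[OF symm_act_linear[OF n \<rho>] pure_tensor_closed[OF n E]])
  show "pure_tensor P n ((\<tau> n ^^ k) E) \<theta> \<in> elems symm n"
    by (rule pure_tensor_closed[OF n tau_pow_closed[OF n E]])
  \<comment> \<open>both sides depend on \<open>k\<close> only modulo \<open>n + 1\<close>\<close>
  define k0 where "k0 = k mod (n + 1)"
  have "k0 < n + 1" unfolding k0_def by (rule mod_less_divisor) simp
  then have "k0 \<le> n" by simp
  moreover have "(\<tau> n ^^ k) E = (\<tau> n ^^ k0) E" "\<rho> \<circ> \<sigma> = \<theta> \<circ> long_cycle n ^^ k0"
    unfolding eq using tau_pow_mod[OF n E, of k] long_cycle_pow_mod[where n = n and k = k] by (auto simp: k0_def)
  ultimately have k0: "k0 \<le> n" "(\<tau> n ^^ k) E = (\<tau> n ^^ k0) E" "\<rho> \<circ> \<sigma> = \<theta> \<circ> long_cycle n ^^ k0" .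
  fix \<theta>' assume \<theta>': "\<theta>' permutes {1..n}"
  define k' where "k' = n + 1 - perm_inv \<theta>' (\<rho> (n + 1))"
  define \<sigma>' where "\<sigma>' = perm_inv \<rho> \<circ> \<theta>' \<circ> long_cycle n ^^ k'"
  have \<sigma>': "\<sigma>' permutes {1..n}" and k': "k' \<le> n"
    unfolding \<sigma>'_def k'_def by (rule act_index[OF \<rho> \<theta>'])+
  have iff: "\<sigma>' = \<sigma> \<longleftrightarrow> \<theta>' \<circ> long_cycle n ^^ k' = \<rho> \<circ> \<sigma>"
    unfolding \<sigma>'_def comp_assoc permutes_comp_inv_eq_iff[OF \<rho>] ..
  have "act n \<rho> (pure_tensor P n E \<sigma>) \<theta>' = (\<tau> n ^^ k') (if \<sigma>' = \<sigma> then E else \<zero>\<^bsub>comp_space P n\<^esub>)"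
    unfolding act_apply[OF \<theta>'] k'_def[symmetric] \<sigma>'_def[symmetric] pure_tensor_apply[OF \<sigma>'] ..
  also have "\<dots> = (if \<theta>' = \<theta> then (\<tau> n ^^ k) E else \<zero>\<^bsub>comp_space P n\<^esub>)"
  proof (cases "\<theta>' = \<theta>")
    case True
    have "(long_cycle n ^^ k0) (n + 1) = n + 1 - k0"
      using k0(1) by (subst long_cycle_pow) auto
    then have "\<rho> (n + 1) = \<theta> (n + 1 - k0)"
      using fun_cong[OF k0(3), of "n + 1"] permutes_last[OF \<sigma>] by simp
    then have "k' = k0" unfolding k'_def True using permutes_inverses(2)[OF \<theta>] k0(1) by simp
    then show ?thesis using True iff k0 by simp
  next
    case False
    then have "\<sigma>' \<noteq> \<sigma>"
      using permutes_decomp_unique(2)[OF \<theta>' \<theta> k' k0(1)] unfolding iff k0(3) by blast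
    then show ?thesis using False linear_zero[OF T M M] by simp
  qed
  also have "\<dots> = pure_tensor P n ((\<tau> n ^^ k) E) \<theta> \<theta>'"
    unfolding pure_tensor_apply[OF \<theta>'] ..
  finally show "act n \<rho> (pure_tensor P n E \<sigma>) \<theta>' = pure_tensor P n ((\<tau> n ^^ k) E) \<theta> \<theta>'" .
qed

text \<open>
  Let \<open>f = \<sigma> E\<close> and \<open>g = \<rho> E'\<close> with \<open>i = \<sigma>(k)\<close>, and let \<open>c \<sigma> = \<theta> c\<^sup>t\<close>. The long cycle is itself a
  \<open>perm_comp\<close>, so that \<open>c (f \<circ>\<^sub>i g)\<close> is \<open>\<theta>\<close> and \<open>\<rho>\<close> applied after the block rotation
  \<open>perm_comp n k (c\<^sup>t) id\<close>. As \<open>t \<noteq> k\<close>, the latter is a power of the long cycle.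
\<close>

lemma symm_act_pcomp_pure:
  assumes i: "2 \<le> i" "i \<le> m" "1 \<le> n" and E: "E \<in> elems P m" "E' \<in> elems P n"
    and p: "\<sigma> permutes {1..m}" "\<rho> permutes {1..n}"
  shows "act (m + n - 1) (long_cycle (m + n - 1))
      (pcomp symm m n i (pure_tensor P m E \<sigma>) (pure_tensor P n E' \<rho>))
    = pcomp symm m n (i - 1) (act m (long_cycle m) (pure_tensor P m E \<sigma>)) (pure_tensor P n E' \<rho>)"
proof -
  have m: "1 \<le> m" "1 \<le> i" "1 \<le> m + n - 1" using i by auto
  define k where "k = perm_inv \<sigma> i"
  define t where "t = perm_inv \<sigma> 1"
  have k: "1 \<le> k" "k \<le> m" "i = \<sigma> k" and t: "1 \<le> t" "t \<le> m" "\<sigma> t = 1"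
    using perm_inv_bounds[OF p(1) m(2) i(2)] perm_inv_bounds[OF p(1) order_refl m(1)]
      permutes_inverses(1)[OF p(1)] by (auto simp: k_def t_def)
  have tk: "t \<noteq> k" using k t i by auto
  obtain \<theta> where \<theta>: "\<theta> permutes {1..m}" "long_cycle m \<circ> \<sigma> = \<theta> \<circ> long_cycle m ^^ t"
    using long_cycle_decomp[OF p(1) t] .
  define k2 where "k2 = (long_cycle m ^^ t) k"
  have k2: "k2 = (if t < k then k - t else k + m + 1 - t)"
    unfolding k2_def using k t by (subst long_cycle_pow) auto
  have k2b: "1 \<le> k2" "k2 \<le> m" using k2 k t tk by (auto split: if_splits)
  have pos: "i - 1 = \<theta> k2"
    using fun_cong[OF \<theta>(2), of k] k(3) i by (simp add: k2_def long_cycle_def)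
  \<comment> \<open>the number of steps by which the composition rotates while \<open>E\<close> rotates by \<open>t\<close>\<close>
  define K where "K = (if t < k then t else t + n - 1)"
  have rot: "perm_comp n k (long_cycle m ^^ t) id = long_cycle (m + n - 1) ^^ K"
    using long_cycle_pow_before_block[of t k m n] long_cycle_pow_after_block[of k t m n] k t tk i
    by (auto simp: K_def)
  have tau: "(\<tau> (m + n - 1) ^^ K) (pcomp P m n k E E') = pcomp P m n k2 ((\<tau> m ^^ t) E) E'"
  proof (cases "t < k")
    case True
    then show ?thesis using tau_pow_comp[OF True k(2) i(3) E] by (simp add: K_def k2)
  next
    case False
    then have kt: "k < t" using tk by simp
    have K: "K = (t - k - 1) + (k + n)" using kt by (simp add: K_def)
    have "(\<tau> (m + n - 1) ^^ (k + n)) (pcomp P m n k E E')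
        = pcomp P m n m ((\<tau> m ^^ (k + 1)) E) E'"
      using tau_pow_comp_across[OF k(1,2) i(3) E] tau_order[OF i(3) E(2)] by simp
    then have "(\<tau> (m + n - 1) ^^ K) (pcomp P m n k E E')
        = (\<tau> (m + n - 1) ^^ (t - k - 1)) (pcomp P m n m ((\<tau> m ^^ (k + 1)) E) E')"
      unfolding K funpow_add by simp
    also have "\<dots> = pcomp P m n (m - (t - k - 1)) ((\<tau> m ^^ (t - k - 1)) ((\<tau> m ^^ (k + 1)) E)) E'"
      by (rule tau_pow_comp[OF _ order_refl i(3) tau_pow_closed[OF m(1) E(1)] E(2)])
        (use kt t in auto)
    also have "(\<tau> m ^^ (t - k - 1)) ((\<tau> m ^^ (k + 1)) E) = (\<tau> m ^^ t) E"
    proof -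
      have "(\<tau> m ^^ (t - k - 1)) ((\<tau> m ^^ (k + 1)) E) = (\<tau> m ^^ (t - k - 1 + (k + 1))) E"
        unfolding funpow_add by simp
      then show ?thesis using kt by simp
    qed
    also have "m - (t - k - 1) = k2" using kt t k by (simp add: k2)
    finally show ?thesis .
  qed
  note pc = perm_comp_permutes[OF p k(1,2) i(3)] perm_comp_permutes[OF \<theta>(1) p(2) k2b i(3)]
  have inj: "inj (long_cycle m)" "inj (long_cycle m ^^ t)"
    by (rule permutes_inj[OF long_cycle_permutes] permutes_inj[OF long_cycle_pow_permutes])+
  have "long_cycle (m + n - 1) \<circ> perm_comp n k \<sigma> \<rho>
      = perm_comp n (\<sigma> k) (long_cycle m) id \<circ> perm_comp n k \<sigma> \<rho>"
    unfolding k(3)[symmetric] long_cycle_eq_perm_comp[OF i] ..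
  also have "\<dots> = perm_comp n k (long_cycle m \<circ> \<sigma>) (id \<circ> \<rho>)"
    using perm_comp_comp[OF inj(1) permutes_inj[OF p(1)] k(1) _ i(3) p(2)] k(3) m(2) by simp
  also have "\<dots> = perm_comp n k (\<theta> \<circ> long_cycle m ^^ t) (\<rho> \<circ> id)"
    by (simp add: \<theta>(2))
  also have "\<dots> = perm_comp n k2 \<theta> \<rho> \<circ> perm_comp n k (long_cycle m ^^ t) id"
    using perm_comp_comp[OF permutes_inj[OF \<theta>(1)] inj(2) k(1) _ i(3) permutes_id,
        folded k2_def, OF k2b(1)] by simp
  finally have eq: "long_cycle (m + n - 1) \<circ> perm_comp n k \<sigma> \<rho>
      = perm_comp n k2 \<theta> \<rho> \<circ> long_cycle (m + n - 1) ^^ K"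
    unfolding rot .
  show ?thesis
    unfolding symm_pcomp_pure[OF p k(1,2) i(3) E k(3)]
      act_pure[OF m(1) long_cycle_permutes p(1) \<theta>(1) E(1) \<theta>(2)]
      symm_pcomp_pure[OF \<theta>(1) p(2) k2b i(3) tau_pow_closed[OF m(1) E(1)] E(2) pos]
      act_pure[OF m(3) long_cycle_permutes pc pcomp_closed[OF k(1,2) i(3) E] eq] tau ..
qed

text \<open>
  The element \<open>E'\<close> becomes the outer operation. Rotating \<open>\<sigma>\<close> and \<open>\<rho>\<close> accounts for the powers
  \<open>\<tau>\<^sup>k\<close> and \<open>\<tau>\<^sup>u\<close>, where \<open>\<sigma>(k) = \<rho>(u) = 1\<close>, and the composition is rotated by \<open>k - 1 + u\<close> steps.
\<close>

lemma symm_act_pcomp_1_pure: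
  assumes mn: "1 \<le> m" "1 \<le> n" and E: "E \<in> elems P m" "E' \<in> elems P n"
    and p: "\<sigma> permutes {1..m}" "\<rho> permutes {1..n}"
  shows "act (m + n - 1) (long_cycle (m + n - 1))
      (pcomp symm m n 1 (pure_tensor P m E \<sigma>) (pure_tensor P n E' \<rho>))
    = \<ominus>\<^bsub>comp_space symm (m + n - 1)\<^esub> pcomp symm n m n
        (act n (long_cycle n) (pure_tensor P n E' \<rho>)) (act m (long_cycle m) (pure_tensor P m E \<sigma>))"
proof -
  have N: "1 \<le> m + n - 1" "n + m - 1 = m + n - 1" using mn by auto
  define k where "k = perm_inv \<sigma> 1"
  define u where "u = perm_inv \<rho> 1"
  have k: "1 \<le> k" "k \<le> m" "\<sigma> k = 1" and u: "1 \<le> u" "u \<le> n" "\<rho> u = 1"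
    using perm_inv_bounds[OF p(1) order_refl mn(1)] perm_inv_bounds[OF p(2) order_refl mn(2)]
      permutes_inverses(1)[OF p(1)] permutes_inverses(1)[OF p(2)] by (auto simp: k_def u_def)
  obtain \<theta> where \<theta>: "\<theta> permutes {1..m}" "long_cycle m \<circ> \<sigma> = \<theta> \<circ> long_cycle m ^^ k"
    using long_cycle_decomp[OF p(1) k] .
  obtain \<theta>' where \<theta>': "\<theta>' permutes {1..n}" "long_cycle n \<circ> \<rho> = \<theta>' \<circ> long_cycle n ^^ u"
    using long_cycle_decomp[OF p(2) u] .
  let ?w = "n + 1 - u"
  have w: "1 \<le> ?w" "?w \<le> n" using u by auto
  have "(long_cycle n ^^ u) (n + 1) = ?w" using u by (subst long_cycle_pow) auto
  then have pos: "n = \<theta>' ?w"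
    using fun_cong[OF \<theta>'(2), of "n + 1"] permutes_last[OF p(2)] mn by (simp add: long_cycle_def)
  note eq = long_cycle_swap[OF p \<theta>(1) \<theta>'(1) mn k u \<theta>(2) \<theta>'(2)]
  note pc = perm_comp_permutes[OF p k(1,2) mn(2)] perm_comp_permutes[OF \<theta>'(1) \<theta>(1) w mn(1), unfolded N(2)]
  let ?E = "(\<tau> m ^^ k) E" and ?E' = "(\<tau> n ^^ u) E'"
  note cl = tau_pow_closed[OF mn(1) E(1), of k] tau_pow_closed[OF mn(2) E(2), of u]
  have "act (m + n - 1) (long_cycle (m + n - 1))
      (pcomp symm m n 1 (pure_tensor P m E \<sigma>) (pure_tensor P n E' \<rho>))
    = pure_tensor P (m + n - 1) (\<ominus>\<^bsub>comp_space P (m + n - 1)\<^esub> pcomp P n m ?w ?E' ?E)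
        (perm_comp m ?w \<theta>' \<theta>)"
    unfolding symm_pcomp_pure[OF p k(1,2) mn(2) E k(3)[symmetric]]
      act_pure[OF N(1) long_cycle_permutes pc pcomp_closed[OF k(1,2) mn(2) E] eq]
      tau_pow_comp_block[OF u(1,2) k(1,2) E] ..
  also have "\<dots> = \<ominus>\<^bsub>comp_space symm (m + n - 1)\<^esub>
      pure_tensor P (m + n - 1) (pcomp P n m ?w ?E' ?E) (perm_comp m ?w \<theta>' \<theta>)"
    using linear_minus[OF pure_tensor_linear[OF N(1)] comp_space[OF N(1)] symm_module[OF N(1)]
        pcomp_closed[OF w mn(1) cl(2,1), unfolded N(2)]] .
  also have "pure_tensor P (m + n - 1) (pcomp P n m ?w ?E' ?E) (perm_comp m ?w \<theta>' \<theta>)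
      = pcomp symm n m n (act n (long_cycle n) (pure_tensor P n E' \<rho>))
          (act m (long_cycle m) (pure_tensor P m E \<sigma>))"
    unfolding act_pure[OF mn(1) long_cycle_permutes p(1) \<theta>(1) E(1) \<theta>(2)]
      act_pure[OF mn(2) long_cycle_permutes p(2) \<theta>'(1) E(2) \<theta>'(2)]
      symm_pcomp_pure[OF \<theta>'(1) \<theta>(1) w mn(1) cl(2,1) pos] N(2) ..
  finally show ?thesis .
qed

lemma symm_anticyclic_operad: "anticyclic_operad symm act"
proof (intro anticyclic_operad.intro anticyclic_operad_axioms.intro symm_sym_operad)
  fix n :: nat and f assume n: "1 \<le> n" and f: "f \<in> elems symm n"
  have idl: "(\<lambda>g. g) \<in> linear_maps (comp_space symm n) (comp_space symm n)"
    by (simp add: linear_maps_def)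
  have "act n id f = (\<lambda>g. g) f"
  proof (rule symm_linear_eqI[OF n symm_act_linear[OF n permutes_id] idl _ f])
    fix E \<sigma> assume *: "E \<in> elems P n" "\<sigma> permutes {1..n}"
    show "act n id (pure_tensor P n E \<sigma>) = pure_tensor P n E \<sigma>"
      using act_pure[OF n permutes_id *(2,2,1), of 0] by (simp add: id_def comp_def)
  qed
  then show "act n id f = f" .
  show "act n \<sigma> f = perm_act symm n \<sigma> f" if \<sigma>: "\<sigma> permutes {1..n}" for \<sigma>
  proof (rule symm_linear_eqI[OF n symm_act_linear[OF n permutes_Suc[OF \<sigma>]]
        symm_perm_act_linear[OF n \<sigma>] _ f])
    fix E \<sigma>' assume *: "E \<in> elems P n" "\<sigma>' permutes {1..n}"
    show "act n \<sigma> (pure_tensor P n E \<sigma>') = perm_act symm n \<sigma> (pure_tensor P n E \<sigma>')"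
      using act_pure[OF n permutes_Suc[OF \<sigma>] *(2) permutes_compose[OF *(2) \<sigma>] *(1), of 0]
        symm_perm_act_pure[OF n \<sigma> *(1), of \<sigma>'] by (simp add: id_def comp_def)
  qed
  fix \<sigma> \<rho> assume p: "\<sigma> permutes {1..n + 1}" "\<rho> permutes {1..n + 1}"
  note c = permutes_compose[OF p(2,1)]
  show "act n (\<sigma> \<circ> \<rho>) f = act n \<sigma> (act n \<rho> f)"
  proof (rule symm_linear_eqI[OF n symm_act_linear[OF n c]
        linear_compose[OF symm_act_linear[OF n p(2)] symm_act_linear[OF n p(1)]] _ f])
    fix E \<sigma>' assume *: "E \<in> elems P n" "\<sigma>' permutes {1..n}"
    obtain \<theta> k where \<theta>: "\<theta> permutes {1..n}" "\<rho> \<circ> \<sigma>' = \<theta> \<circ> long_cycle n ^^ k"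
      using permutes_decomp[OF permutes_compose[OF permutes_Suc[OF *(2)] p(2)]] by metis
    obtain \<theta>' k' where \<theta>': "\<theta>' permutes {1..n}" "\<sigma> \<circ> \<theta> = \<theta>' \<circ> long_cycle n ^^ k'"
      using permutes_decomp[OF permutes_compose[OF permutes_Suc[OF \<theta>(1)] p(1)]] by metis
    have "\<sigma> \<circ> \<rho> \<circ> \<sigma>' = (\<sigma> \<circ> \<theta>) \<circ> long_cycle n ^^ k" unfolding comp_assoc \<theta>(2) ..
    also have "\<dots> = \<theta>' \<circ> long_cycle n ^^ (k' + k)" unfolding \<theta>'(2) comp_assoc funpow_add ..
    finally have eq: "\<sigma> \<circ> \<rho> \<circ> \<sigma>' = \<theta>' \<circ> long_cycle n ^^ (k' + k)" .
    show "act n (\<sigma> \<circ> \<rho>) (pure_tensor P n E \<sigma>') = act n \<sigma> (act n \<rho> (pure_tensor P n E \<sigma>'))"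
      unfolding act_pure[OF n p(2) *(2) \<theta>(1) *(1) \<theta>(2)]
        act_pure[OF n p(1) \<theta>(1) \<theta>'(1) tau_pow_closed[OF n *(1)] \<theta>'(2)]
        act_pure[OF n c *(2) \<theta>'(1) *(1) eq]
      by (simp add: funpow_add)
  qed
next
  have "long_cycle 1 \<circ> id = id \<circ> long_cycle 1 ^^ 1" by (simp add: funpow_1)
  from act_pure[OF order_refl long_cycle_permutes permutes_id permutes_id unit_closed this]
  show "act 1 (long_cycle 1) (op_unit symm) = \<ominus>\<^bsub>comp_space symm 1\<^esub> op_unit symm"
    unfolding symm_unit funpow_1 tau_unit
    using linear_minus[OF pure_tensor_linear comp_space symm_module unit_closed] by simp
next
  fix i m n :: nat and f g
  assume i: "2 \<le> i" "i \<le> m" "1 \<le> n" and f: "f \<in> elems symm m" and g: "g \<in> elems symm n"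
  have m: "1 \<le> m" "1 \<le> i" "1 \<le> i - 1" "i - 1 \<le> m" "1 \<le> m + n - 1" using i by auto
  note A = symm_act_linear[OF _ long_cycle_permutes]
  note L = symm_pcomp_linear_left and R = symm_pcomp_linear_right
  note lin = linear_compose[OF L[OF m(2) i(2,3)] A[OF m(5)]]
    linear_compose[OF A[OF m(1)] L[OF m(3,4) i(3)]] linear_compose[OF R[OF m(2) i(2,3)] A[OF m(5)]]
    R[OF m(3,4) i(3) linear_closed[OF A[OF m(1)]]]
  show "act (m + n - 1) (long_cycle (m + n - 1)) (pcomp symm m n i f g)
      = pcomp symm m n (i - 1) (act m (long_cycle m) f) g"
    by (rule symm_bilinear_eqI[where
          T = "\<lambda>f g. act (m + n - 1) (long_cycle (m + n - 1)) (pcomp symm m n i f g)"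
          and T' = "\<lambda>f g. pcomp symm m n (i - 1) (act m (long_cycle m) f) g",
          OF m(1) i(3) _ _ _ _ symm_act_pcomp_pure[OF i] f g]; (rule lin)?; assumption)
next
  fix m n :: nat and f g
  assume mn: "1 \<le> m" "1 \<le> n" and f: "f \<in> elems symm m" and g: "g \<in> elems symm n"
  have N: "1 \<le> m + n - 1" "n + m - 1 = m + n - 1" using mn by auto
  note A = symm_act_linear[OF _ long_cycle_permutes]
  note L = symm_pcomp_linear_left and R = symm_pcomp_linear_right
  note L' = L[OF mn(2) order_refl mn(1), unfolded N(2)]
    and R' = R[OF mn(2) order_refl mn(1), unfolded N(2)]
  note neg = linear_uminus[OF _ symm_module[OF N(1)]]
  note lin = linear_compose[OF L[OF order_refl mn] A[OF N(1)]]
    neg[OF linear_compose[OF A[OF mn(1)] R'[OF linear_closed[OF A[OF mn(2)]]]]]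
    linear_compose[OF R[OF order_refl mn] A[OF N(1)]]
    neg[OF linear_compose[OF A[OF mn(2)] L'[OF linear_closed[OF A[OF mn(1)]]]]]
  show "act (m + n - 1) (long_cycle (m + n - 1)) (pcomp symm m n 1 f g)
      = \<ominus>\<^bsub>comp_space symm (m + n - 1)\<^esub> pcomp symm n m n (act n (long_cycle n) g)
          (act m (long_cycle m) f)"
    by (rule symm_bilinear_eqI[where
          T = "\<lambda>f g. act (m + n - 1) (long_cycle (m + n - 1)) (pcomp symm m n 1 f g)"
          and T' = "\<lambda>f g. \<ominus>\<^bsub>comp_space symm (m + n - 1)\<^esub> pcomp symm n m n (act n (long_cycle n) g)
            (act m (long_cycle m) f)",
          OF mn _ _ _ _ symm_act_pcomp_1_pure[OF mn] f g]; (rule lin)?; assumption)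
qed (rule symm_act_linear)

end


section \<open>Quotients of anticyclic operads\<close>

lemma sym_operad_surjection:
  assumes s: "operad_surjection P Q \<pi>" and P: "sym_operad P"
    and perm: "\<And>n \<sigma> f. 1 \<le> n \<Longrightarrow> \<sigma> permutes {1..n} \<Longrightarrow> f \<in> elems P n \<Longrightarrow>
      perm_act Q n \<sigma> (\<pi> n f) = \<pi> n (perm_act P n \<sigma> f)"
  shows "sym_operad_hom P Q \<pi>"
proof -
  interpret operad_surjection P Q \<pi> by (rule s)
  interpret P: sym_operad P by (rule P)
  have cl: "perm_act P n \<sigma> f \<in> elems P n" if "1 \<le> n" "\<sigma> permutes {1..n}" "f \<in> elems P n" for n \<sigma> f
    by (rule linear_closed[OF P.perm_act_linear[OF that(1,2)] that(3)])
  have Q: "sym_operad Q"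
  proof (intro sym_operad.intro sym_operad_axioms.intro target_ns_operad)
    fix n :: nat and \<sigma> :: "nat \<Rightarrow> nat" assume n: "1 \<le> n" and \<sigma>: "\<sigma> permutes {1..n}"
    show "perm_act Q n \<sigma> \<in> linear_maps (comp_space Q n) (comp_space Q n)"
      by (rule linear_from_source[OF n P.perm_act_linear[OF n \<sigma>] perm[OF n \<sigma>]])
    fix \<rho> :: "nat \<Rightarrow> nat" and f assume \<rho>: "\<rho> permutes {1..n}" and "f \<in> elems Q n"
    then obtain f' where f: "f' \<in> elems P n" "f = \<pi> n f'" using n by (auto simp: proj_surj)
    show "perm_act Q n (\<sigma> \<circ> \<rho>) f = perm_act Q n \<sigma> (perm_act Q n \<rho> f)"
      unfolding f(2) perm[OF n permutes_compose[OF \<rho> \<sigma>] f(1)] perm[OF n \<rho> f(1)]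
        perm[OF n \<sigma> cl[OF n \<rho> f(1)]] P.perm_act_comp[OF n \<sigma> \<rho> f(1)] ..
  next
    fix n :: nat and f assume n: "1 \<le> n" and "f \<in> elems Q n"
    then obtain f' where f: "f' \<in> elems P n" "f = \<pi> n f'" by (auto simp: proj_surj)
    show "perm_act Q n id f = f"
      unfolding f(2) perm[OF n permutes_id f(1)] P.perm_act_id[OF n f(1)] ..
  next
    fix k m n :: nat and \<sigma> \<rho> :: "nat \<Rightarrow> nat" and f g
    assume k: "1 \<le> k" "k \<le> m" "1 \<le> n" and p: "\<sigma> permutes {1..m}" "\<rho> permutes {1..n}"
      and "f \<in> elems Q m" "g \<in> elems Q n"
    moreover have m: "1 \<le> m" "1 \<le> m + n - 1" using k by auto
    ultimately obtain f' g' where f: "f' \<in> elems P m" "f = \<pi> m f'" and g: "g' \<in> elems P n" "g = \<pi> n g'"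
      by (auto simp: proj_surj)
    note b = permutes_bounds[OF p(1) k(1,2)]
    show "pcomp Q m n (\<sigma> k) (perm_act Q m \<sigma> f) (perm_act Q n \<rho> g)
        = perm_act Q (m + n - 1) (perm_comp n k \<sigma> \<rho>) (pcomp Q m n k f g)"
      unfolding f(2) g(2) perm[OF m(1) p(1) f(1)] perm[OF k(3) p(2) g(1)]
        proj_pcomp[OF b k(3) cl[OF m(1) p(1) f(1)] cl[OF k(3) p(2) g(1)]]
        proj_pcomp[OF k f(1) g(1)]
        perm[OF m(2) perm_comp_permutes[OF p k] pcomp_closed[OF k f(1) g(1)]]
        P.equivariant[OF k p f(1) g(1)] ..
  qed
  show ?thesis
    by (intro sym_operad_hom.intro sym_operad_hom_axioms.intro P Q proj_linear
        proj_unit[symmetric] proj_pcomp[symmetric] perm[symmetric])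
qed

lemma anticyclic_operad_surjection:
  assumes s: "operad_surjection P Q \<pi>" and hom: "sym_operad_hom P Q \<pi>"
    and P: "anticyclic_operad P A"
    and act: "\<And>n \<sigma> f. 1 \<le> n \<Longrightarrow> \<sigma> permutes {1..n + 1} \<Longrightarrow> f \<in> elems P n \<Longrightarrow>
      B n \<sigma> (\<pi> n f) = \<pi> n (A n \<sigma> f)"
  shows "anticyclic_operad_hom P A Q B \<pi>"
proof -
  interpret operad_surjection P Q \<pi> by (rule s)
  interpret H: sym_operad_hom P Q \<pi> by (rule hom)
  interpret P: anticyclic_operad P A by (rule P)
  have cl: "A n \<sigma> f \<in> elems P n" if "1 \<le> n" "\<sigma> permutes {1..n + 1}" "f \<in> elems P n" for n \<sigma> f
    by (rule linear_closed[OF P.act_linear[OF that(1,2)] that(3)])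
  have Q: "anticyclic_operad Q B"
  proof (intro anticyclic_operad.intro anticyclic_operad_axioms.intro)
    show "sym_operad Q" by (rule H.target.sym_operad_axioms)
  next
    fix n :: nat and \<sigma> :: "nat \<Rightarrow> nat" assume n: "1 \<le> n" and \<sigma>: "\<sigma> permutes {1..n + 1}"
    show "B n \<sigma> \<in> linear_maps (comp_space Q n) (comp_space Q n)"
      by (rule linear_from_source[OF n P.act_linear[OF n \<sigma>] act[OF n \<sigma>]])
    fix \<rho> :: "nat \<Rightarrow> nat" and f assume \<rho>: "\<rho> permutes {1..n + 1}" and "f \<in> elems Q n"
    then obtain f' where f: "f' \<in> elems P n" "f = \<pi> n f'" using n by (auto simp: proj_surj)
    show "B n (\<sigma> \<circ> \<rho>) f = B n \<sigma> (B n \<rho> f)"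
      unfolding f(2) act[OF n permutes_compose[OF \<rho> \<sigma>] f(1)] act[OF n \<rho> f(1)]
        act[OF n \<sigma> cl[OF n \<rho> f(1)]] P.act_comp[OF n \<sigma> \<rho> f(1)] ..
  next
    fix n :: nat and f assume n: "1 \<le> n" and "f \<in> elems Q n"
    then obtain f' where f: "f' \<in> elems P n" "f = \<pi> n f'" by (auto simp: proj_surj)
    show "B n id f = f"
      unfolding f(2) act[OF n permutes_id f(1)] P.act_id[OF n f(1)] ..
    show "B n \<sigma> f = perm_act Q n \<sigma> f" if \<sigma>: "\<sigma> permutes {1..n}" for \<sigma>
      unfolding f(2) act[OF n permutes_Suc[OF \<sigma>] f(1)] P.act_extends[OF n \<sigma> f(1)]
        H.hom_perm_act[OF n \<sigma> f(1)] ..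
  next
    have "B 1 (long_cycle 1) (op_unit Q) = \<pi> 1 (\<ominus>\<^bsub>comp_space P 1\<^esub> op_unit P)"
      unfolding proj_unit act[OF order_refl long_cycle_permutes unit_closed] P.cycle_unit ..
    also have "\<dots> = \<ominus>\<^bsub>comp_space Q 1\<^esub> op_unit Q"
      unfolding proj_unit by (rule proj_minus[OF order_refl unit_closed])
    finally show "B 1 (long_cycle 1) (op_unit Q) = \<ominus>\<^bsub>comp_space Q 1\<^esub> op_unit Q" .
  next
    fix i m n :: nat and f g
    assume i: "2 \<le> i" "i \<le> m" "1 \<le> n" and "f \<in> elems Q m" "g \<in> elems Q n"
    moreover have m: "1 \<le> m" "1 \<le> m + n - 1" "1 \<le> i" "1 \<le> i - 1" "i - 1 \<le> m" using i by auto
    ultimately obtain f' g' where f: "f' \<in> elems P m" "f = \<pi> m f'" and g: "g' \<in> elems P n" "g = \<pi> n g'"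
      by (auto simp: proj_surj)
    show "B (m + n - 1) (long_cycle (m + n - 1)) (pcomp Q m n i f g)
        = pcomp Q m n (i - 1) (B m (long_cycle m) f) g"
      unfolding f(2) g(2) proj_pcomp[OF m(3) i(2,3) f(1) g(1)]
        act[OF m(2) long_cycle_permutes pcomp_closed[OF m(3) i(2,3) f(1) g(1)]]
        act[OF m(1) long_cycle_permutes f(1)]
        proj_pcomp[OF m(4,5) i(3) cl[OF m(1) long_cycle_permutes f(1)] g(1)]
        P.cycle_pcomp[OF i f(1) g(1)] ..
  next
    fix m n :: nat and f g
    assume mn: "1 \<le> m" "1 \<le> n" and "f \<in> elems Q m" "g \<in> elems Q n"
    then obtain f' g' where f: "f' \<in> elems P m" "f = \<pi> m f'" and g: "g' \<in> elems P n" "g = \<pi> n g'"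
      by (auto simp: proj_surj)
    have N: "1 \<le> m + n - 1" "n + m - 1 = m + n - 1" using mn by auto
    note c = cl[OF mn(1) long_cycle_permutes f(1)] cl[OF mn(2) long_cycle_permutes g(1)]
    have "B (m + n - 1) (long_cycle (m + n - 1)) (pcomp Q m n 1 f g)
        = \<pi> (m + n - 1) (\<ominus>\<^bsub>comp_space P (m + n - 1)\<^esub>
            pcomp P n m n (A n (long_cycle n) g') (A m (long_cycle m) f'))"
      unfolding f(2) g(2) proj_pcomp[OF order_refl mn f(1) g(1)]
        act[OF N(1) long_cycle_permutes pcomp_closed[OF order_refl mn f(1) g(1)]]
        P.cycle_pcomp_1[OF mn f(1) g(1)] ..
    also have "\<dots> = \<ominus>\<^bsub>comp_space Q (m + n - 1)\<^esub>
        \<pi> (m + n - 1) (pcomp P n m n (A n (long_cycle n) g') (A m (long_cycle m) f'))"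
      by (rule proj_minus[OF N(1) pcomp_closed[OF mn(2) order_refl mn(1) c(2,1), unfolded N(2)]])
    also have "\<pi> (m + n - 1) (pcomp P n m n (A n (long_cycle n) g') (A m (long_cycle m) f'))
        = pcomp Q n m n (B n (long_cycle n) g) (B m (long_cycle m) f)"
      unfolding f(2) g(2) act[OF mn(1) long_cycle_permutes f(1)]
        act[OF mn(2) long_cycle_permutes g(1)]
      by (rule proj_pcomp[OF mn(2) order_refl mn(1) c(2,1), unfolded N(2), symmetric])
    finally show "B (m + n - 1) (long_cycle (m + n - 1)) (pcomp Q m n 1 f g)
        = \<ominus>\<^bsub>comp_space Q (m + n - 1)\<^esub> pcomp Q n m n (B n (long_cycle n) g) (B m (long_cycle m) f)" .
  qed
  show ?thesis
    by (intro anticyclic_operad_hom.intro anticyclic_operad_hom_axioms.intro hom P Q act[symmetric])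
qed

lemma sym_operad_idealD:
  assumes "sym_operad_ideal P I"
  shows "operad_ideal P I"
    and "1 \<le> n \<Longrightarrow> \<sigma> permutes {1..n} \<Longrightarrow> f \<in> I n \<Longrightarrow> perm_act P n \<sigma> f \<in> I n"
  using assms unfolding sym_operad_ideal_def by blast+

lemma sym_operad_idealI:
  assumes "operad_ideal P I"
    and "\<And>n \<sigma> f. 1 \<le> n \<Longrightarrow> \<sigma> permutes {1..n} \<Longrightarrow> f \<in> I n \<Longrightarrow> perm_act P n \<sigma> f \<in> I n"
  shows "sym_operad_ideal P I"
  using assms unfolding sym_operad_ideal_def by blast

lemma (in sym_operad) sym_operad_ideal_generated:
  assumes S: "\<And>n. 1 \<le> n \<Longrightarrow> S n \<subseteq> elems P n"
  shows "sym_operad_ideal P (ideal_generated (sym_operad_ideal P) S)"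
proof -
  let ?J = "\<lambda>n. if n = 0 then UNIV else elems P n"
  have J: "sym_operad_ideal P ?J" "\<And>k. S k \<subseteq> ?J k"
    using S by (auto intro!: sym_operad_idealI operad_ideal_improper linear_closed[OF perm_act_linear])
  show ?thesis
  proof (rule sym_operad_idealI)
    show "operad_ideal P (ideal_generated (sym_operad_ideal P) S)"
      by (rule operad_ideal_generated[where is_ideal = "sym_operad_ideal P" and S = S and ?J0.0 = ?J,
            OF sym_operad_idealD(1) J])
    fix n :: nat and \<sigma> f
    assume *: "1 \<le> n" "\<sigma> permutes {1..n}" "f \<in> ideal_generated (sym_operad_ideal P) S n"
    show "perm_act P n \<sigma> f \<in> ideal_generated (sym_operad_ideal P) S n"
    proof (rule ideal_generatedI)
      fix I assume I: "sym_operad_ideal P I" "\<And>k. S k \<subseteq> I k"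
      then have "f \<in> I n" using ideal_generated_least[of "sym_operad_ideal P" I S, OF I] *(3) by blast
      then show "perm_act P n \<sigma> f \<in> I n" by (rule sym_operad_idealD(2)[OF I(1) *(1,2)])
    qed
  qed
qed

text \<open>
  A generated ideal is stable under the large symmetric groups as soon as the orbits of its
  generators lie in it: the elements whose orbit stays in the ideal form an ideal. Closure under
  composition is an induction on the power of the long cycle, since one application of the cycle
  turns a composition into another one of rotated elements.
\<close>

lemma (in anticyclic_operad) act_stable_ideal:
  fixes S
  defines "I \<equiv> ideal_generated (sym_operad_ideal P) S"
  assumes S: "\<And>n. 1 \<le> n \<Longrightarrow> S n \<subseteq> elems P n"
    and act_S: "\<And>n \<sigma> f. 1 \<le> n \<Longrightarrow> \<sigma> permutes {1..n + 1} \<Longrightarrow> f \<in> S n \<Longrightarrow> A n \<sigma> f \<in> I n"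
    and n: "1 \<le> n" and \<sigma>: "\<sigma> permutes {1..n + 1}" and f: "f \<in> I n"
  shows "A n \<sigma> f \<in> I n"
proof -
  have sI: "sym_operad_ideal P I"
    unfolding I_def by (rule sym_operad_ideal_generated[OF S])
  note I = sym_operad_idealD(1)[OF sI]
  have IP: "f \<in> elems P n" if "1 \<le> n" "f \<in> I n" for f n
    using submodule_subset[OF comp_space operad_idealD(1)[OF I]] that by blast
  have cl: "A n \<sigma> f \<in> elems P n" if "1 \<le> n" "\<sigma> permutes {1..n + 1}" "f \<in> elems P n" for n \<sigma> f
    by (rule linear_closed[OF act_linear[OF that(1,2)] that(3)])
  define J where
    "J n = {f \<in> I n. 1 \<le> n \<longrightarrow> (\<forall>\<sigma>. \<sigma> permutes {1..n + 1} \<longrightarrow> A n \<sigma> f \<in> I n)}" for n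
  have JI: "f \<in> I n" if "f \<in> J n" for f n
    using that by (simp add: J_def)
  have J_act: "A n \<sigma> f \<in> J n" if n: "1 \<le> n" and \<sigma>: "\<sigma> permutes {1..n + 1}" and f: "f \<in> J n" for n \<sigma> f
  proof -
    have "A n \<rho> (A n \<sigma> f) \<in> I n" if \<rho>: "\<rho> permutes {1..n + 1}" for \<rho>
      using f n permutes_compose[OF \<sigma> \<rho>] act_comp[OF n \<rho> \<sigma> IP[OF n JI[OF f]]]
      by (auto simp: J_def)
    then show ?thesis using f n \<sigma> by (simp add: J_def)
  qed
  have comp_I: "pcomp P m n i f g \<in> I (m + n - 1)"
    if "1 \<le> i" "i \<le> m" "1 \<le> n" "f \<in> elems P m" "g \<in> elems P n" "f \<in> J m \<or> g \<in> J n" for i m n f g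
    using that operad_idealD(2,3)[OF I that(1-3)] JI by blast
  have cycle_I: "A (m + n - 1) (long_cycle (m + n - 1) ^^ k) (pcomp P m n i f g) \<in> I (m + n - 1)"
    if "1 \<le> i" "i \<le> m" "1 \<le> n" "f \<in> elems P m" "g \<in> elems P n" "f \<in> J m \<or> g \<in> J n" for k i m n f g
    using that
  proof (induction k arbitrary: i m n f g)
    case 0
    have N: "1 \<le> m + n - 1" using 0 by auto
    show ?case
      using act_id[OF N pcomp_closed[OF 0(1-5)]] comp_I[OF 0] by (simp add: id_def)
  next
    case (Suc k)
    note * = Suc.prems
    have m: "1 \<le> m" and N: "1 \<le> m + n - 1" "n + m - 1 = m + n - 1" using * by auto
    note cyc = long_cycle_permutes long_cycle_pow_permutes
    have cf: "A m (long_cycle m) f \<in> elems P m" "A n (long_cycle n) g \<in> elems P n"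
      by (rule cl[OF m cyc(1) *(4)] cl[OF *(3) cyc(1) *(5)])+
    have J: "A m (long_cycle m) f \<in> J m \<or> g \<in> J n"
      "A n (long_cycle n) g \<in> J n \<or> A m (long_cycle m) f \<in> J m"
      using *(6) J_act[OF m cyc(1)] J_act[OF *(3) cyc(1)] by blast+
    have "A (m + n - 1) (long_cycle (m + n - 1) ^^ Suc k) (pcomp P m n i f g)
        = A (m + n - 1) (long_cycle (m + n - 1) ^^ k)
            (A (m + n - 1) (long_cycle (m + n - 1)) (pcomp P m n i f g))"
      unfolding funpow_Suc_right by (rule act_comp[OF N(1) cyc(2,1) pcomp_closed[OF *(1-5)]])
    also have "\<dots> \<in> I (m + n - 1)"
    proof (cases "i = 1")
      case True
      let ?h = "pcomp P n m n (A n (long_cycle n) g) (A m (long_cycle m) f)"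
      have h: "?h \<in> elems P (m + n - 1)"
        using pcomp_closed[OF *(3) order_refl m cf(2,1)] N(2) by simp
      have "A (m + n - 1) (long_cycle (m + n - 1) ^^ k) ?h \<in> I (m + n - 1)"
        using Suc.IH[OF *(3) order_refl m cf(2,1) J(2)] unfolding N(2) .
      then have "\<ominus>\<^bsub>comp_space P (m + n - 1)\<^esub> A (m + n - 1) (long_cycle (m + n - 1) ^^ k) ?h
          \<in> I (m + n - 1)"
        by (rule submodule_minus[OF comp_space[OF N(1)] operad_idealD(1)[OF I N(1)]])
      then show ?thesis
        unfolding True cycle_pcomp_1[OF m *(3-5)]
          linear_minus[OF act_linear[OF N(1) cyc(2)] comp_space[OF N(1)] comp_space[OF N(1)] h] .
    next
      case False
      then have i: "2 \<le> i" "1 \<le> i - 1" "i - 1 \<le> m" using * by auto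
      show ?thesis
        unfolding cycle_pcomp[OF i(1) *(2-5)]
        by (rule Suc.IH[OF i(2,3) *(3) cf(1) *(5) J(1)])
    qed
    finally show ?case .
  qed
  have comp_J: "pcomp P m n i f g \<in> J (m + n - 1)"
    if *: "1 \<le> i" "i \<le> m" "1 \<le> n" "f \<in> elems P m" "g \<in> elems P n" "f \<in> J m \<or> g \<in> J n" for i m n f g
  proof -
    have N: "1 \<le> m + n - 1" using * by auto
    have "A (m + n - 1) \<sigma> (pcomp P m n i f g) \<in> I (m + n - 1)"
      if \<sigma>: "\<sigma> permutes {1..m + n - 1 + 1}" for \<sigma>
    proof -
      obtain \<theta> k where \<theta>: "\<theta> permutes {1..m + n - 1}" "\<sigma> = \<theta> \<circ> long_cycle (m + n - 1) ^^ k"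
        using permutes_decomp[OF \<sigma>] by metis
      note c = pcomp_closed[OF *(1-5)]
      have "A (m + n - 1) \<sigma> (pcomp P m n i f g) = perm_act P (m + n - 1) \<theta>
          (A (m + n - 1) (long_cycle (m + n - 1) ^^ k) (pcomp P m n i f g))"
        unfolding \<theta>(2) act_comp[OF N permutes_Suc[OF \<theta>(1)] long_cycle_pow_permutes c]
        by (rule act_extends[OF N \<theta>(1) cl[OF N long_cycle_pow_permutes c]])
      then show ?thesis
        using sym_operad_idealD(2)[OF sI N \<theta>(1) cycle_I[OF *]] by simp
    qed
    then show ?thesis using comp_I[OF *] by (simp add: J_def)
  qed
  have "sym_operad_ideal P J"
  proof (intro sym_operad_idealI operad_idealI)
    fix n :: nat assume n: "1 \<le> n"
    note M = comp_space[OF n] and N = operad_idealD(1)[OF I n]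
    show "submodule (J n) rat_field (comp_space P n)"
    proof (rule rat_submoduleI[OF M])
      show "J n \<subseteq> elems P n" using JI IP[OF n] by blast
      show "\<zero>\<^bsub>comp_space P n\<^esub> \<in> J n"
        using submodule_zero[OF M N] linear_zero[OF act_linear[OF n] M M] by (simp add: J_def)
      show "x \<oplus>\<^bsub>comp_space P n\<^esub> y \<in> J n" if "x \<in> J n" "y \<in> J n" for x y
        using that n IP[OF n] linear_add[OF act_linear[OF n]] submodule_add[OF M N]
        by (simp add: J_def)
      show "c \<odot>\<^bsub>comp_space P n\<^esub> x \<in> J n" if "x \<in> J n" for c x
        using that n IP[OF n] linear_smult[OF act_linear[OF n]] submodule_smult[OF M N]
        by (simp add: J_def)
    qed
    fix \<sigma> f assume \<sigma>: "\<sigma> permutes {1..n}" and f: "f \<in> J n"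
    show "perm_act P n \<sigma> f \<in> J n"
      using J_act[OF n permutes_Suc[OF \<sigma>] f] act_extends[OF n \<sigma> IP[OF n JI[OF f]]] by simp
  next
    fix i m n :: nat and f g
    assume *: "1 \<le> i" "i \<le> m" "1 \<le> n" "f \<in> elems P m" "g \<in> J n"
    then show "pcomp P m n i f g \<in> J (m + n - 1)"
      using comp_J[OF *(1-4) IP[OF *(3) JI[OF *(5)]]] by blast
  next
    fix i m n :: nat and f g
    assume *: "1 \<le> i" "i \<le> m" "1 \<le> n" "f \<in> J m" "g \<in> elems P n"
    then have "1 \<le> m" by simp
    then show "pcomp P m n i f g \<in> J (m + n - 1)"
      using comp_J[OF *(1-3) IP[OF _ JI[OF *(4)]] *(5)] *(4) by blast
  qed
  moreover have "S k \<subseteq> J k" for k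
    using act_S ideal_generated_incl[of S k "sym_operad_ideal P"] by (auto simp: J_def I_def)
  ultimately have "I n \<subseteq> J n" unfolding I_def by (rule ideal_generated_least)
  then show ?thesis using f n \<sigma> by (auto simp: J_def)
qed


section \<open>The anticyclic structure of Zinb\<close>

interpretation dend: ns_anticyclic_operad ns_Dend dend_tau
  by (rule dend_tau_anticyclic)

interpretation Dend: anticyclic_operad Dend dend_act
  unfolding Dend_def dend_act_def by (rule dend.symm_anticyclic_operad)

lemma funpow_2:
  fixes h :: "'c \<Rightarrow> 'c"
  shows "(h ^^ 2) x = h (h x)"
  by (simp add: numeral_2_eq_2)

lemma long_cycle_2_transpose:
  "long_cycle 2 \<circ> transpose 1 2 = transpose 1 2 \<circ> long_cycle 2 ^^ 2"
  "long_cycle 2 ^^ 2 \<circ> transpose 1 2 = transpose 1 2 \<circ> long_cycle 2 ^^ 1"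
proof -
  have t: "transpose 1 2 permutes {1..2 + 1 :: nat}"
    by (rule permutes_swap_id) auto
  have c: "long_cycle 2 x = (if x = 1 then 3 else if x = 2 then 1 else if x = 3 then 2 else x)" for x
    by (auto simp: long_cycle_def)
  note p = permutes_compose[OF t long_cycle_permutes] permutes_compose[OF t long_cycle_pow_permutes]
    permutes_compose[OF long_cycle_pow_permutes t]
  have x: "x = 1 \<or> x = 2 \<or> x = 3" if "x \<in> {1..2 + 1}" for x :: nat
    using that by auto
  show "long_cycle 2 \<circ> transpose 1 2 = transpose 1 2 \<circ> long_cycle 2 ^^ 2"
    by (rule permutes_eqI[OF p(1,3)])
      (auto dest!: x simp: c funpow_2 transpose_def)
  show "long_cycle 2 ^^ 2 \<circ> transpose 1 2 = transpose 1 2 \<circ> long_cycle 2 ^^ 1"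
    by (rule permutes_eqI[OF p(2,3)])
      (auto dest!: x simp: c funpow_2 transpose_def funpow_1)
qed

lemma zinb_relations_subset: "zinb_relations n \<subseteq> elems Dend n"
proof -
  interpret M: module rat_field "comp_space Dend 2" by (rule Dend.comp_space) simp
  show ?thesis
    unfolding zinb_relations_def
    using dend.pure_tensor_closed[of 2] dend_op_closed
    by (auto simp: Dend_def[symmetric] intro!: M.minus_closed)
qed

lemma zinb_ideal: "sym_operad_ideal Dend zinb_ideal"
  unfolding zinb_ideal_def by (rule Dend.sym_operad_ideal_generated[OF zinb_relations_subset])

text \<open>
  For \<open>r = x\<^sub>1 \<prec> x\<^sub>2 - x\<^sub>2 \<succ> x\<^sub>1\<close> and the transposition \<open>s\<close>, the long cycle \<open>c\<close> on three letters
  satisfies \<open>c r = - r + s r\<close> and \<open>c\<^sup>2 r = - s r\<close>.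
\<close>

lemma dend_act_zinb_relations:
  assumes n: "1 \<le> n" and \<sigma>: "\<sigma> permutes {1..n + 1}" and f: "f \<in> zinb_relations n"
  shows "dend_act n \<sigma> f \<in> zinb_ideal n"
proof -
  let ?pure = "pure_tensor ns_Dend 2" and ?s = "transpose 1 2 :: nat \<Rightarrow> nat"
  define r where "r = ?pure (dend_op Prec) id \<ominus>\<^bsub>comp_space Dend 2\<^esub> ?pure (dend_op Succ) ?s"
  define r' where "r' = ?pure (dend_op Prec) ?s \<ominus>\<^bsub>comp_space Dend 2\<^esub> ?pure (dend_op Succ) id"
  have n2: "n = 2" and fr: "f = r"
    using f by (auto simp: zinb_relations_def r_def split: if_splits)
  have two: "(1 :: nat) \<le> 2" by simp
  have s: "?s permutes {1..2}" by (rule permutes_swap_id) auto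
  interpret M: module rat_field "comp_space Dend 2" by (rule Dend.comp_space[OF two])
  interpret N: module rat_field "comp_space ns_Dend 2" by (rule dend.comp_space[OF two])
  note I = Dend.comp_space[OF two] operad_idealD(1)[OF sym_operad_idealD(1)[OF zinb_ideal] two]
  have cl: "?pure (dend_op g) \<sigma> \<in> elems Dend 2" for g \<sigma>
    unfolding Dend_def by (rule dend.pure_tensor_closed[OF two dend_op_closed])
  have lin: "(\<lambda>E. ?pure E \<sigma>) \<in> linear_maps (comp_space ns_Dend 2) (comp_space Dend 2)" for \<sigma>
    unfolding Dend_def by (rule dend.pure_tensor_linear[OF two])
  have act: "dend_act 2 \<rho> (?pure (dend_op g) \<sigma>) = ?pure ((dend_tau 2 ^^ k) (dend_op g)) \<theta>"
    if "\<rho> permutes {1..2 + 1}" "\<sigma> permutes {1..2}" "\<theta> permutes {1..2}"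
      "\<rho> \<circ> \<sigma> = \<theta> \<circ> long_cycle 2 ^^ k" for \<rho> \<sigma> \<theta> k g
    unfolding dend_act_def by (rule dend.act_pure[OF two that(1-3) dend_op_closed that(4)])
  note cyc = long_cycle_permutes[of 2] long_cycle_pow_permutes[where n = 2 and k = 2]
  have tau1: "(dend_tau 2 ^^ 1) (dend_op Succ) = dend_op Prec"
    "(dend_tau 2 ^^ 1) (dend_op Prec) = dend_tau 2 (dend_op Prec)"
    by (simp_all only: funpow_1 dend_tau_Succ)
  have tau2: "(dend_tau 2 ^^ 2) (dend_op Succ) = dend_tau 2 (dend_op Prec)"
    by (simp only: funpow_2 dend_tau_Succ)
  \<comment> \<open>from \<open>\<tau>(\<succ>) = \<prec>\<close> and \<open>\<tau>\<^sup>3 = 1\<close>\<close>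
  have tau2': "(dend_tau 2 ^^ 2) (dend_op Prec) = dend_op Succ"
  proof -
    have "(dend_tau 2 ^^ 2) (dend_op Prec) = (dend_tau 2 ^^ (2 + 1)) (dend_op Succ)"
      unfolding dend_tau_Succ[symmetric] funpow_add funpow_1 by simp
    then show ?thesis using dend.tau_order[OF two dend_op_closed] by simp
  qed
  have pure_tau: "?pure (dend_tau 2 (dend_op Prec)) \<sigma>
      = (\<ominus>\<^bsub>comp_space Dend 2\<^esub> ?pure (dend_op Prec) \<sigma>)
          \<ominus>\<^bsub>comp_space Dend 2\<^esub> ?pure (dend_op Succ) \<sigma>" for \<sigma>
    unfolding dend_tau_Prec
      linear_diff[OF lin N.module_axioms M.module_axioms N.a_inv_closed[OF dend_op_closed] dend_op_closed]
      linear_minus[OF lin N.module_axioms M.module_axioms dend_op_closed] ..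
  have diff: "dend_act 2 \<rho> (x \<ominus>\<^bsub>comp_space Dend 2\<^esub> y)
      = dend_act 2 \<rho> x \<ominus>\<^bsub>comp_space Dend 2\<^esub> dend_act 2 \<rho> y"
    if "\<rho> permutes {1..2 + 1}" "x \<in> elems Dend 2" "y \<in> elems Dend 2" for \<rho> x y
    by (rule linear_diff[OF Dend.act_linear[OF two that(1)] I(1) I(1) that(2,3)])
  have id1: "long_cycle 2 \<circ> id = id \<circ> long_cycle 2 ^^ 1"
    and id2: "long_cycle 2 ^^ 2 \<circ> id = id \<circ> long_cycle 2 ^^ 2"
    by (simp_all only: comp_id id_comp funpow_1)
  have r: "r \<in> zinb_ideal 2"
    using ideal_generated_incl[of zinb_relations 2 "sym_operad_ideal Dend"]
    by (auto simp: zinb_relations_def r_def zinb_ideal_def)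
  have rc: "r \<in> elems Dend 2" by (rule subsetD[OF submodule_subset[OF I] r])
  have "dend_act 2 ?s r = r'"
  proof -
    have a: "?s \<circ> id = ?s \<circ> long_cycle 2 ^^ 0" "?s \<circ> ?s = id \<circ> long_cycle 2 ^^ 0"
      by (auto simp: fun_eq_iff)
    show ?thesis
      unfolding r_def diff[OF permutes_Suc[OF s] cl cl] r'_def
        act[OF permutes_Suc[OF s] permutes_id s a(1)] act[OF permutes_Suc[OF s] s permutes_id a(2)]
      by simp
  qed
  then have "perm_act Dend 2 ?s r = r'"
    unfolding Dend.act_extends[OF two s rc] .
  then have r': "r' \<in> zinb_ideal 2"
    using sym_operad_idealD(2)[OF zinb_ideal two s r] by (simp only:)
  have c1: "dend_act 2 (long_cycle 2) r = (\<ominus>\<^bsub>comp_space Dend 2\<^esub> r) \<oplus>\<^bsub>comp_space Dend 2\<^esub> r'"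
  proof -
    let ?a = "?pure (dend_op Prec) id" and ?b = "?pure (dend_op Succ) id"
      and ?a' = "?pure (dend_op Prec) ?s" and ?b' = "?pure (dend_op Succ) ?s"
    have "dend_act 2 (long_cycle 2) r
        = ((\<ominus>\<^bsub>comp_space Dend 2\<^esub> ?a) \<ominus>\<^bsub>comp_space Dend 2\<^esub> ?b) \<ominus>\<^bsub>comp_space Dend 2\<^esub>
          ((\<ominus>\<^bsub>comp_space Dend 2\<^esub> ?a') \<ominus>\<^bsub>comp_space Dend 2\<^esub> ?b')"
      unfolding r_def diff[OF cyc(1) cl cl]
        act[OF cyc(1) permutes_id permutes_id id1]
        act[OF cyc(1) s s long_cycle_2_transpose(1)] tau1 tau2 pure_tau ..
    also have "\<dots> = (\<ominus>\<^bsub>comp_space Dend 2\<^esub> r) \<oplus>\<^bsub>comp_space Dend 2\<^esub> r'"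
      unfolding r_def r'_def
      using cl[of Prec id] cl[of Succ id] cl[of Prec ?s] cl[of Succ ?s]
      by (simp add: a_minus_def M.minus_add M.a_ac)
    finally show ?thesis .
  qed
  have c2: "dend_act 2 (long_cycle 2 ^^ 2) r = \<ominus>\<^bsub>comp_space Dend 2\<^esub> r'"
  proof -
    have "dend_act 2 (long_cycle 2 ^^ 2) r
        = ?pure (dend_op Succ) id \<ominus>\<^bsub>comp_space Dend 2\<^esub> ?pure (dend_op Prec) ?s"
      unfolding r_def diff[OF cyc(2) cl cl]
        act[OF cyc(2) permutes_id permutes_id id2]
        act[OF cyc(2) s s long_cycle_2_transpose(2)] tau1 tau2' ..
    also have "\<dots> = \<ominus>\<^bsub>comp_space Dend 2\<^esub> r'"
      unfolding r'_def
      using cl[of Succ id] cl[of Prec ?s] by (simp add: a_minus_def M.minus_add M.a_ac)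
    finally show ?thesis .
  qed
  obtain \<theta> k where \<theta>: "k \<le> 2" "\<theta> permutes {1..2}" "\<sigma> = \<theta> \<circ> long_cycle 2 ^^ k"
    using permutes_decomp[OF \<sigma>[unfolded n2]] .
  consider "k = 0" | "k = 1" | "k = 2" using \<theta>(1) by linarith
  then have "dend_act 2 (long_cycle 2 ^^ k) r \<in> zinb_ideal 2"
  proof cases
    case 1
    then show ?thesis using Dend.act_id[OF two rc] r by (simp add: id_def)
  next
    case 2
    show ?thesis
      unfolding 2 funpow_1 c1 by (intro submodule_add[OF I] submodule_minus[OF I] r r')
  next
    case 3
    show ?thesis unfolding 3 c2 by (rule submodule_minus[OF I r'])
  qed
  then have "perm_act Dend 2 \<theta> (dend_act 2 (long_cycle 2 ^^ k) r) \<in> zinb_ideal 2"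
    by (rule sym_operad_idealD(2)[OF zinb_ideal two \<theta>(2)])
  moreover have "dend_act 2 \<sigma> r = perm_act Dend 2 \<theta> (dend_act 2 (long_cycle 2 ^^ k) r)"
    unfolding \<theta>(3) Dend.act_comp[OF two permutes_Suc[OF \<theta>(2)] long_cycle_pow_permutes rc]
    by (rule Dend.act_extends[OF two \<theta>(2) linear_closed[OF Dend.act_linear[OF two
            long_cycle_pow_permutes] rc]])
  ultimately show ?thesis unfolding n2 fr by simp
qed

lemma dend_act_zinb_ideal:
  "1 \<le> n \<Longrightarrow> \<sigma> permutes {1..n + 1} \<Longrightarrow> f \<in> zinb_ideal n \<Longrightarrow> dend_act n \<sigma> f \<in> zinb_ideal n"
  unfolding zinb_ideal_def
  by (rule Dend.act_stable_ideal[OF zinb_relations_subset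
        dend_act_zinb_relations[unfolded zinb_ideal_def]])

lemma zinb_surjection: "operad_surjection Dend Zinb zinb_proj"
  unfolding zinb_proj_def
  by (rule Dend.quot_surjection[OF sym_operad_idealD(1)[OF zinb_ideal]])
    (simp_all add: Zinb_def quot_sym_operad_def operad.extend_def quot_operad_def)

interpretation zinb: operad_surjection Dend Zinb zinb_proj
  by (rule zinb_surjection)

lemma zinb_hom: "sym_operad_hom Dend Zinb zinb_proj"
proof (rule sym_operad_surjection[OF zinb_surjection Dend.sym_operad_axioms])
  fix n :: nat and \<sigma> f assume n: "1 \<le> n" and \<sigma>: "\<sigma> permutes {1..n}" and f: "f \<in> elems Dend n"
  note I = Dend.comp_space[OF n] operad_idealD(1)[OF sym_operad_idealD(1)[OF zinb_ideal] n]
  show "perm_act Zinb n \<sigma> (zinb_proj n f) = zinb_proj n (perm_act Dend n \<sigma> f)"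
    using coset_map[OF I I Dend.perm_act_linear[OF n \<sigma>] sym_operad_idealD(2)[OF zinb_ideal n \<sigma>] f]
    by (simp add: Zinb_def quot_sym_operad_def operad.extend_def zinb_proj_def quot_proj_def)
qed

definition zinb_act :: "nat \<Rightarrow> (nat \<Rightarrow> nat) \<Rightarrow> dend_elem set \<Rightarrow> dend_elem set" where
  "zinb_act n \<sigma> U = (if 1 \<le> n \<and> \<sigma> permutes {1..n + 1} \<and> U \<in> elems Zinb n
     then \<Union>f\<in>U. zinb_proj n (dend_act n \<sigma> f) else undefined)"

lemma zinb_act_proj:
  assumes n: "1 \<le> n" and \<sigma>: "\<sigma> permutes {1..n + 1}" and f: "f \<in> elems Dend n"
  shows "zinb_act n \<sigma> (zinb_proj n f) = zinb_proj n (dend_act n \<sigma> f)"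
proof -
  note I = Dend.comp_space[OF n] operad_idealD(1)[OF sym_operad_idealD(1)[OF zinb_ideal] n]
  show ?thesis
    using coset_map[OF I I Dend.act_linear[OF n \<sigma>] dend_act_zinb_ideal[OF n \<sigma>] f]
      zinb.proj_closed[OF n f] n \<sigma>
    by (simp add: zinb_act_def zinb_proj_def quot_proj_def)
qed

theorem theorem5p9:
  shows "\<exists>!A. extensional_act Zinb A \<and> anticyclic_operad Zinb A \<and>
           anticyclic_operad_hom Dend dend_act Zinb A zinb_proj"
proof (rule ex1I)
  have hom: "anticyclic_operad_hom Dend dend_act Zinb zinb_act zinb_proj"
    by (rule anticyclic_operad_surjection[where B = zinb_act and A = dend_act,
          OF zinb_surjection zinb_hom Dend.anticyclic_operad_axioms zinb_act_proj])
  have undef: "extensional_act Zinb zinb_act"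
    by (simp add: extensional_act_def zinb_act_def)
  show "extensional_act Zinb zinb_act \<and> anticyclic_operad Zinb zinb_act \<and>
      anticyclic_operad_hom Dend dend_act Zinb zinb_act zinb_proj"
    using undef hom anticyclic_operad_hom.axioms(3)[OF hom] by blast
  fix A
  assume *: "extensional_act Zinb A \<and> anticyclic_operad Zinb A \<and>
      anticyclic_operad_hom Dend dend_act Zinb A zinb_proj"
  then interpret A: anticyclic_operad_hom Dend dend_act Zinb A zinb_proj by blast
  show "A = zinb_act"
  proof (intro ext)
    fix n \<sigma> U
    show "A n \<sigma> U = zinb_act n \<sigma> U"
    proof (cases "1 \<le> n \<and> \<sigma> permutes {1..n + 1} \<and> U \<in> elems Zinb n")
      case True
      then obtain f where f: "f \<in> elems Dend n" "U = zinb_proj n f" by (auto simp: zinb.proj_surj)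
      show ?thesis
        using True zinb_act_proj[of n \<sigma> f] A.hom_act[of n \<sigma> f] f by simp
    next
      case False
      then show ?thesis using * undef unfolding extensional_act_def by metis
    qed
  qed
qed

end
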